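(* Let $(\mathcal C,\mathbb E,\mathfrak s)$ be a $2$-Calabi-Yau extriangulated category with enough projectives and enough injectives. Then any almost complete cluster tilting subcategory $\mathcal X$ of $\mathcal C$ is contained in exactly two cluster tilting subcategories $\mathcal R$ and $\mathcal Q$ of $\mathcal C$. Both $(\mathcal R,\mathcal Q)$ and $(\mathcal Q,\mathcal R)$ form $\mathcal X$-mutation pairs.
   Context: Conventions: all additive categories are Krull-Schmidt; a subcategory is a full subcategory closed under isomorphisms, finite direct sums and direct summands; $\mathrm{add}\,M$ is the subcategory of direct summands of finite direct sums of copies of $M$. Extriangulated category: a triple $(\mathcal C,\mathbb E,\mathfrak s)$ with $\mathcal C$ additive, $\mathbb E:\mathcal C^{\mathrm{op}}\times\mathcal C\to\mathrm{Ab}$ a biadditive functor, and $\mathfrak s$ assigning to each $\delta\in\mathbb E(C,A)$ an equivalence class $\mathfrak s(\delta)=[A\xrightarrow{x}B\xrightarrow{y}C]$ of sequences (equivalence: an isomorphism of middle terms compatible with the identities of the ends). One says $A\to B\to C$ realizes $\delta$ and calls $A\to B\to C\overset{\delta}{\dashrightarrow}$ an $\mathbb E$-triangle. Write $a_*\delta=\mathbb E(C,a)(\delta)$, $c^*\delta=\mathbb E(c,A)(\delta)$; a morphism $\delta\to\delta'$ with $\delta'\in\mathbb E(C',A')$ is a pair $(a:A\to A',c:C\to C')$ with $a_*\delta=c^*\delta'$. Axioms: every morphism $(a,c):\delta\to\delta'$ is realized by some $b$ with $bx=x'a$, $y'b=cy$; $\mathfrak s(0)$ is the split sequence and $\mathfrak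 s(\delta\oplus\delta')=\mathfrak s(\delta)\oplus\mathfrak s(\delta')$; (ET3) if $bx=x'a$ there is $c$ with $cy=y'b$ and $(a,c):\delta\to\delta'$ a morphism, and dually (ET3)$^{\rm op}$; (ET4) if $A\xrightarrow{f}B\xrightarrow{f'}D$ realizes $\delta$ and $B\xrightarrow{g}C\xrightarrow{g'}F$ realizes $\delta'$, there are an object $E$, morphisms $h':C\to E$, $d:D\to E$, $e:E\to F$ with $h'g=df'$, $eh'=g'$, and $\delta''\in\mathbb E(E,A)$ realized by $A\xrightarrow{gf}C\xrightarrow{h'}E$, such that $D\xrightarrow{d}E\xrightarrow{e}F$ realizes $f'_*\delta'$, $d^*\delta''=\delta$, $f_*\delta''=e^*\delta'$; and dually (ET4)$^{\rm op}$. $P$ is projective if every morphism $P\to C$ lifts along $y$ for every $\mathbb E$-triangle $A\to B\xrightarrow{y}C\dashrightarrow$; injectives are dual. $\mathrm{Proj}(\mathcal C)$ is the subcategory of projectives. Enough projectives: every $C$ has an $\mathbb E$-triangle $A\to P\to C\dashrightarrow$ with $P$ projective; enough injectives dually. $2$-Calabi-Yau: $\mathcal C$ is $k$-linear over a field $k$, all $\mathrm{Hom}(A,B)$ and $\mathbb E(A,B)$ are finite dimensional, and there is a bifunctorial isomorphism $\mathbb E(A,B)\simeq\mathrm{Hom}_k(\mathbb E(B,A),k)$. A subcategory $\mathcal R$ is rigid if $\mathbb E(\mathcal R,\mathcal R)=0$; it is cluster tilting if it is functorially finite and $M\in\mathcal R\iff\mathbb E(M,\mathcal R)=0\iff\mathbb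 E(\mathcal R,M)=0$. A functorially finite rigid subcategory $\mathcal X$ with $\mathrm{Proj}(\mathcal C)\subseteq\mathcal X$ is almost complete cluster tilting if there is a cluster tilting subcategory $\mathcal R\supseteq\mathcal X$ and an indecomposable object $R_0$ not isomorphic to any object of $\mathcal X$ such that the indecomposables of $\mathcal R$ are those of $\mathcal X$ together with $R_0$. For subcategories $\mathcal X\subseteq\mathcal A$, $\mathcal X\subseteq\mathcal B$ of $\mathcal C$, $(\mathcal A,\mathcal B)$ is an $\mathcal X$-mutation pair if (1) for any $A\in\mathcal A$ there is an $\mathbb E$-triangle $A\xrightarrow{\alpha}X\xrightarrow{\beta}B\dashrightarrow$ with $B\in\mathcal B$, $\alpha$ a left and $\beta$ a right $\mathcal X$-approximation (in particular $X\in\mathcal X$), and (2) for any $B\in\mathcal B$ there is such an $\mathbb E$-triangle with $A\in\mathcal A$. *)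

theory Defs
  imports "Jordan_Normal_Form.Missing_VectorSpace"
begin

section \<open>Categories\<close>

text \<open>
  The morphism sets carry a module record over the type of scalars. For a preadditive category only
  its additive part (\<open>carrier\<close>, \<open>zero\<close>, \<open>add\<close>) is relevant; scalar multiplication enters with
  \<open>linear_extriangulated_category\<close>. The fields \<open>mult\<close> and \<open>one\<close> are never used.
\<close>

record ('o, 'm, 'k) precat =
  Ob :: "'o set"
  Mor :: "'o \<Rightarrow> 'o \<Rightarrow> ('k, 'm) module"
  composition :: "'m \<Rightarrow> 'm \<Rightarrow> 'm"  (infixl \<open>\<cdot>\<index>\<close> 75)
  ident :: "'o \<Rightarrow> 'm"

definition arr :: "('o, 'm, 'k, 'z) precat_scheme \<Rightarrow> 'm \<Rightarrow> 'o \<Rightarrow> 'o \<Rightarrow> bool"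
    (\<open>\<guillemotleft>_ : _ \<rightarrow> _\<guillemotright>\<index>\<close>) where
  "\<guillemotleft>f : A \<rightarrow> B\<guillemotright>\<^bsub>\<C>\<^esub> \<longleftrightarrow> A \<in> Ob \<C> \<and> B \<in> Ob \<C> \<and> f \<in> carrier (Mor \<C> A B)"

locale category =
  fixes \<C> :: "('o, 'm, 'k, 'z) precat_scheme" (structure)
  assumes dom_cod_unique: "\<guillemotleft>f : A \<rightarrow> B\<guillemotright> \<Longrightarrow> \<guillemotleft>f : A' \<rightarrow> B'\<guillemotright> \<Longrightarrow> A = A' \<and> B = B'"
    and ident_arr: "A \<in> Ob \<C> \<Longrightarrow> \<guillemotleft>ident \<C> A : A \<rightarrow> A\<guillemotright>"
    and comp_arr: "\<guillemotleft>f : A \<rightarrow> B\<guillemotright> \<Longrightarrow> \<guillemotleft>g : B \<rightarrow> D\<guillemotright> \<Longrightarrow> \<guillemotleft>g \<cdot> f : A \<rightarrow> D\<guillemotright>"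
    and comp_ident_left: "\<guillemotleft>f : A \<rightarrow> B\<guillemotright> \<Longrightarrow> ident \<C> B \<cdot> f = f"
    and comp_ident_right: "\<guillemotleft>f : A \<rightarrow> B\<guillemotright> \<Longrightarrow> f \<cdot> ident \<C> A = f"
    and comp_assoc: "\<guillemotleft>f : A \<rightarrow> B\<guillemotright> \<Longrightarrow> \<guillemotleft>g : B \<rightarrow> D\<guillemotright> \<Longrightarrow> \<guillemotleft>h : D \<rightarrow> E\<guillemotright> \<Longrightarrow>
          h \<cdot> (g \<cdot> f) = (h \<cdot> g) \<cdot> f"

definition is_iso :: "('o, 'm, 'k, 'z) precat_scheme \<Rightarrow> 'm \<Rightarrow> 'o \<Rightarrow> 'o \<Rightarrow> bool" where
  "is_iso \<C> f A B \<longleftrightarrow> \<guillemotleft>f : A \<rightarrow> B\<guillemotright>\<^bsub>\<C>\<^esub> \<and>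
     (\<exists>g. \<guillemotleft>g : B \<rightarrow> A\<guillemotright>\<^bsub>\<C>\<^esub> \<and> g \<cdot>\<^bsub>\<C>\<^esub> f = ident \<C> A \<and> f \<cdot>\<^bsub>\<C>\<^esub> g = ident \<C> B)"

definition isomorphic :: "('o, 'm, 'k, 'z) precat_scheme \<Rightarrow> 'o \<Rightarrow> 'o \<Rightarrow> bool" where
  "isomorphic \<C> A B \<longleftrightarrow> (\<exists>f. is_iso \<C> f A B)"

definition zero_object :: "('o, 'm, 'k, 'z) precat_scheme \<Rightarrow> 'o \<Rightarrow> bool" where
  "zero_object \<C> Z \<longleftrightarrow> Z \<in> Ob \<C> \<and>
     (\<forall>A\<in>Ob \<C>. (\<exists>!f. \<guillemotleft>f : Z \<rightarrow> A\<guillemotright>\<^bsub>\<C>\<^esub>) \<and> (\<exists>!f. \<guillemotleft>f : A \<rightarrow> Z\<guillemotright>\<^bsub>\<C>\<^esub>))"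


section \<open>Additive and Krull-Schmidt categories\<close>

locale preadditive_category = category +
  assumes mor_abelian_group: "A \<in> Ob \<C> \<Longrightarrow> B \<in> Ob \<C> \<Longrightarrow> abelian_group (Mor \<C> A B)"
    and comp_add_left: "\<guillemotleft>f : A \<rightarrow> B\<guillemotright> \<Longrightarrow> \<guillemotleft>g : B \<rightarrow> D\<guillemotright> \<Longrightarrow> \<guillemotleft>g' : B \<rightarrow> D\<guillemotright> \<Longrightarrow>
          (g \<oplus>\<^bsub>Mor \<C> B D\<^esub> g') \<cdot> f = g \<cdot> f \<oplus>\<^bsub>Mor \<C> A D\<^esub> g' \<cdot> f"
    and comp_add_right: "\<guillemotleft>f : A \<rightarrow> B\<guillemotright> \<Longrightarrow> \<guillemotleft>f' : A \<rightarrow> B\<guillemotright> \<Longrightarrow> \<guillemotleft>g : B \<rightarrow> D\<guillemotright> \<Longrightarrow>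
          g \<cdot> (f \<oplus>\<^bsub>Mor \<C> A B\<^esub> f') = g \<cdot> f \<oplus>\<^bsub>Mor \<C> A D\<^esub> g \<cdot> f'"

definition is_biproduct ::
    "('o, 'm, 'k, 'z) precat_scheme \<Rightarrow> 'o \<Rightarrow> 'o \<Rightarrow> 'o \<Rightarrow> 'm \<Rightarrow> 'm \<Rightarrow> 'm \<Rightarrow> 'm \<Rightarrow> bool" where
  "is_biproduct \<C> A B S i\<^sub>1 i\<^sub>2 p\<^sub>1 p\<^sub>2 \<longleftrightarrow>
     \<guillemotleft>i\<^sub>1 : A \<rightarrow> S\<guillemotright>\<^bsub>\<C>\<^esub> \<and> \<guillemotleft>i\<^sub>2 : B \<rightarrow> S\<guillemotright>\<^bsub>\<C>\<^esub> \<and> \<guillemotleft>p\<^sub>1 : S \<rightarrow> A\<guillemotright>\<^bsub>\<C>\<^esub> \<and> \<guillemotleft>p\<^sub>2 : S \<rightarrow> B\<guillemotright>\<^bsub>\<C>\<^esub> \<and>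
     p\<^sub>1 \<cdot>\<^bsub>\<C>\<^esub> i\<^sub>1 = ident \<C> A \<and> p\<^sub>2 \<cdot>\<^bsub>\<C>\<^esub> i\<^sub>2 = ident \<C> B \<and>
     p\<^sub>2 \<cdot>\<^bsub>\<C>\<^esub> i\<^sub>1 = \<zero>\<^bsub>Mor \<C> A B\<^esub> \<and> p\<^sub>1 \<cdot>\<^bsub>\<C>\<^esub> i\<^sub>2 = \<zero>\<^bsub>Mor \<C> B A\<^esub> \<and>
     i\<^sub>1 \<cdot>\<^bsub>\<C>\<^esub> p\<^sub>1 \<oplus>\<^bsub>Mor \<C> S S\<^esub> i\<^sub>2 \<cdot>\<^bsub>\<C>\<^esub> p\<^sub>2 = ident \<C> S"

text \<open>\<open>S\<close> is a direct sum of the family \<open>A 0, \<dots>, A (n - 1)\<close>; for \<open>n = 0\<close> it is a zero object.\<close>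

definition is_direct_sum ::
    "('o, 'm, 'k, 'z) precat_scheme \<Rightarrow> nat \<Rightarrow> (nat \<Rightarrow> 'o) \<Rightarrow> 'o \<Rightarrow> bool" where
  "is_direct_sum \<C> n A S \<longleftrightarrow> S \<in> Ob \<C> \<and>
     (\<exists>i p. (\<forall>j<n. \<guillemotleft>i j : A j \<rightarrow> S\<guillemotright>\<^bsub>\<C>\<^esub> \<and> \<guillemotleft>p j : S \<rightarrow> A j\<guillemotright>\<^bsub>\<C>\<^esub>) \<and>
            (\<forall>j<n. \<forall>l<n. p j \<cdot>\<^bsub>\<C>\<^esub> i l = (if j = l then ident \<C> (A j) else \<zero>\<^bsub>Mor \<C> (A l) (A j)\<^esub>)) \<and>
            (\<Oplus>\<^bsub>Mor \<C> S S\<^esub> j\<in>{..<n}. i j \<cdot>\<^bsub>\<C>\<^esub> p j) = ident \<C> S)"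

locale additive_category = preadditive_category +
  assumes ex_zero_object: "\<exists>Z. zero_object \<C> Z"
    and ex_biproduct: "A \<in> Ob \<C> \<Longrightarrow> B \<in> Ob \<C> \<Longrightarrow>
          \<exists>S i\<^sub>1 i\<^sub>2 p\<^sub>1 p\<^sub>2. is_biproduct \<C> A B S i\<^sub>1 i\<^sub>2 p\<^sub>1 p\<^sub>2"

definition End_ring :: "('o, 'm, 'k, 'z) precat_scheme \<Rightarrow> 'o \<Rightarrow> 'm ring" where
  "End_ring \<C> A =
     \<lparr>carrier = carrier (Mor \<C> A A), mult = composition \<C>, one = ident \<C> A,
      zero = \<zero>\<^bsub>Mor \<C> A A\<^esub>, add = add (Mor \<C> A A)\<rparr>"

text \<open>Local rings need not be commutative here.\<close>

definition local_ring :: "('a, 'b) ring_scheme \<Rightarrow> bool" where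
  "local_ring R \<longleftrightarrow> ring R \<and> \<one>\<^bsub>R\<^esub> \<noteq> \<zero>\<^bsub>R\<^esub> \<and>
     (\<forall>a\<in>carrier R - Units R. \<forall>b\<in>carrier R - Units R. a \<oplus>\<^bsub>R\<^esub> b \<notin> Units R)"

locale krull_schmidt_category = additive_category +
  assumes krull_schmidt: "A \<in> Ob \<C> \<Longrightarrow>
    \<exists>n B. (\<forall>j<n. B j \<in> Ob \<C> \<and> local_ring (End_ring \<C> (B j))) \<and> is_direct_sum \<C> n B A"

definition indecomposable :: "('o, 'm, 'k, 'z) precat_scheme \<Rightarrow> 'o \<Rightarrow> bool" where
  "indecomposable \<C> A \<longleftrightarrow> A \<in> Ob \<C> \<and> \<not> zero_object \<C> A \<and>
     (\<forall>B D i\<^sub>1 i\<^sub>2 p\<^sub>1 p\<^sub>2. is_biproduct \<C> B D A i\<^sub>1 i\<^sub>2 p\<^sub>1 p\<^sub>2 \<longrightarrow> zero_object \<C> B \<or> zero_object \<C> D)"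

text \<open>Full subcategories are represented by their sets of objects.\<close>

definition subcategory :: "('o, 'm, 'k, 'z) precat_scheme \<Rightarrow> 'o set \<Rightarrow> bool" where
  "subcategory \<C> \<X> \<longleftrightarrow> \<X> \<subseteq> Ob \<C> \<and>
     (\<forall>A B. A \<in> \<X> \<and> isomorphic \<C> A B \<longrightarrow> B \<in> \<X>) \<and>
     (\<forall>n A S. (\<forall>j<n. A j \<in> \<X>) \<and> is_direct_sum \<C> n A S \<longrightarrow> S \<in> \<X>) \<and>
     (\<forall>A B S i\<^sub>1 i\<^sub>2 p\<^sub>1 p\<^sub>2. S \<in> \<X> \<and> is_biproduct \<C> A B S i\<^sub>1 i\<^sub>2 p\<^sub>1 p\<^sub>2 \<longrightarrow> A \<in> \<X>)"

definition left_approximation ::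
    "('o, 'm, 'k, 'z) precat_scheme \<Rightarrow> 'o set \<Rightarrow> 'm \<Rightarrow> 'o \<Rightarrow> 'o \<Rightarrow> bool" where
  "left_approximation \<C> \<X> f A X \<longleftrightarrow> X \<in> \<X> \<and> \<guillemotleft>f : A \<rightarrow> X\<guillemotright>\<^bsub>\<C>\<^esub> \<and>
     (\<forall>X'\<in>\<X>. \<forall>g. \<guillemotleft>g : A \<rightarrow> X'\<guillemotright>\<^bsub>\<C>\<^esub> \<longrightarrow> (\<exists>h. \<guillemotleft>h : X \<rightarrow> X'\<guillemotright>\<^bsub>\<C>\<^esub> \<and> h \<cdot>\<^bsub>\<C>\<^esub> f = g))"

definition right_approximation ::
    "('o, 'm, 'k, 'z) precat_scheme \<Rightarrow> 'o set \<Rightarrow> 'm \<Rightarrow> 'o \<Rightarrow> 'o \<Rightarrow> bool" where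
  "right_approximation \<C> \<X> f X A \<longleftrightarrow> X \<in> \<X> \<and> \<guillemotleft>f : X \<rightarrow> A\<guillemotright>\<^bsub>\<C>\<^esub> \<and>
     (\<forall>X'\<in>\<X>. \<forall>g. \<guillemotleft>g : X' \<rightarrow> A\<guillemotright>\<^bsub>\<C>\<^esub> \<longrightarrow> (\<exists>h. \<guillemotleft>h : X' \<rightarrow> X\<guillemotright>\<^bsub>\<C>\<^esub> \<and> f \<cdot>\<^bsub>\<C>\<^esub> h = g))"

definition functorially_finite :: "('o, 'm, 'k, 'z) precat_scheme \<Rightarrow> 'o set \<Rightarrow> bool" where
  "functorially_finite \<C> \<X> \<longleftrightarrow>
     (\<forall>A\<in>Ob \<C>. (\<exists>f X. left_approximation \<C> \<X> f A X) \<and> (\<exists>f X. right_approximation \<C> \<X> f X A))"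


section \<open>Extriangulated categories\<close>

text \<open>
  \<open>Ext \<C> D A\<close> is the group \<open>E(D, A)\<close>, contravariant in \<open>D\<close> and covariant in \<open>A\<close>;
  \<open>Ext_map \<C> c a\<close> is the map \<open>E(c, a) : E(D, A) \<rightarrow> E(D', A')\<close> for \<open>c : D' \<rightarrow> D\<close> and \<open>a : A \<rightarrow> A'\<close>.
  It carries no object indices, since these are determined by \<open>c\<close> and \<open>a\<close>.
  \<open>realization \<C> D A \<delta>\<close> is the equivalence class of sequences \<open>A \<rightarrow> B \<rightarrow> D\<close> assigned to \<open>\<delta> \<in> E(D, A)\<close>,
  a sequence with morphisms \<open>x\<close> and \<open>y\<close> being represented by the triple \<open>(B, x, y)\<close>.
\<close>

record ('o, 'm, 'k, 'e) preextri = "('o, 'm, 'k) precat" +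
  Ext :: "'o \<Rightarrow> 'o \<Rightarrow> ('k, 'e) module"
  Ext_map :: "'m \<Rightarrow> 'm \<Rightarrow> 'e \<Rightarrow> 'e"
  realization :: "'o \<Rightarrow> 'o \<Rightarrow> 'e \<Rightarrow> ('o \<times> 'm \<times> 'm) set"

text \<open>\<open>push \<C> D a \<delta>\<close> is \<open>a\<^sub>* \<delta> = E(D, a)(\<delta>)\<close> and \<open>pull \<C> A c \<delta>\<close> is \<open>c\<^sup>* \<delta> = E(c, A)(\<delta>)\<close>.\<close>

definition push :: "('o, 'm, 'k, 'e, 'z) preextri_scheme \<Rightarrow> 'o \<Rightarrow> 'm \<Rightarrow> 'e \<Rightarrow> 'e" where
  "push \<C> D a \<delta> = Ext_map \<C> (ident \<C> D) a \<delta>"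

definition pull :: "('o, 'm, 'k, 'e, 'z) preextri_scheme \<Rightarrow> 'o \<Rightarrow> 'm \<Rightarrow> 'e \<Rightarrow> 'e" where
  "pull \<C> A c \<delta> = Ext_map \<C> c (ident \<C> A) \<delta>"

definition sequences :: "('o, 'm, 'k, 'z) precat_scheme \<Rightarrow> 'o \<Rightarrow> 'o \<Rightarrow> ('o \<times> 'm \<times> 'm) set" where
  "sequences \<C> A D = {(B, x, y). \<guillemotleft>x : A \<rightarrow> B\<guillemotright>\<^bsub>\<C>\<^esub> \<and> \<guillemotleft>y : B \<rightarrow> D\<guillemotright>\<^bsub>\<C>\<^esub>}"

definition seq_equiv ::
    "('o, 'm, 'k, 'z) precat_scheme \<Rightarrow> 'o \<Rightarrow> 'o \<Rightarrow> (('o \<times> 'm \<times> 'm) \<times> ('o \<times> 'm \<times> 'm)) set" where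
  "seq_equiv \<C> A D = {((B, x, y), (B', x', y')).
     (B, x, y) \<in> sequences \<C> A D \<and> (B', x', y') \<in> sequences \<C> A D \<and>
     (\<exists>b. is_iso \<C> b B B' \<and> b \<cdot>\<^bsub>\<C>\<^esub> x = x' \<and> y' \<cdot>\<^bsub>\<C>\<^esub> b = y)}"

text \<open>\<open>A \<rightarrow> B \<rightarrow> D\<close> with morphisms \<open>x\<close> and \<open>y\<close> realizes \<open>\<delta> \<in> E(D, A)\<close>.\<close>

definition E_triangle ::
    "('o, 'm, 'k, 'e, 'z) preextri_scheme \<Rightarrow> 'o \<Rightarrow> 'm \<Rightarrow> 'o \<Rightarrow> 'm \<Rightarrow> 'o \<Rightarrow> 'e \<Rightarrow> bool" where
  "E_triangle \<C> A x B y D \<delta> \<longleftrightarrow>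
     A \<in> Ob \<C> \<and> D \<in> Ob \<C> \<and> \<delta> \<in> carrier (Ext \<C> D A) \<and> (B, x, y) \<in> realization \<C> D A \<delta>"

definition ext_morphism ::
    "('o, 'm, 'k, 'e, 'z) preextri_scheme \<Rightarrow>
     'm \<Rightarrow> 'm \<Rightarrow> 'o \<Rightarrow> 'o \<Rightarrow> 'e \<Rightarrow> 'o \<Rightarrow> 'o \<Rightarrow> 'e \<Rightarrow> bool" where
  "ext_morphism \<C> a c D A \<delta> D' A' \<delta>' \<longleftrightarrow>
     \<delta> \<in> carrier (Ext \<C> D A) \<and> \<delta>' \<in> carrier (Ext \<C> D' A') \<and>
     \<guillemotleft>a : A \<rightarrow> A'\<guillemotright>\<^bsub>\<C>\<^esub> \<and> \<guillemotleft>c : D \<rightarrow> D'\<guillemotright>\<^bsub>\<C>\<^esub> \<and> push \<C> D a \<delta> = pull \<C> A' c \<delta>'"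

text \<open>
  In \<open>realization_sum\<close>, the element \<open>\<delta> \<oplus> \<delta>'\<close> of \<open>E(D \<oplus> D', A \<oplus> A')\<close>, i.e. the one corresponding to
  \<open>(\<delta>, 0, 0, \<delta>')\<close> under \<open>E(D \<oplus> D', A \<oplus> A') = E(D, A) \<oplus> E(D, A') \<oplus> E(D', A) \<oplus> E(D', A')\<close>, is
  written in terms of projections and injections, as are the direct sums \<open>x \<oplus> x'\<close> and \<open>y \<oplus> y'\<close>.
\<close>

locale extriangulated_category = additive_category \<C>
  for \<C> :: "('o, 'm, 'k, 'e, 'z) preextri_scheme" (structure) +
  assumes Ext_abelian_group: "D \<in> Ob \<C> \<Longrightarrow> A \<in> Ob \<C> \<Longrightarrow> abelian_group (Ext \<C> D A)"
    and Ext_map_hom: "\<guillemotleft>c : D' \<rightarrow> D\<guillemotright> \<Longrightarrow> \<guillemotleft>a : A \<rightarrow> A'\<guillemotright> \<Longrightarrow>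
          Ext_map \<C> c a \<in> hom (add_monoid (Ext \<C> D A)) (add_monoid (Ext \<C> D' A'))"
    and Ext_map_ident: "D \<in> Ob \<C> \<Longrightarrow> A \<in> Ob \<C> \<Longrightarrow> \<delta> \<in> carrier (Ext \<C> D A) \<Longrightarrow>
          Ext_map \<C> (ident \<C> D) (ident \<C> A) \<delta> = \<delta>"
    and Ext_map_comp: "\<guillemotleft>c : D' \<rightarrow> D\<guillemotright> \<Longrightarrow> \<guillemotleft>c' : D'' \<rightarrow> D'\<guillemotright> \<Longrightarrow> \<guillemotleft>a : A \<rightarrow> A'\<guillemotright> \<Longrightarrow> \<guillemotleft>a' : A' \<rightarrow> A''\<guillemotright> \<Longrightarrow>
          \<delta> \<in> carrier (Ext \<C> D A) \<Longrightarrow>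
          Ext_map \<C> (c \<cdot> c') (a' \<cdot> a) \<delta> = Ext_map \<C> c' a' (Ext_map \<C> c a \<delta>)"
    and Ext_map_add_left: "\<guillemotleft>c : D' \<rightarrow> D\<guillemotright> \<Longrightarrow> \<guillemotleft>c' : D' \<rightarrow> D\<guillemotright> \<Longrightarrow> \<guillemotleft>a : A \<rightarrow> A'\<guillemotright> \<Longrightarrow>
          \<delta> \<in> carrier (Ext \<C> D A) \<Longrightarrow>
          Ext_map \<C> (c \<oplus>\<^bsub>Mor \<C> D' D\<^esub> c') a \<delta> = Ext_map \<C> c a \<delta> \<oplus>\<^bsub>Ext \<C> D' A'\<^esub> Ext_map \<C> c' a \<delta>"
    and Ext_map_add_right: "\<guillemotleft>c : D' \<rightarrow> D\<guillemotright> \<Longrightarrow> \<guillemotleft>a : A \<rightarrow> A'\<guillemotright> \<Longrightarrow> \<guillemotleft>a' : A \<rightarrow> A'\<guillemotright> \<Longrightarrow>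
          \<delta> \<in> carrier (Ext \<C> D A) \<Longrightarrow>
          Ext_map \<C> c (a \<oplus>\<^bsub>Mor \<C> A A'\<^esub> a') \<delta> = Ext_map \<C> c a \<delta> \<oplus>\<^bsub>Ext \<C> D' A'\<^esub> Ext_map \<C> c a' \<delta>"
    and realization_class: "D \<in> Ob \<C> \<Longrightarrow> A \<in> Ob \<C> \<Longrightarrow> \<delta> \<in> carrier (Ext \<C> D A) \<Longrightarrow>
          realization \<C> D A \<delta> \<in> sequences \<C> A D // seq_equiv \<C> A D"
    and realization_morphism: "E_triangle \<C> A x B y D \<delta> \<Longrightarrow> E_triangle \<C> A' x' B' y' D' \<delta>' \<Longrightarrow>
          ext_morphism \<C> a c D A \<delta> D' A' \<delta>' \<Longrightarrow>
          \<exists>b. \<guillemotleft>b : B \<rightarrow> B'\<guillemotright> \<and> b \<cdot> x = x' \<cdot> a \<and> y' \<cdot> b = c \<cdot> y"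
    and realization_zero: "is_biproduct \<C> A D S i\<^sub>1 i\<^sub>2 p\<^sub>1 p\<^sub>2 \<Longrightarrow>
          E_triangle \<C> A i\<^sub>1 S p\<^sub>2 D \<zero>\<^bsub>Ext \<C> D A\<^esub>"
    and realization_sum: "E_triangle \<C> A x B y D \<delta> \<Longrightarrow> E_triangle \<C> A' x' B' y' D' \<delta>' \<Longrightarrow>
          is_biproduct \<C> A A' SA i\<^sub>A i\<^sub>A' p\<^sub>A p\<^sub>A' \<Longrightarrow>
          is_biproduct \<C> B B' SB i\<^sub>B i\<^sub>B' p\<^sub>B p\<^sub>B' \<Longrightarrow>
          is_biproduct \<C> D D' SD i\<^sub>D i\<^sub>D' p\<^sub>D p\<^sub>D' \<Longrightarrow>
          E_triangle \<C>
            SA (i\<^sub>B \<cdot> x \<cdot> p\<^sub>A \<oplus>\<^bsub>Mor \<C> SA SB\<^esub> i\<^sub>B' \<cdot> x' \<cdot> p\<^sub>A')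
            SB (i\<^sub>D \<cdot> y \<cdot> p\<^sub>B \<oplus>\<^bsub>Mor \<C> SB SD\<^esub> i\<^sub>D' \<cdot> y' \<cdot> p\<^sub>B')
            SD (Ext_map \<C> p\<^sub>D i\<^sub>A \<delta> \<oplus>\<^bsub>Ext \<C> SD SA\<^esub> Ext_map \<C> p\<^sub>D' i\<^sub>A' \<delta>')"
    and ET3: "E_triangle \<C> A x B y D \<delta> \<Longrightarrow> E_triangle \<C> A' x' B' y' D' \<delta>' \<Longrightarrow>
          \<guillemotleft>a : A \<rightarrow> A'\<guillemotright> \<Longrightarrow> \<guillemotleft>b : B \<rightarrow> B'\<guillemotright> \<Longrightarrow> b \<cdot> x = x' \<cdot> a \<Longrightarrow>
          \<exists>c. \<guillemotleft>c : D \<rightarrow> D'\<guillemotright> \<and> c \<cdot> y = y' \<cdot> b \<and> ext_morphism \<C> a c D A \<delta> D' A' \<delta>'"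
    and ET3_op: "E_triangle \<C> A x B y D \<delta> \<Longrightarrow> E_triangle \<C> A' x' B' y' D' \<delta>' \<Longrightarrow>
          \<guillemotleft>b : B \<rightarrow> B'\<guillemotright> \<Longrightarrow> \<guillemotleft>c : D \<rightarrow> D'\<guillemotright> \<Longrightarrow> c \<cdot> y = y' \<cdot> b \<Longrightarrow>
          \<exists>a. \<guillemotleft>a : A \<rightarrow> A'\<guillemotright> \<and> b \<cdot> x = x' \<cdot> a \<and> ext_morphism \<C> a c D A \<delta> D' A' \<delta>'"
    and ET4: "E_triangle \<C> A f B f' D \<delta> \<Longrightarrow> E_triangle \<C> B g C g' F \<delta>' \<Longrightarrow>
          \<exists>E h' d e \<delta>''. \<guillemotleft>h' : C \<rightarrow> E\<guillemotright> \<and> \<guillemotleft>d : D \<rightarrow> E\<guillemotright> \<and> \<guillemotleft>e : E \<rightarrow> F\<guillemotright> \<and>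
            h' \<cdot> g = d \<cdot> f' \<and> e \<cdot> h' = g' \<and>
            E_triangle \<C> A (g \<cdot> f) C h' E \<delta>'' \<and>
            E_triangle \<C> D d E e F (push \<C> F f' \<delta>') \<and>
            pull \<C> A d \<delta>'' = \<delta> \<and> push \<C> E f \<delta>'' = pull \<C> B e \<delta>'"
    and ET4_op: "E_triangle \<C> D f' A f B \<delta> \<Longrightarrow> E_triangle \<C> F g' B g C \<delta>' \<Longrightarrow>
          \<exists>E h' d e \<delta>''. \<guillemotleft>h' : E \<rightarrow> A\<guillemotright> \<and> \<guillemotleft>d : D \<rightarrow> E\<guillemotright> \<and> \<guillemotleft>e : E \<rightarrow> F\<guillemotright> \<and>
            f \<cdot> h' = g' \<cdot> e \<and> h' \<cdot> d = f' \<and>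
            E_triangle \<C> E h' A (g \<cdot> f) C \<delta>'' \<and>
            E_triangle \<C> D d E e F (pull \<C> D g' \<delta>) \<and>
            push \<C> C e \<delta>'' = \<delta>' \<and> pull \<C> E g \<delta>'' = push \<C> B d \<delta>"

definition projective :: "('o, 'm, 'k, 'e, 'z) preextri_scheme \<Rightarrow> 'o \<Rightarrow> bool" where
  "projective \<C> P \<longleftrightarrow> P \<in> Ob \<C> \<and>
     (\<forall>A x B y D \<delta> f. E_triangle \<C> A x B y D \<delta> \<and> \<guillemotleft>f : P \<rightarrow> D\<guillemotright>\<^bsub>\<C>\<^esub> \<longrightarrow>
        (\<exists>g. \<guillemotleft>g : P \<rightarrow> B\<guillemotright>\<^bsub>\<C>\<^esub> \<and> y \<cdot>\<^bsub>\<C>\<^esub> g = f))"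

definition injective :: "('o, 'm, 'k, 'e, 'z) preextri_scheme \<Rightarrow> 'o \<Rightarrow> bool" where
  "injective \<C> I \<longleftrightarrow> I \<in> Ob \<C> \<and>
     (\<forall>A x B y D \<delta> f. E_triangle \<C> A x B y D \<delta> \<and> \<guillemotleft>f : A \<rightarrow> I\<guillemotright>\<^bsub>\<C>\<^esub> \<longrightarrow>
        (\<exists>g. \<guillemotleft>g : B \<rightarrow> I\<guillemotright>\<^bsub>\<C>\<^esub> \<and> g \<cdot>\<^bsub>\<C>\<^esub> x = f))"

definition Proj :: "('o, 'm, 'k, 'e, 'z) preextri_scheme \<Rightarrow> 'o set" where
  "Proj \<C> = {P. projective \<C> P}"

definition enough_projectives :: "('o, 'm, 'k, 'e, 'z) preextri_scheme \<Rightarrow> bool" where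
  "enough_projectives \<C> \<longleftrightarrow>
     (\<forall>D\<in>Ob \<C>. \<exists>A x P y \<delta>. E_triangle \<C> A x P y D \<delta> \<and> projective \<C> P)"

definition enough_injectives :: "('o, 'm, 'k, 'e, 'z) preextri_scheme \<Rightarrow> bool" where
  "enough_injectives \<C> \<longleftrightarrow>
     (\<forall>A\<in>Ob \<C>. \<exists>x I y D \<delta>. E_triangle \<C> A x I y D \<delta> \<and> injective \<C> I)"


section \<open>The 2-Calabi-Yau condition\<close>

locale linear_extriangulated_category = extriangulated_category \<C> + field K
  for K :: "('k, 'r) ring_scheme" and \<C> :: "('o, 'm, 'k, 'e, 'z) preextri_scheme" (structure) +
  assumes Mor_vectorspace: "A \<in> Ob \<C> \<Longrightarrow> B \<in> Ob \<C> \<Longrightarrow> vectorspace K (Mor \<C> A B)"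
    and comp_smult_left: "\<guillemotleft>f : A \<rightarrow> B\<guillemotright> \<Longrightarrow> \<guillemotleft>g : B \<rightarrow> D\<guillemotright> \<Longrightarrow> r \<in> carrier K \<Longrightarrow>
          (r \<odot>\<^bsub>Mor \<C> B D\<^esub> g) \<cdot> f = r \<odot>\<^bsub>Mor \<C> A D\<^esub> (g \<cdot> f)"
    and comp_smult_right: "\<guillemotleft>f : A \<rightarrow> B\<guillemotright> \<Longrightarrow> \<guillemotleft>g : B \<rightarrow> D\<guillemotright> \<Longrightarrow> r \<in> carrier K \<Longrightarrow>
          g \<cdot> (r \<odot>\<^bsub>Mor \<C> A B\<^esub> f) = r \<odot>\<^bsub>Mor \<C> A D\<^esub> (g \<cdot> f)"
    and Ext_vectorspace: "D \<in> Ob \<C> \<Longrightarrow> A \<in> Ob \<C> \<Longrightarrow> vectorspace K (Ext \<C> D A)"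
    and Ext_map_linear: "\<guillemotleft>c : D' \<rightarrow> D\<guillemotright> \<Longrightarrow> \<guillemotleft>a : A \<rightarrow> A'\<guillemotright> \<Longrightarrow>
          Ext_map \<C> c a \<in> module_hom K (Ext \<C> D A) (Ext \<C> D' A')"
    and Ext_map_smult_left: "\<guillemotleft>c : D' \<rightarrow> D\<guillemotright> \<Longrightarrow> \<guillemotleft>a : A \<rightarrow> A'\<guillemotright> \<Longrightarrow> r \<in> carrier K \<Longrightarrow>
          \<delta> \<in> carrier (Ext \<C> D A) \<Longrightarrow>
          Ext_map \<C> (r \<odot>\<^bsub>Mor \<C> D' D\<^esub> c) a \<delta> = r \<odot>\<^bsub>Ext \<C> D' A'\<^esub> Ext_map \<C> c a \<delta>"
    and Ext_map_smult_right: "\<guillemotleft>c : D' \<rightarrow> D\<guillemotright> \<Longrightarrow> \<guillemotleft>a : A \<rightarrow> A'\<guillemotright> \<Longrightarrow> r \<in> carrier K \<Longrightarrow>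
          \<delta> \<in> carrier (Ext \<C> D A) \<Longrightarrow>
          Ext_map \<C> c (r \<odot>\<^bsub>Mor \<C> A A'\<^esub> a) \<delta> = r \<odot>\<^bsub>Ext \<C> D' A'\<^esub> Ext_map \<C> c a \<delta>"

definition self_module :: "('k, 'r) ring_scheme \<Rightarrow> ('k, 'k) module" where
  "self_module K =
     \<lparr>carrier = carrier K, mult = mult K, one = \<one>\<^bsub>K\<^esub>, zero = \<zero>\<^bsub>K\<^esub>, add = add K, smult = mult K\<rparr>"

text \<open>Functionals are taken extensional, so that each one is represented exactly once.\<close>

definition dual_space ::
    "('k, 'r) ring_scheme \<Rightarrow> ('k, 'v, 's) module_scheme \<Rightarrow> ('k, 'v \<Rightarrow> 'k) module" where
  "dual_space K V = (ring.func_space K (carrier V))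
     \<lparr>carrier := module_hom K V (self_module K) \<inter> extensional (carrier V)\<rparr>"

text \<open>
  A bifunctorial isomorphism \<open>E(A, B) \<cong> Hom\<^sub>k(E(B, A), k)\<close>; both sides are contravariant in \<open>A\<close> and
  covariant in \<open>B\<close>.
\<close>

definition two_calabi_yau_duality ::
    "('k, 'r) ring_scheme \<Rightarrow> ('o, 'm, 'k, 'e, 'z) preextri_scheme \<Rightarrow>
     ('o \<Rightarrow> 'o \<Rightarrow> 'e \<Rightarrow> 'e \<Rightarrow> 'k) \<Rightarrow> bool" where
  "two_calabi_yau_duality K \<C> \<Phi> \<longleftrightarrow>
     (\<forall>A\<in>Ob \<C>. \<forall>B\<in>Ob \<C>.
        \<Phi> A B \<in> module_hom K (Ext \<C> A B) (dual_space K (Ext \<C> B A)) \<and>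
        bij_betw (\<Phi> A B) (carrier (Ext \<C> A B)) (carrier (dual_space K (Ext \<C> B A)))) \<and>
     (\<forall>A A' B B' a b. \<guillemotleft>a : A' \<rightarrow> A\<guillemotright>\<^bsub>\<C>\<^esub> \<and> \<guillemotleft>b : B \<rightarrow> B'\<guillemotright>\<^bsub>\<C>\<^esub> \<longrightarrow>
        (\<forall>\<delta>\<in>carrier (Ext \<C> A B). \<forall>\<epsilon>\<in>carrier (Ext \<C> B' A').
           \<Phi> A' B' (Ext_map \<C> a b \<delta>) \<epsilon> = \<Phi> A B \<delta> (Ext_map \<C> b a \<epsilon>)))"

locale two_calabi_yau_extriangulated_category = linear_extriangulated_category +
  assumes Mor_fin_dim: "A \<in> Ob \<C> \<Longrightarrow> B \<in> Ob \<C> \<Longrightarrow> vectorspace.fin_dim K (Mor \<C> A B)"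
    and Ext_fin_dim: "A \<in> Ob \<C> \<Longrightarrow> B \<in> Ob \<C> \<Longrightarrow> vectorspace.fin_dim K (Ext \<C> A B)"
    and two_calabi_yau: "\<exists>\<Phi>. two_calabi_yau_duality K \<C> \<Phi>"


section \<open>Cluster tilting subcategories and mutation pairs\<close>

definition Ext_vanishes :: "('o, 'm, 'k, 'e, 'z) preextri_scheme \<Rightarrow> 'o set \<Rightarrow> 'o set \<Rightarrow> bool" where
  "Ext_vanishes \<C> \<A> \<B> \<longleftrightarrow> (\<forall>A\<in>\<A>. \<forall>B\<in>\<B>. carrier (Ext \<C> A B) = {\<zero>\<^bsub>Ext \<C> A B\<^esub>})"

definition rigid :: "('o, 'm, 'k, 'e, 'z) preextri_scheme \<Rightarrow> 'o set \<Rightarrow> bool" where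
  "rigid \<C> \<R> \<longleftrightarrow> subcategory \<C> \<R> \<and> Ext_vanishes \<C> \<R> \<R>"

definition cluster_tilting :: "('o, 'm, 'k, 'e, 'z) preextri_scheme \<Rightarrow> 'o set \<Rightarrow> bool" where
  "cluster_tilting \<C> \<R> \<longleftrightarrow> subcategory \<C> \<R> \<and> functorially_finite \<C> \<R> \<and>
     (\<forall>M\<in>Ob \<C>. (M \<in> \<R> \<longleftrightarrow> Ext_vanishes \<C> {M} \<R>) \<and> (M \<in> \<R> \<longleftrightarrow> Ext_vanishes \<C> \<R> {M}))"

definition almost_complete_cluster_tilting ::
    "('o, 'm, 'k, 'e, 'z) preextri_scheme \<Rightarrow> 'o set \<Rightarrow> bool" where
  "almost_complete_cluster_tilting \<C> \<X> \<longleftrightarrow>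
     rigid \<C> \<X> \<and> functorially_finite \<C> \<X> \<and> Proj \<C> \<subseteq> \<X> \<and>
     (\<exists>\<R> R\<^sub>0. cluster_tilting \<C> \<R> \<and> \<X> \<subseteq> \<R> \<and> indecomposable \<C> R\<^sub>0 \<and>
        (\<forall>X\<in>\<X>. \<not> isomorphic \<C> R\<^sub>0 X) \<and>
        (\<forall>M. indecomposable \<C> M \<longrightarrow> (M \<in> \<R> \<longleftrightarrow> M \<in> \<X> \<or> isomorphic \<C> M R\<^sub>0)))"

definition mutation_pair ::
    "('o, 'm, 'k, 'e, 'z) preextri_scheme \<Rightarrow> 'o set \<Rightarrow> 'o set \<Rightarrow> 'o set \<Rightarrow> bool" where
  "mutation_pair \<C> \<X> \<A> \<B> \<longleftrightarrow>
     subcategory \<C> \<X> \<and> subcategory \<C> \<A> \<and> subcategory \<C> \<B> \<and> \<X> \<subseteq> \<A> \<and> \<X> \<subseteq> \<B> \<and>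
     (\<forall>A\<in>\<A>. \<exists>B\<in>\<B>. \<exists>\<alpha> X \<beta> \<delta>. E_triangle \<C> A \<alpha> X \<beta> B \<delta> \<and>
        left_approximation \<C> \<X> \<alpha> A X \<and> right_approximation \<C> \<X> \<beta> X B) \<and>
     (\<forall>B\<in>\<B>. \<exists>A\<in>\<A>. \<exists>\<alpha> X \<beta> \<delta>. E_triangle \<C> A \<alpha> X \<beta> B \<delta> \<and>
        left_approximation \<C> \<X> \<alpha> A X \<and> right_approximation \<C> \<X> \<beta> X B)"

end

theory Submission
  imports Defs
begin

text \<open>
  Let \<open>\<R>\<close> be a cluster tilting subcategory containing \<open>\<X>\<close> with one further indecomposable \<open>R\<close>, and put
  \<open>\<Z> = {M. E(M, \<X>) = 0}\<close>, which by duality is also \<open>{M. E(\<X>, M) = 0}\<close>. Every cluster tilting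
  subcategory containing \<open>\<X>\<close> lies in \<open>\<Z>\<close>. The stable category \<open>\<Z>/[\<X>]\<close> should be thought of as a
  2-Calabi-Yau triangulated category with shift functor \<open>A \<mapsto> B\<close>, where \<open>A \<rightarrow> X \<rightarrow> B\<close> is an E-triangle with
  \<open>X\<close> in \<open>\<X>\<close>. The proof works with these \<^emph>\<open>exchange triangles\<close> directly and never forms the quotient.

  \<^bold>\<open>Exchange triangles exist\<close> in both directions (\<open>ex_exchange_triangle_from\<close>,
  \<open>ex_exchange_triangle_to\<close>). By duality injectives are projective, so they lie in \<open>\<X>\<close>. A left
  \<open>\<X>\<close>-approximation of \<open>A\<close>, enlarged by an inflation of \<open>A\<close> into an injective, is again an inflation
  (\<open>inflation_pair\<close>, a consequence of ET4) and a left approximation. Its cone lies in \<open>\<Z>\<close>.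

  \<^bold>\<open>Mutation preserves cluster tilting.\<close> Let \<open>mutate \<S>\<close> consist of the cones of all exchange triangles
  starting in \<open>\<S>\<close>. For two exchange triangles, \<open>E(A, A') = 0\<close> if and only if \<open>E(B, B') = 0\<close>
  (\<open>exchange_Ext_trivial\<close>). Hence if \<open>\<S>\<close> is its own \<open>E\<close>-orthogonal complement, so is \<open>mutate \<S>\<close>. If all
  identities of objects of \<open>\<S>\<close> are sums of morphisms factoring through \<open>\<X>\<close> or through one fixed object
  of \<open>\<S>\<close>, then the same holds for \<open>mutate \<S>\<close>, and with the finite dimension of the morphism spaces this
  yields approximations (\<open>cluster_tilting_mutate\<close>). Moreover \<open>mutate \<S> \<noteq> \<S>\<close> unless \<open>\<S> = \<X>\<close>, since
  otherwise all exchange triangles starting in \<open>\<S>\<close> split (\<open>mutate_neq\<close>).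

  \<^bold>\<open>There are no other completions\<close> (\<open>rigid_in_cluster_tilting_or_mutate\<close>). Let \<open>T\<close> in \<open>\<Z>\<close> be rigid.
  Choose an E-triangle \<open>L \<rightarrow> Y \<rightarrow> T\<close> with morphisms \<open>\<kappa>\<close> and \<open>y\<close>, where \<open>y\<close> is a right \<open>\<R>\<close>-approximation
  and \<open>Y\<close> is the sum of an object of \<open>\<X>\<close> and of as few copies of \<open>R\<close> as possible. Then \<open>L\<close> lies in \<open>\<R>\<close>.
  Rigidity of \<open>T\<close> implies that every \<open>g : L \<rightarrow> Y\<close> has the form \<open>\<kappa> b + h' \<kappa>\<close>. If \<open>R\<close> were a summand of both
  \<open>L\<close> and \<open>Y\<close>, one could take for \<open>g\<close> the projection onto \<open>R\<close> followed by the inclusion. As the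
  endomorphism ring of \<open>R\<close> is local, some composite \<open>R \<rightarrow> L \<rightarrow> Y \<rightarrow> R\<close> through \<open>\<kappa>\<close> would then be invertible,
  and one copy of \<open>R\<close> in \<open>Y\<close> would be superfluous. So either \<open>Y\<close> lies in \<open>\<X>\<close> and \<open>T\<close> in \<open>mutate \<R>\<close>, or \<open>L\<close> lies
  in \<open>\<X>\<close>, the triangle splits, and \<open>T\<close> lies in \<open>\<R>\<close>. Since a cluster tilting subcategory is closed under
  direct sums and maximal among those satisfying \<open>E(\<T>, \<T>) = 0\<close>, any completion \<open>\<T>\<close> is \<open>\<R>\<close> or \<open>mutate \<R>\<close>.

  Finally \<open>mutate (mutate \<R>)\<close> is a completion different from \<open>mutate \<R>\<close>, hence equal to \<open>\<R>\<close>; this gives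
  the second mutation pair.\<close>

section \<open>Sums of morphisms, retracts and local endomorphism rings\<close>

text \<open>The closure of \<open>P\<close> under finite sums inside \<open>Hom(A, B)\<close>, including the empty sum. Inverses are not
  added; the generating sets used below are all closed under inverses.\<close>

inductive_set morphism_sums ::
    "('o, 'm, 'k, 'z) precat_scheme \<Rightarrow> 'o \<Rightarrow> 'o \<Rightarrow> 'm set \<Rightarrow> 'm set"
  for \<C> :: "('o, 'm, 'k, 'z) precat_scheme" (structure) and A B :: 'o and P :: "'m set" where
  zero: "\<zero>\<^bsub>Mor \<C> A B\<^esub> \<in> morphism_sums \<C> A B P"
| add: "f \<in> P \<Longrightarrow> g \<in> morphism_sums \<C> A B P \<Longrightarrow> f \<oplus>\<^bsub>Mor \<C> A B\<^esub> g \<in> morphism_sums \<C> A B P"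

text \<open>Morphisms \<open>A \<rightarrow> B\<close> that factor through an object of \<open>\<G>\<close>. Together with \<open>morphism_sums\<close> this gives the
  ideal of morphisms generated by the identities of the objects of \<open>\<G>\<close>, so direct sums of objects of
  \<open>\<G>\<close> need not be formed.\<close>

definition through ::
    "('o, 'm, 'k, 'z) precat_scheme \<Rightarrow> 'o set \<Rightarrow> 'o \<Rightarrow> 'o \<Rightarrow> 'm set" where
  "through \<C> \<G> A B = {v \<cdot>\<^bsub>\<C>\<^esub> u | u v Y. Y \<in> \<G> \<and> \<guillemotleft>u : A \<rightarrow> Y\<guillemotright>\<^bsub>\<C>\<^esub> \<and> \<guillemotleft>v : Y \<rightarrow> B\<guillemotright>\<^bsub>\<C>\<^esub>}"

text \<open>Retracts; no complement of \<open>A\<close> in \<open>B\<close> is required.\<close>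

definition retract_of :: "('o, 'm, 'k, 'z) precat_scheme \<Rightarrow> 'o \<Rightarrow> 'o \<Rightarrow> bool" where
  "retract_of \<C> A B \<longleftrightarrow>
     (\<exists>i p. \<guillemotleft>i : A \<rightarrow> B\<guillemotright>\<^bsub>\<C>\<^esub> \<and> \<guillemotleft>p : B \<rightarrow> A\<guillemotright>\<^bsub>\<C>\<^esub> \<and> p \<cdot>\<^bsub>\<C>\<^esub> i = ident \<C> A)"

lemma arr_Ob:
  assumes "\<guillemotleft>f : A \<rightarrow> B\<guillemotright>\<^bsub>\<C>\<^esub>"
  shows "A \<in> Ob \<C>" and "B \<in> Ob \<C>"
  using assms by (auto simp: arr_def)

context category
begin

lemma is_iso_sym: "is_iso \<C> f A B \<Longrightarrow> \<exists>g. is_iso \<C> g B A \<and> g \<cdot> f = ident \<C> A \<and> f \<cdot> g = ident \<C> B"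
  unfolding is_iso_def by blast

lemma is_iso_ident: "A \<in> Ob \<C> \<Longrightarrow> is_iso \<C> (ident \<C> A) A A"
  unfolding is_iso_def using ident_arr comp_ident_left by blast

lemma isomorphic_sym: "isomorphic \<C> A B \<Longrightarrow> isomorphic \<C> B A"
  unfolding isomorphic_def using is_iso_sym by blast

lemma comp_assoc4:
  assumes "\<guillemotleft>f : A \<rightarrow> B\<guillemotright>" "\<guillemotleft>g : B \<rightarrow> D\<guillemotright>" "\<guillemotleft>h : D \<rightarrow> E\<guillemotright>" "\<guillemotleft>k : E \<rightarrow> F\<guillemotright>"
  shows "(k \<cdot> h) \<cdot> (g \<cdot> f) = k \<cdot> ((h \<cdot> g) \<cdot> f)"
  using comp_assoc[OF comp_arr[OF assms(1,2)] assms(3,4)] comp_assoc[OF assms(1,2,3)] by simp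

lemma is_iso_comp:
  assumes "is_iso \<C> f A B" and "is_iso \<C> g B D"
  shows "is_iso \<C> (g \<cdot> f) A D"
proof -
  obtain f' g' where f: "\<guillemotleft>f : A \<rightarrow> B\<guillemotright>" "\<guillemotleft>f' : B \<rightarrow> A\<guillemotright>" "f' \<cdot> f = ident \<C> A" "f \<cdot> f' = ident \<C> B"
    and g: "\<guillemotleft>g : B \<rightarrow> D\<guillemotright>" "\<guillemotleft>g' : D \<rightarrow> B\<guillemotright>" "g' \<cdot> g = ident \<C> B" "g \<cdot> g' = ident \<C> D"
    using assms unfolding is_iso_def by blast
  have "(f' \<cdot> g') \<cdot> (g \<cdot> f) = ident \<C> A" "(g \<cdot> f) \<cdot> (f' \<cdot> g') = ident \<C> D"
    using comp_assoc4[OF f(1) g(1,2) f(2)] comp_assoc4[OF g(2) f(2,1) g(1)] f g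
      comp_ident_left[OF f(1)] comp_ident_left[OF g(2)] by simp_all
  then show ?thesis unfolding is_iso_def using f g comp_arr by blast
qed

lemma isomorphic_trans: "isomorphic \<C> A B \<Longrightarrow> isomorphic \<C> B D \<Longrightarrow> isomorphic \<C> A D"
  unfolding isomorphic_def using is_iso_comp by blast

lemma isomorphic_retract: "isomorphic \<C> A B \<Longrightarrow> retract_of \<C> A B"
  unfolding isomorphic_def is_iso_def retract_of_def by blast

lemma retract_of_trans:
  assumes "retract_of \<C> A B" and "retract_of \<C> B D"
  shows "retract_of \<C> A D"
proof -
  obtain i p j q where *: "\<guillemotleft>i : A \<rightarrow> B\<guillemotright>" "\<guillemotleft>p : B \<rightarrow> A\<guillemotright>" "p \<cdot> i = ident \<C> A"
    "\<guillemotleft>j : B \<rightarrow> D\<guillemotright>" "\<guillemotleft>q : D \<rightarrow> B\<guillemotright>" "q \<cdot> j = ident \<C> B"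
    using assms unfolding retract_of_def by blast
  then have "(p \<cdot> q) \<cdot> (j \<cdot> i) = ident \<C> A" "\<guillemotleft>j \<cdot> i : A \<rightarrow> D\<guillemotright>" "\<guillemotleft>p \<cdot> q : D \<rightarrow> A\<guillemotright>"
    using comp_assoc4[OF *(1,4,5,2)] comp_arr comp_ident_left[OF *(1)] by auto
  then show ?thesis unfolding retract_of_def by blast
qed

lemma left_approximationD:
  assumes "left_approximation \<C> \<X> f A X"
  shows "X \<in> \<X>" "\<guillemotleft>f : A \<rightarrow> X\<guillemotright>"
    "\<And>X' g. X' \<in> \<X> \<Longrightarrow> \<guillemotleft>g : A \<rightarrow> X'\<guillemotright> \<Longrightarrow> \<exists>h. \<guillemotleft>h : X \<rightarrow> X'\<guillemotright> \<and> h \<cdot> f = g"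
  using assms unfolding left_approximation_def by blast+

lemma right_approximationD:
  assumes "right_approximation \<C> \<X> f X A"
  shows "X \<in> \<X>" "\<guillemotleft>f : X \<rightarrow> A\<guillemotright>"
    "\<And>X' g. X' \<in> \<X> \<Longrightarrow> \<guillemotleft>g : X' \<rightarrow> A\<guillemotright> \<Longrightarrow> \<exists>h. \<guillemotleft>h : X' \<rightarrow> X\<guillemotright> \<and> f \<cdot> h = g"
  using assms unfolding right_approximation_def by blast+

end

context preadditive_category
begin

lemma zero_arr: "A \<in> Ob \<C> \<Longrightarrow> B \<in> Ob \<C> \<Longrightarrow> \<guillemotleft>\<zero>\<^bsub>Mor \<C> A B\<^esub> : A \<rightarrow> B\<guillemotright>"
  by (simp add: arr_def abelian_groupE(2) mor_abelian_group)

lemma add_arr: "\<guillemotleft>f : A \<rightarrow> B\<guillemotright> \<Longrightarrow> \<guillemotleft>g : A \<rightarrow> B\<guillemotright> \<Longrightarrow> \<guillemotleft>f \<oplus>\<^bsub>Mor \<C> A B\<^esub> g : A \<rightarrow> B\<guillemotright>"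
  by (simp add: arr_def abelian_groupE(1) mor_abelian_group)

lemma neg_arr: "\<guillemotleft>f : A \<rightarrow> B\<guillemotright> \<Longrightarrow> \<guillemotleft>\<ominus>\<^bsub>Mor \<C> A B\<^esub> f : A \<rightarrow> B\<guillemotright>"
  by (simp add: arr_def abelian_group.a_inv_closed mor_abelian_group)

lemma add_zero_arr:
  assumes "\<guillemotleft>f : A \<rightarrow> B\<guillemotright>"
  shows "f \<oplus>\<^bsub>Mor \<C> A B\<^esub> \<zero>\<^bsub>Mor \<C> A B\<^esub> = f" and "\<zero>\<^bsub>Mor \<C> A B\<^esub> \<oplus>\<^bsub>Mor \<C> A B\<^esub> f = f"
proof -
  interpret abelian_group "Mor \<C> A B" using assms mor_abelian_group by (auto simp: arr_def)
  show "f \<oplus>\<^bsub>Mor \<C> A B\<^esub> \<zero>\<^bsub>Mor \<C> A B\<^esub> = f" "\<zero>\<^bsub>Mor \<C> A B\<^esub> \<oplus>\<^bsub>Mor \<C> A B\<^esub> f = f"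
    using assms by (auto simp: arr_def)
qed

lemma add_neg_arr:
  assumes "\<guillemotleft>f : A \<rightarrow> B\<guillemotright>"
  shows "f \<oplus>\<^bsub>Mor \<C> A B\<^esub> (\<ominus>\<^bsub>Mor \<C> A B\<^esub> f) = \<zero>\<^bsub>Mor \<C> A B\<^esub>"
    and "(\<ominus>\<^bsub>Mor \<C> A B\<^esub> f) \<oplus>\<^bsub>Mor \<C> A B\<^esub> f = \<zero>\<^bsub>Mor \<C> A B\<^esub>"
proof -
  interpret abelian_group "Mor \<C> A B" using assms mor_abelian_group by (auto simp: arr_def)
  show "f \<oplus>\<^bsub>Mor \<C> A B\<^esub> (\<ominus>\<^bsub>Mor \<C> A B\<^esub> f) = \<zero>\<^bsub>Mor \<C> A B\<^esub>"
    "(\<ominus>\<^bsub>Mor \<C> A B\<^esub> f) \<oplus>\<^bsub>Mor \<C> A B\<^esub> f = \<zero>\<^bsub>Mor \<C> A B\<^esub>"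
    using assms by (auto simp: arr_def r_neg l_neg)
qed

lemma add_arr_assoc:
  assumes "\<guillemotleft>f : A \<rightarrow> B\<guillemotright>" "\<guillemotleft>g : A \<rightarrow> B\<guillemotright>" "\<guillemotleft>h : A \<rightarrow> B\<guillemotright>"
  shows "(f \<oplus>\<^bsub>Mor \<C> A B\<^esub> g) \<oplus>\<^bsub>Mor \<C> A B\<^esub> h = f \<oplus>\<^bsub>Mor \<C> A B\<^esub> (g \<oplus>\<^bsub>Mor \<C> A B\<^esub> h)"
proof -
  interpret abelian_group "Mor \<C> A B" using assms mor_abelian_group by (auto simp: arr_def)
  show ?thesis using assms by (auto simp: arr_def a_assoc)
qed

lemma add_arr_comm:
  assumes "\<guillemotleft>f : A \<rightarrow> B\<guillemotright>" "\<guillemotleft>g : A \<rightarrow> B\<guillemotright>"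
  shows "f \<oplus>\<^bsub>Mor \<C> A B\<^esub> g = g \<oplus>\<^bsub>Mor \<C> A B\<^esub> f"
proof -
  interpret abelian_group "Mor \<C> A B" using assms mor_abelian_group by (auto simp: arr_def)
  show ?thesis using assms by (auto simp: arr_def a_comm)
qed

lemma add_arr_eq_self:
  assumes "\<guillemotleft>f : A \<rightarrow> B\<guillemotright>" "\<guillemotleft>g : A \<rightarrow> B\<guillemotright>" and "f \<oplus>\<^bsub>Mor \<C> A B\<^esub> g = f"
  shows "g = \<zero>\<^bsub>Mor \<C> A B\<^esub>"
  by (metis assms add_arr_assoc add_neg_arr(2) add_zero_arr(2) neg_arr)

lemma comp_zero_left:
  assumes "\<guillemotleft>f : A \<rightarrow> B\<guillemotright>" "D \<in> Ob \<C>"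
  shows "\<zero>\<^bsub>Mor \<C> B D\<^esub> \<cdot> f = \<zero>\<^bsub>Mor \<C> A D\<^esub>"
proof -
  have z: "\<guillemotleft>\<zero>\<^bsub>Mor \<C> B D\<^esub> : B \<rightarrow> D\<guillemotright>" using assms zero_arr by (auto simp: arr_def)
  show ?thesis
    using comp_add_left[OF assms(1) z z] add_zero_arr[OF z] add_arr_eq_self comp_arr[OF assms(1) z]
    by metis
qed

lemma comp_zero_right:
  assumes "\<guillemotleft>g : B \<rightarrow> D\<guillemotright>" "A \<in> Ob \<C>"
  shows "g \<cdot> \<zero>\<^bsub>Mor \<C> A B\<^esub> = \<zero>\<^bsub>Mor \<C> A D\<^esub>"
proof -
  have z: "\<guillemotleft>\<zero>\<^bsub>Mor \<C> A B\<^esub> : A \<rightarrow> B\<guillemotright>" using assms zero_arr by (auto simp: arr_def)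
  show ?thesis
    using comp_add_right[OF z z assms(1)] add_zero_arr[OF z] add_arr_eq_self comp_arr[OF z assms(1)]
    by metis
qed

lemma neg_arr_unique:
  assumes "\<guillemotleft>f : A \<rightarrow> B\<guillemotright>" "\<guillemotleft>g : A \<rightarrow> B\<guillemotright>" and "f \<oplus>\<^bsub>Mor \<C> A B\<^esub> g = \<zero>\<^bsub>Mor \<C> A B\<^esub>"
  shows "\<ominus>\<^bsub>Mor \<C> A B\<^esub> f = g"
  by (metis assms add_arr_assoc add_neg_arr(2) add_zero_arr neg_arr)

lemma comp_neg_left:
  assumes "\<guillemotleft>f : A \<rightarrow> B\<guillemotright>" "\<guillemotleft>g : B \<rightarrow> D\<guillemotright>"
  shows "(\<ominus>\<^bsub>Mor \<C> B D\<^esub> g) \<cdot> f = \<ominus>\<^bsub>Mor \<C> A D\<^esub> (g \<cdot> f)"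
  using comp_add_left[OF assms(1,2) neg_arr[OF assms(2)]] neg_arr_unique
    add_neg_arr(1)[OF assms(2)] comp_zero_left[OF assms(1)] assms comp_arr neg_arr arr_Ob
  by metis

lemma comp_neg_right:
  assumes "\<guillemotleft>f : A \<rightarrow> B\<guillemotright>" "\<guillemotleft>g : B \<rightarrow> D\<guillemotright>"
  shows "g \<cdot> (\<ominus>\<^bsub>Mor \<C> A B\<^esub> f) = \<ominus>\<^bsub>Mor \<C> A D\<^esub> (g \<cdot> f)"
  using comp_add_right[OF assms(1) neg_arr[OF assms(1)] assms(2)] neg_arr_unique
    add_neg_arr(1)[OF assms(1)] comp_zero_right[OF assms(2)] assms comp_arr neg_arr arr_Ob
  by metis

lemma morphism_sums_arr:
  assumes "f \<in> morphism_sums \<C> A B P" and "A \<in> Ob \<C>" "B \<in> Ob \<C>"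
    and "\<And>g. g \<in> P \<Longrightarrow> \<guillemotleft>g : A \<rightarrow> B\<guillemotright>"
  shows "\<guillemotleft>f : A \<rightarrow> B\<guillemotright>"
  using assms(1) by induction (auto intro: assms zero_arr add_arr)

lemma morphism_sums_base:
  assumes "f \<in> P" and "\<guillemotleft>f : A \<rightarrow> B\<guillemotright>"
  shows "f \<in> morphism_sums \<C> A B P"
  using morphism_sums.add[OF assms(1) morphism_sums.zero, of \<C> A B] add_zero_arr[OF assms(2)] by simp

lemma morphism_sums_add:
  assumes "f \<in> morphism_sums \<C> A B P" and "g \<in> morphism_sums \<C> A B P"
    and "A \<in> Ob \<C>" "B \<in> Ob \<C>" and "\<And>g. g \<in> P \<Longrightarrow> \<guillemotleft>g : A \<rightarrow> B\<guillemotright>"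
  shows "f \<oplus>\<^bsub>Mor \<C> A B\<^esub> g \<in> morphism_sums \<C> A B P"
  using assms(1)
proof induction
  case zero
  then show ?case using assms add_zero_arr morphism_sums_arr by metis
next
  case (add f h)
  have "\<guillemotleft>f : A \<rightarrow> B\<guillemotright>" "\<guillemotleft>h : A \<rightarrow> B\<guillemotright>" "\<guillemotleft>g : A \<rightarrow> B\<guillemotright>"
    using assms add morphism_sums_arr by metis+
  then show ?case using add morphism_sums.add add_arr_assoc by metis
qed

text \<open>Additive maps that send generators to sums of generators send sums to sums.\<close>

lemma morphism_sums_image:
  assumes f: "f \<in> morphism_sums \<C> A B P" and ob: "A \<in> Ob \<C>" "B \<in> Ob \<C>" "A' \<in> Ob \<C>" "B' \<in> Ob \<C>"
    and P: "\<And>g. g \<in> P \<Longrightarrow> \<guillemotleft>g : A \<rightarrow> B\<guillemotright>" and P': "\<And>g. g \<in> P' \<Longrightarrow> \<guillemotleft>g : A' \<rightarrow> B'\<guillemotright>"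
    and zero: "\<phi> \<zero>\<^bsub>Mor \<C> A B\<^esub> = \<zero>\<^bsub>Mor \<C> A' B'\<^esub>"
    and add: "\<And>g h. \<guillemotleft>g : A \<rightarrow> B\<guillemotright> \<Longrightarrow> \<guillemotleft>h : A \<rightarrow> B\<guillemotright> \<Longrightarrow>
      \<phi> (g \<oplus>\<^bsub>Mor \<C> A B\<^esub> h) = \<phi> g \<oplus>\<^bsub>Mor \<C> A' B'\<^esub> \<phi> h"
    and base: "\<And>g. g \<in> P \<Longrightarrow> \<phi> g \<in> morphism_sums \<C> A' B' P'"
  shows "\<phi> f \<in> morphism_sums \<C> A' B' P'"
  using f
proof induction
  case zero
  then show ?case using assms(8) morphism_sums.zero by metis
next
  case (add f h)
  then have "\<guillemotleft>f : A \<rightarrow> B\<guillemotright>" "\<guillemotleft>h : A \<rightarrow> B\<guillemotright>" using P ob morphism_sums_arr by metis+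
  then show ?case using add assms(9) base morphism_sums_add ob P' by metis
qed

lemma morphism_sums_comp:
  assumes f: "f \<in> morphism_sums \<C> A B P" and ob: "A \<in> Ob \<C>" "B \<in> Ob \<C>"
    and P: "\<And>g. g \<in> P \<Longrightarrow> \<guillemotleft>g : A \<rightarrow> B\<guillemotright>" and P': "\<And>g. g \<in> P' \<Longrightarrow> \<guillemotleft>g : A' \<rightarrow> B'\<guillemotright>"
    and u: "\<guillemotleft>u : A' \<rightarrow> A\<guillemotright>" and v: "\<guillemotleft>v : B \<rightarrow> B'\<guillemotright>"
    and base: "\<And>g. g \<in> P \<Longrightarrow> v \<cdot> g \<cdot> u \<in> morphism_sums \<C> A' B' P'"
  shows "v \<cdot> f \<cdot> u \<in> morphism_sums \<C> A' B' P'"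
proof (rule morphism_sums_image[OF f ob _ _ P P', where \<phi> = "\<lambda>f. v \<cdot> f \<cdot> u"])
  show "A' \<in> Ob \<C>" "B' \<in> Ob \<C>" using u v by (auto simp: arr_def)
  show "v \<cdot> \<zero>\<^bsub>Mor \<C> A B\<^esub> \<cdot> u = \<zero>\<^bsub>Mor \<C> A' B'\<^esub>"
    using u v ob comp_zero_left comp_zero_right by (metis arr_Ob(2))
  show "v \<cdot> (g \<oplus>\<^bsub>Mor \<C> A B\<^esub> h) \<cdot> u = v \<cdot> g \<cdot> u \<oplus>\<^bsub>Mor \<C> A' B'\<^esub> v \<cdot> h \<cdot> u"
    if "\<guillemotleft>g : A \<rightarrow> B\<guillemotright>" "\<guillemotleft>h : A \<rightarrow> B\<guillemotright>" for g h
    using comp_add_right[OF that v] comp_add_left[OF u comp_arr[OF that(1) v] comp_arr[OF that(2) v]]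
    by simp
qed (use base in auto)

lemma through_arr: "f \<in> through \<C> \<G> A B \<Longrightarrow> \<guillemotleft>f : A \<rightarrow> B\<guillemotright>"
  unfolding through_def using comp_arr by blast

lemma through_comp:
  assumes "f \<in> through \<C> \<G> A B" and "\<guillemotleft>u : A' \<rightarrow> A\<guillemotright>" and "\<guillemotleft>v : B \<rightarrow> B'\<guillemotright>"
  shows "v \<cdot> f \<cdot> u \<in> through \<C> \<G> A' B'"
proof -
  obtain a b Y where *: "Y \<in> \<G>" "\<guillemotleft>a : A \<rightarrow> Y\<guillemotright>" "\<guillemotleft>b : Y \<rightarrow> B\<guillemotright>" "f = b \<cdot> a"
    using assms(1) unfolding through_def by blast
  have "v \<cdot> f \<cdot> u = (v \<cdot> b) \<cdot> (a \<cdot> u)"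
    using comp_assoc[OF *(2,3) assms(3)] comp_assoc[OF assms(2) *(2) comp_arr[OF *(3) assms(3)]] *(4)
    by simp
  then show ?thesis unfolding through_def using * assms comp_arr by blast
qed

lemma through_sums_comp:
  assumes "f \<in> morphism_sums \<C> A B (through \<C> \<G> A B)" and "\<guillemotleft>u : A' \<rightarrow> A\<guillemotright>" and "\<guillemotleft>v : B \<rightarrow> B'\<guillemotright>"
  shows "v \<cdot> f \<cdot> u \<in> morphism_sums \<C> A' B' (through \<C> \<G> A' B')"
  by (rule morphism_sums_comp[OF assms(1) arr_Ob(2)[OF assms(2)] arr_Ob(1)[OF assms(3)]
        through_arr through_arr assms(2,3)])
    (auto intro: morphism_sums_base through_comp through_arr assms)

lemma finsum_morphism_sums:
  assumes "finite J" "A \<in> Ob \<C>" "B \<in> Ob \<C>" "\<And>g. g \<in> P \<Longrightarrow> \<guillemotleft>g : A \<rightarrow> B\<guillemotright>"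
    and "\<And>j. j \<in> J \<Longrightarrow> f j \<in> P"
  shows "(\<Oplus>\<^bsub>Mor \<C> A B\<^esub> j\<in>J. f j) \<in> morphism_sums \<C> A B P"
proof -
  interpret abelian_group "Mor \<C> A B" using assms mor_abelian_group by auto
  show ?thesis using assms(1,5)
  proof (induction J)
    case empty
    then show ?case by (simp add: morphism_sums.zero)
  next
    case (insert j J)
    then have "f j \<in> P" "f \<in> J \<rightarrow> carrier (Mor \<C> A B)" "f j \<in> carrier (Mor \<C> A B)"
      using assms(4) by (auto simp: arr_def)
    then show ?case using insert by (simp add: morphism_sums.add)
  qed
qed

lemma biproduct_arr:
  assumes "is_biproduct \<C> A B S i\<^sub>1 i\<^sub>2 p\<^sub>1 p\<^sub>2"
  shows "\<guillemotleft>i\<^sub>1 : A \<rightarrow> S\<guillemotright>" "\<guillemotleft>i\<^sub>2 : B \<rightarrow> S\<guillemotright>" "\<guillemotleft>p\<^sub>1 : S \<rightarrow> A\<guillemotright>" "\<guillemotleft>p\<^sub>2 : S \<rightarrow> B\<guillemotright>"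
    "A \<in> Ob \<C>" "B \<in> Ob \<C>" "S \<in> Ob \<C>"
  using assms unfolding is_biproduct_def arr_def by auto

lemma biproduct_eqs:
  assumes "is_biproduct \<C> A B S i\<^sub>1 i\<^sub>2 p\<^sub>1 p\<^sub>2"
  shows "p\<^sub>1 \<cdot> i\<^sub>1 = ident \<C> A" "p\<^sub>2 \<cdot> i\<^sub>2 = ident \<C> B"
     "p\<^sub>2 \<cdot> i\<^sub>1 = \<zero>\<^bsub>Mor \<C> A B\<^esub>" "p\<^sub>1 \<cdot> i\<^sub>2 = \<zero>\<^bsub>Mor \<C> B A\<^esub>"
     "i\<^sub>1 \<cdot> p\<^sub>1 \<oplus>\<^bsub>Mor \<C> S S\<^esub> i\<^sub>2 \<cdot> p\<^sub>2 = ident \<C> S"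
  using assms unfolding is_biproduct_def by auto

lemma biproduct_swap:
  assumes "is_biproduct \<C> A B S i\<^sub>1 i\<^sub>2 p\<^sub>1 p\<^sub>2"
  shows "is_biproduct \<C> B A S i\<^sub>2 i\<^sub>1 p\<^sub>2 p\<^sub>1"
proof -
  note b = biproduct_arr[OF assms]
  show ?thesis
    using assms add_arr_comm[OF comp_arr[OF b(3,1)] comp_arr[OF b(4,2)]] unfolding is_biproduct_def
    by simp
qed

lemma biproduct_retract:
  assumes "is_biproduct \<C> A B S i\<^sub>1 i\<^sub>2 p\<^sub>1 p\<^sub>2"
  shows "retract_of \<C> A S"
  using assms unfolding is_biproduct_def retract_of_def by auto

lemma biproduct_decomp:
  assumes "is_biproduct \<C> A B S i\<^sub>1 i\<^sub>2 p\<^sub>1 p\<^sub>2" and "\<guillemotleft>f : S \<rightarrow> D\<guillemotright>"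
  shows "f = (f \<cdot> i\<^sub>1) \<cdot> p\<^sub>1 \<oplus>\<^bsub>Mor \<C> S D\<^esub> (f \<cdot> i\<^sub>2) \<cdot> p\<^sub>2"
proof -
  note b = biproduct_arr[OF assms(1)]
  show ?thesis
    using comp_add_right[OF comp_arr[OF b(3,1)] comp_arr[OF b(4,2)] assms(2)] comp_ident_right[OF assms(2)]
      comp_assoc[OF b(3,1) assms(2)] comp_assoc[OF b(4,2) assms(2)] biproduct_eqs(5)[OF assms(1)]
    by simp
qed

lemma biproduct_direct_sum:
  assumes bi: "is_biproduct \<C> A B S i\<^sub>1 i\<^sub>2 p\<^sub>1 p\<^sub>2"
  shows "is_direct_sum \<C> 2 (\<lambda>j. if j = 0 then A else B) S"
proof -
  interpret abelian_group "Mor \<C> S S" using biproduct_arr[OF bi] mor_abelian_group by auto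
  let ?i = "\<lambda>j::nat. if j = 0 then i\<^sub>1 else i\<^sub>2"
  let ?p = "\<lambda>j::nat. if j = 0 then p\<^sub>1 else p\<^sub>2"
  have c: "i\<^sub>1 \<cdot> p\<^sub>1 \<in> carrier (Mor \<C> S S)" "i\<^sub>2 \<cdot> p\<^sub>2 \<in> carrier (Mor \<C> S S)"
    using biproduct_arr[OF bi] comp_arr by (auto simp: arr_def)
  have lt: "{..<2::nat} = {0, 1}" by auto
  have h3: "(\<Oplus>\<^bsub>Mor \<C> S S\<^esub> j\<in>{..<2}. ?i j \<cdot> ?p j) = ident \<C> S"
    unfolding lt using c biproduct_eqs(5)[OF bi] by (simp add: Pi_def)
  have h1: "\<forall>j<2. \<guillemotleft>?i j : (if j = 0 then A else B) \<rightarrow> S\<guillemotright> \<and> \<guillemotleft>?p j : S \<rightarrow> (if j = 0 then A else B)\<guillemotright>"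
    using biproduct_arr[OF bi] by simp
  have h2: "\<forall>j<2. \<forall>l<2. ?p j \<cdot> ?i l = (if j = l then ident \<C> (if j = 0 then A else B)
      else \<zero>\<^bsub>Mor \<C> (if l = 0 then A else B) (if j = 0 then A else B)\<^esub>)"
    using biproduct_eqs[OF bi] by simp
  show ?thesis
    unfolding is_direct_sum_def
    by (rule conjI[OF biproduct_arr(7)[OF bi]], rule exI[of _ ?i], rule exI[of _ ?p])
      (intro conjI h1 h2 h3)
qed

lemma subcategory_direct_sum:
  assumes "subcategory \<C> \<X>" and "is_direct_sum \<C> n A S" and "\<And>j. j < n \<Longrightarrow> A j \<in> \<X>"
  shows "S \<in> \<X>"
  by (rule assms(1)[unfolded subcategory_def, THEN conjunct2, THEN conjunct2, THEN conjunct1,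
        THEN spec, THEN spec, THEN spec, THEN mp, of n A S]) (intro conjI allI impI assms(2,3))

lemma subcategory_biproduct:
  assumes "subcategory \<C> \<X>" and "is_biproduct \<C> A B S i\<^sub>1 i\<^sub>2 p\<^sub>1 p\<^sub>2" and "A \<in> \<X>" "B \<in> \<X>"
  shows "S \<in> \<X>"
  by (rule subcategory_direct_sum[OF assms(1) biproduct_direct_sum[OF assms(2)]])
    (use assms in auto)

lemma subcategory_summand:
  assumes "subcategory \<C> \<X>" and "is_biproduct \<C> A B S i\<^sub>1 i\<^sub>2 p\<^sub>1 p\<^sub>2" and "S \<in> \<X>"
  shows "A \<in> \<X>" "B \<in> \<X>"
proof -
  note * = assms(1)[unfolded subcategory_def, THEN conjunct2, THEN conjunct2, THEN conjunct2]
  show "A \<in> \<X>" using * assms(2,3) by metis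
  show "B \<in> \<X>" using * biproduct_swap[OF assms(2)] assms(3) by metis
qed

lemma subcategory_isomorphic:
  assumes "subcategory \<C> \<X>" and "A \<in> \<X>" and "isomorphic \<C> A B"
  shows "B \<in> \<X>"
  by (rule assms(1)[unfolded subcategory_def, THEN conjunct2, THEN conjunct1, THEN spec, THEN spec,
        THEN mp, OF conjI[OF assms(2,3)]])

lemma subcategory_Ob: "subcategory \<C> \<X> \<Longrightarrow> A \<in> \<X> \<Longrightarrow> A \<in> Ob \<C>"
  using subcategory_def[THEN iffD1, THEN conjunct1] by blast

lemma direct_sum_retract:
  assumes "is_direct_sum \<C> n B A" and "j < n"
  shows "retract_of \<C> (B j) A"
proof -
  obtain i p where "\<forall>j<n. \<guillemotleft>i j : B j \<rightarrow> A\<guillemotright> \<and> \<guillemotleft>p j : A \<rightarrow> B j\<guillemotright>"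
    "\<forall>j<n. \<forall>l<n. p j \<cdot> i l = (if j = l then ident \<C> (B j) else \<zero>\<^bsub>Mor \<C> (B l) (B j)\<^esub>)"
    using assms(1) unfolding is_direct_sum_def by auto
  then have "\<guillemotleft>i j : B j \<rightarrow> A\<guillemotright>" "\<guillemotleft>p j : A \<rightarrow> B j\<guillemotright>" "p j \<cdot> i j = ident \<C> (B j)"
    using assms(2) by auto
  then show ?thesis unfolding retract_of_def by blast
qed

text \<open>The form in which Krull-Schmidt decompositions enter the proof.\<close>

lemma ident_direct_sum:
  assumes "is_direct_sum \<C> n B A" and "\<And>j. j < n \<Longrightarrow> \<exists>Y\<in>\<G>. isomorphic \<C> (B j) Y"
  shows "ident \<C> A \<in> morphism_sums \<C> A A (through \<C> \<G> A A)"
proof -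
  obtain i p where A: "A \<in> Ob \<C>" and ip: "\<forall>j<n. \<guillemotleft>i j : B j \<rightarrow> A\<guillemotright> \<and> \<guillemotleft>p j : A \<rightarrow> B j\<guillemotright>"
    and sum: "(\<Oplus>\<^bsub>Mor \<C> A A\<^esub> j\<in>{..<n}. i j \<cdot> p j) = ident \<C> A"
    using assms(1) unfolding is_direct_sum_def by auto
  have "i j \<cdot> p j \<in> through \<C> \<G> A A" if j: "j < n" for j
  proof -
    obtain Y u v where Y: "Y \<in> \<G>" "\<guillemotleft>u : B j \<rightarrow> Y\<guillemotright>" "\<guillemotleft>v : Y \<rightarrow> B j\<guillemotright>" "v \<cdot> u = ident \<C> (B j)"
      using assms(2)[OF j] unfolding isomorphic_def is_iso_def by blast
    have ij: "\<guillemotleft>i j : B j \<rightarrow> A\<guillemotright>" "\<guillemotleft>p j : A \<rightarrow> B j\<guillemotright>" using ip j by auto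
    have "i j \<cdot> p j = (i j \<cdot> v) \<cdot> (u \<cdot> p j)"
      using comp_assoc4[OF ij(2) Y(2,3) ij(1)] Y(4) comp_ident_left[OF ij(2)] by simp
    then show ?thesis unfolding through_def using Y ij comp_arr by blast
  qed
  then show ?thesis
    using finsum_morphism_sums[of "{..<n}" A A "through \<C> \<G> A A" "\<lambda>j. i j \<cdot> p j"] A through_arr sum
    by auto
qed

lemma zero_object_Ob: "zero_object \<C> Z \<Longrightarrow> Z \<in> Ob \<C>"
  unfolding zero_object_def by blast

lemma arr_from_zero_object: "zero_object \<C> Z \<Longrightarrow> \<guillemotleft>f : Z \<rightarrow> A\<guillemotright> \<Longrightarrow> \<guillemotleft>g : Z \<rightarrow> A\<guillemotright> \<Longrightarrow> f = g"
  unfolding zero_object_def using arr_Ob(2) by metis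

lemma zero_object_if_ident_zero:
  assumes "A \<in> Ob \<C>" and "ident \<C> A = \<zero>\<^bsub>Mor \<C> A A\<^esub>"
  shows "zero_object \<C> A"
proof -
  have "f = \<zero>\<^bsub>Mor \<C> A B\<^esub>" if "\<guillemotleft>f : A \<rightarrow> B\<guillemotright>" for f B
    using comp_ident_right[OF that] comp_zero_right[OF that assms(1)] assms(2) by simp
  moreover have "f = \<zero>\<^bsub>Mor \<C> B A\<^esub>" if "\<guillemotleft>f : B \<rightarrow> A\<guillemotright>" for f B
    using comp_ident_left[OF that] comp_zero_left[OF that assms(1)] assms(2) by simp
  ultimately show ?thesis unfolding zero_object_def using assms(1) zero_arr by metis
qed

lemma biproduct_zero_object:
  assumes "A \<in> Ob \<C>" and Z: "zero_object \<C> Z"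
  shows "is_biproduct \<C> A Z A (ident \<C> A) \<zero>\<^bsub>Mor \<C> Z A\<^esub> (ident \<C> A) \<zero>\<^bsub>Mor \<C> A Z\<^esub>"
proof -
  note ob = assms(1) zero_object_Ob[OF Z]
  note a = ident_arr[OF ob(1)] zero_arr[OF ob(2,1)] zero_arr[OF ob]
  show ?thesis
    unfolding is_biproduct_def
    using a comp_ident_left[OF a(1)] comp_ident_left[OF a(2)] comp_ident_right[OF a(3)]
      comp_zero_left[OF a(3) ob(1)] add_zero_arr[OF a(1)]
      arr_from_zero_object[OF Z comp_arr[OF a(2,3)] ident_arr[OF ob(2)]]
    by simp
qed

lemma biproduct_pair_comp:
  assumes bi: "is_biproduct \<C> A B T j\<^sub>1 j\<^sub>2 q\<^sub>1 q\<^sub>2"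
    and "\<guillemotleft>a : A \<rightarrow> S\<guillemotright>" "\<guillemotleft>b : B \<rightarrow> S\<guillemotright>" "\<guillemotleft>f : W \<rightarrow> A\<guillemotright>" "\<guillemotleft>g : W \<rightarrow> B\<guillemotright>"
  shows "(a \<cdot> q\<^sub>1 \<oplus>\<^bsub>Mor \<C> T S\<^esub> b \<cdot> q\<^sub>2) \<cdot> (j\<^sub>1 \<cdot> f \<oplus>\<^bsub>Mor \<C> W T\<^esub> j\<^sub>2 \<cdot> g) = a \<cdot> f \<oplus>\<^bsub>Mor \<C> W S\<^esub> b \<cdot> g"
proof -
  note b = biproduct_arr[OF bi] and e = biproduct_eqs[OF bi] and as = assms(2-5)
  note W = arr_Ob(1)[OF as(3)] and S = arr_Ob(2)[OF as(1)]
  let ?v = "j\<^sub>1 \<cdot> f \<oplus>\<^bsub>Mor \<C> W T\<^esub> j\<^sub>2 \<cdot> g"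
  have v: "\<guillemotleft>?v : W \<rightarrow> T\<guillemotright>" using comp_arr b as add_arr by meson
  have "q\<^sub>1 \<cdot> ?v = f"
    using comp_add_right[OF comp_arr[OF as(3) b(1)] comp_arr[OF as(4) b(2)] b(3)]
      comp_assoc[OF as(3) b(1,3)] comp_assoc[OF as(4) b(2,3)] e comp_ident_left[OF as(3)]
      comp_zero_left[OF as(4) b(5)] add_zero_arr[OF as(3)] by simp
  moreover have "q\<^sub>2 \<cdot> ?v = g"
    using comp_add_right[OF comp_arr[OF as(3) b(1)] comp_arr[OF as(4) b(2)] b(4)]
      comp_assoc[OF as(3) b(1,4)] comp_assoc[OF as(4) b(2,4)] e comp_ident_left[OF as(4)]
      comp_zero_left[OF as(3) b(6)] add_zero_arr[OF as(4)] by simp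
  ultimately show ?thesis
    using comp_add_left[OF v comp_arr[OF b(3) as(1)] comp_arr[OF b(4) as(2)]]
      comp_assoc[OF v b(3) as(1)] comp_assoc[OF v b(4) as(2)] by simp
qed

lemma biproduct_pair_inj:
  assumes bi: "is_biproduct \<C> A B T j\<^sub>1 j\<^sub>2 q\<^sub>1 q\<^sub>2" and "\<guillemotleft>a : A \<rightarrow> S\<guillemotright>" "\<guillemotleft>b : B \<rightarrow> S\<guillemotright>"
  shows "(a \<cdot> q\<^sub>1 \<oplus>\<^bsub>Mor \<C> T S\<^esub> b \<cdot> q\<^sub>2) \<cdot> j\<^sub>1 = a" "(a \<cdot> q\<^sub>1 \<oplus>\<^bsub>Mor \<C> T S\<^esub> b \<cdot> q\<^sub>2) \<cdot> j\<^sub>2 = b"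
proof -
  note b = biproduct_arr[OF bi] and e = biproduct_eqs[OF bi] and as = assms(2,3)
  show "(a \<cdot> q\<^sub>1 \<oplus>\<^bsub>Mor \<C> T S\<^esub> b \<cdot> q\<^sub>2) \<cdot> j\<^sub>1 = a"
    using comp_add_left[OF b(1) comp_arr[OF b(3) as(1)] comp_arr[OF b(4) as(2)]] e
      comp_assoc[OF b(1,3) as(1)] comp_assoc[OF b(1,4) as(2)] comp_ident_right[OF as(1)]
      comp_zero_right[OF as(2) b(5)] add_zero_arr[OF as(1)] by simp
  show "(a \<cdot> q\<^sub>1 \<oplus>\<^bsub>Mor \<C> T S\<^esub> b \<cdot> q\<^sub>2) \<cdot> j\<^sub>2 = b"
    using comp_add_left[OF b(2) comp_arr[OF b(3) as(1)] comp_arr[OF b(4) as(2)]] e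
      comp_assoc[OF b(2,3) as(1)] comp_assoc[OF b(2,4) as(2)] comp_ident_right[OF as(2)]
      comp_zero_right[OF as(1) b(6)] add_zero_arr[OF as(2)] by simp
qed

lemma biproduct_proj_pair:
  assumes bi: "is_biproduct \<C> A B T j\<^sub>1 j\<^sub>2 q\<^sub>1 q\<^sub>2" and "\<guillemotleft>f : W \<rightarrow> A\<guillemotright>" "\<guillemotleft>g : W \<rightarrow> B\<guillemotright>"
  shows "q\<^sub>1 \<cdot> (j\<^sub>1 \<cdot> f \<oplus>\<^bsub>Mor \<C> W T\<^esub> j\<^sub>2 \<cdot> g) = f" "q\<^sub>2 \<cdot> (j\<^sub>1 \<cdot> f \<oplus>\<^bsub>Mor \<C> W T\<^esub> j\<^sub>2 \<cdot> g) = g"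
proof -
  note b = biproduct_arr[OF bi] and e = biproduct_eqs[OF bi] and as = assms(2,3)
  show "q\<^sub>1 \<cdot> (j\<^sub>1 \<cdot> f \<oplus>\<^bsub>Mor \<C> W T\<^esub> j\<^sub>2 \<cdot> g) = f"
    using comp_add_right[OF comp_arr[OF as(1) b(1)] comp_arr[OF as(2) b(2)] b(3)]
      comp_assoc[OF as(1) b(1,3)] comp_assoc[OF as(2) b(2,3)] e comp_ident_left[OF as(1)]
      comp_zero_left[OF as(2) b(5)] add_zero_arr[OF as(1)] by simp
  show "q\<^sub>2 \<cdot> (j\<^sub>1 \<cdot> f \<oplus>\<^bsub>Mor \<C> W T\<^esub> j\<^sub>2 \<cdot> g) = g"
    using comp_add_right[OF comp_arr[OF as(1) b(1)] comp_arr[OF as(2) b(2)] b(4)]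
      comp_assoc[OF as(1) b(1,4)] comp_assoc[OF as(2) b(2,4)] e comp_ident_left[OF as(2)]
      comp_zero_left[OF as(1) b(6)] add_zero_arr[OF as(2)] by simp
qed

text \<open>The automorphism of \<open>T = A \<oplus> B\<close> given by the matrix with rows \<open>(1, 0)\<close> and \<open>(f, 1)\<close> transports the
  biproduct structure. This makes the graph of \<open>f\<close> a split inflation.\<close>

lemma biproduct_shear:
  assumes bi: "is_biproduct \<C> A B T j\<^sub>1 j\<^sub>2 q\<^sub>1 q\<^sub>2" and f: "\<guillemotleft>f : A \<rightarrow> B\<guillemotright>"
    and f': "f' = \<ominus>\<^bsub>Mor \<C> A B\<^esub> f"
  shows "is_biproduct \<C> A B T (j\<^sub>1 \<cdot> ident \<C> A \<oplus>\<^bsub>Mor \<C> A T\<^esub> j\<^sub>2 \<cdot> f) j\<^sub>2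
    q\<^sub>1 (f' \<cdot> q\<^sub>1 \<oplus>\<^bsub>Mor \<C> T B\<^esub> ident \<C> B \<cdot> q\<^sub>2)"
proof -
  note b = biproduct_arr[OF bi] and e = biproduct_eqs[OF bi]
  note i = ident_arr[OF b(5)] ident_arr[OF b(6)]
  have f'a: "\<guillemotleft>f' : A \<rightarrow> B\<guillemotright>" using f f' neg_arr by simp
  let ?i = "j\<^sub>1 \<cdot> ident \<C> A \<oplus>\<^bsub>Mor \<C> A T\<^esub> j\<^sub>2 \<cdot> f"
  let ?p = "f' \<cdot> q\<^sub>1 \<oplus>\<^bsub>Mor \<C> T B\<^esub> ident \<C> B \<cdot> q\<^sub>2"
  have ia: "\<guillemotleft>?i : A \<rightarrow> T\<guillemotright>" by (intro add_arr comp_arr[OF i(1) b(1)] comp_arr[OF f b(2)])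
  have pa: "\<guillemotleft>?p : T \<rightarrow> B\<guillemotright>" by (intro add_arr comp_arr[OF b(3) f'a] comp_arr[OF b(4) i(2)])
  have 1: "?p \<cdot> ?i = \<zero>\<^bsub>Mor \<C> A B\<^esub>"
    using biproduct_pair_comp[OF bi f'a i(2) i(1) f] comp_ident_left[OF f] comp_ident_right[OF f'a]
      add_neg_arr(2)[OF f] f' by simp
  have u: "\<guillemotleft>(j\<^sub>2 \<cdot> f) \<cdot> q\<^sub>1 : T \<rightarrow> T\<guillemotright>" (is "\<guillemotleft>?u : T \<rightarrow> T\<guillemotright>") using b f comp_arr by meson
  have v: "\<guillemotleft>j\<^sub>1 \<cdot> q\<^sub>1 : T \<rightarrow> T\<guillemotright>" and w: "\<guillemotleft>j\<^sub>2 \<cdot> q\<^sub>2 : T \<rightarrow> T\<guillemotright>" using b comp_arr by meson+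
  have 2: "?i \<cdot> q\<^sub>1 = j\<^sub>1 \<cdot> q\<^sub>1 \<oplus>\<^bsub>Mor \<C> T T\<^esub> ?u"
    using comp_add_left[OF b(3) comp_arr[OF i(1) b(1)] comp_arr[OF f b(2)]] comp_ident_right[OF b(1)]
    by simp
  have 3: "j\<^sub>2 \<cdot> ?p = \<ominus>\<^bsub>Mor \<C> T T\<^esub> ?u \<oplus>\<^bsub>Mor \<C> T T\<^esub> j\<^sub>2 \<cdot> q\<^sub>2"
    using comp_add_right[OF comp_arr[OF b(3) f'a] comp_arr[OF b(4) i(2)] b(2)] comp_ident_left[OF b(4)]
      comp_assoc[OF b(3) f'a b(2)] comp_neg_right[OF f b(2)] comp_neg_left[OF b(3) comp_arr[OF f b(2)]] f'
    by simp
  have "?i \<cdot> q\<^sub>1 \<oplus>\<^bsub>Mor \<C> T T\<^esub> j\<^sub>2 \<cdot> ?p = j\<^sub>1 \<cdot> q\<^sub>1 \<oplus>\<^bsub>Mor \<C> T T\<^esub> (?u \<oplus>\<^bsub>Mor \<C> T T\<^esub> (\<ominus>\<^bsub>Mor \<C> T T\<^esub> ?u \<oplus>\<^bsub>Mor \<C> T T\<^esub> j\<^sub>2 \<cdot> q\<^sub>2))"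
    unfolding 2 3 by (rule add_arr_assoc[OF v u add_arr[OF neg_arr[OF u] w]])
  also have "\<dots> = ident \<C> T"
    using add_arr_assoc[OF u neg_arr[OF u] w] add_neg_arr(1)[OF u] add_zero_arr[OF w] e(5) by simp
  finally show ?thesis
    unfolding is_biproduct_def
    using ia pa b 1 e(4) biproduct_pair_inj(2)[OF bi f'a i(2)] biproduct_proj_pair(1)[OF bi i(1) f]
    by simp
qed

lemma lift_morphism_sums:
  assumes f: "f \<in> morphism_sums \<C> A T P" and y: "\<guillemotleft>y : S \<rightarrow> T\<guillemotright>" and A: "A \<in> Ob \<C>"
    and P: "\<And>g. g \<in> P \<Longrightarrow> \<exists>k. \<guillemotleft>k : A \<rightarrow> S\<guillemotright> \<and> y \<cdot> k = g"
  shows "\<exists>k. \<guillemotleft>k : A \<rightarrow> S\<guillemotright> \<and> y \<cdot> k = f"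
  using f
proof induction
  case zero
  then show ?case using zero_arr[OF A arr_Ob(1)[OF y]] comp_zero_right[OF y A] by blast
next
  case (add f g)
  obtain k where k: "\<guillemotleft>k : A \<rightarrow> S\<guillemotright>" "y \<cdot> k = f" using P[OF add(1)] by blast
  obtain l where l: "\<guillemotleft>l : A \<rightarrow> S\<guillemotright>" "y \<cdot> l = g" using add.IH by blast
  show ?case using comp_add_right[OF k(1) l(1) y] k(2) l(2) add_arr[OF k(1) l(1)] by auto
qed

lemma extend_morphism_sums:
  assumes f: "f \<in> morphism_sums \<C> A T P" and x: "\<guillemotleft>x : A \<rightarrow> S\<guillemotright>" and T: "T \<in> Ob \<C>"
    and P: "\<And>g. g \<in> P \<Longrightarrow> \<exists>k. \<guillemotleft>k : S \<rightarrow> T\<guillemotright> \<and> k \<cdot> x = g"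
  shows "\<exists>k. \<guillemotleft>k : S \<rightarrow> T\<guillemotright> \<and> k \<cdot> x = f"
  using f
proof induction
  case zero
  then show ?case using zero_arr[OF arr_Ob(2)[OF x] T] comp_zero_left[OF x T] by blast
next
  case (add f g)
  obtain k where k: "\<guillemotleft>k : S \<rightarrow> T\<guillemotright>" "k \<cdot> x = f" using P[OF add(1)] by blast
  obtain l where l: "\<guillemotleft>l : S \<rightarrow> T\<guillemotright>" "l \<cdot> x = g" using add.IH by blast
  show ?case using comp_add_left[OF x k(1) l(1)] k(2) l(2) add_arr[OF k(1) l(1)] by auto
qed

lemma through_sums_from:
  assumes "ident \<C> M \<in> morphism_sums \<C> M M (through \<C> \<G> M M)" and h: "\<guillemotleft>h : M \<rightarrow> T\<guillemotright>"
  shows "h \<in> morphism_sums \<C> M T (through \<C> \<G> M T)"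
  using through_sums_comp[OF assms(1) ident_arr[OF arr_Ob(1)[OF h]] h] comp_ident_right[OF h] by simp

lemma through_sums_to:
  assumes "ident \<C> M \<in> morphism_sums \<C> M M (through \<C> \<G> M M)" and h: "\<guillemotleft>h : A \<rightarrow> M\<guillemotright>"
  shows "h \<in> morphism_sums \<C> A M (through \<C> \<G> A M)"
  using through_sums_comp[OF assms(1) h ident_arr[OF arr_Ob(2)[OF h]]] comp_ident_left[OF h]
    comp_ident_left[OF ident_arr[OF arr_Ob(2)[OF h]]] by simp

lemma morphism_sums_mono: "f \<in> morphism_sums \<C> A B P \<Longrightarrow> P \<subseteq> P' \<Longrightarrow> f \<in> morphism_sums \<C> A B P'"
proof (induction rule: morphism_sums.induct)
  case zero
  show ?case by (rule morphism_sums.zero)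
next
  case (add f g)
  then show ?case by (meson morphism_sums.add subsetD)
qed

lemma Units_End_ring:
  assumes "A \<in> Ob \<C>"
  shows "f \<in> Units (End_ring \<C> A) \<longleftrightarrow> is_iso \<C> f A A"
  using assms unfolding Units_def End_ring_def is_iso_def arr_def by auto

lemma local_sum_iso:
  assumes loc: "local_ring (End_ring \<C> A)" and f: "\<guillemotleft>f : A \<rightarrow> A\<guillemotright>" and g: "\<guillemotleft>g : A \<rightarrow> A\<guillemotright>"
    and iso: "is_iso \<C> (f \<oplus>\<^bsub>Mor \<C> A A\<^esub> g) A A"
  shows "is_iso \<C> f A A \<or> is_iso \<C> g A A"
proof (rule ccontr)
  note A = arr_Ob(1)[OF f]
  assume "\<not> (is_iso \<C> f A A \<or> is_iso \<C> g A A)"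
  then have "f \<in> carrier (End_ring \<C> A) - Units (End_ring \<C> A)" "g \<in> carrier (End_ring \<C> A) - Units (End_ring \<C> A)"
    using Units_End_ring[OF A] f g by (auto simp: End_ring_def arr_def)
  then have "f \<oplus>\<^bsub>End_ring \<C> A\<^esub> g \<notin> Units (End_ring \<C> A)" using loc unfolding local_ring_def by blast
  then show False using iso Units_End_ring[OF A] by (simp add: End_ring_def)
qed

lemma local_ident_nonzero: "local_ring (End_ring \<C> A) \<Longrightarrow> ident \<C> A \<noteq> \<zero>\<^bsub>Mor \<C> A A\<^esub>"
  unfolding local_ring_def End_ring_def by simp

text \<open>The idempotent \<open>u b\<close> and its complement sum to the identity, so one of them is invertible; the
  complement annihilates \<open>u\<close>.\<close>

lemma local_left_invertible:
  assumes loc: "local_ring (End_ring \<C> A)" and u: "\<guillemotleft>u : A \<rightarrow> A\<guillemotright>" and b: "\<guillemotleft>b : A \<rightarrow> A\<guillemotright>" and bu: "b \<cdot> u = ident \<C> A"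
  shows "is_iso \<C> u A A"
proof -
  note A = arr_Ob(1)[OF u] note i = ident_arr[OF A]
  note ub = comp_arr[OF b u]
  let ?e = "ident \<C> A \<oplus>\<^bsub>Mor \<C> A A\<^esub> (\<ominus>\<^bsub>Mor \<C> A A\<^esub> (u \<cdot> b))"
  note n = neg_arr[OF ub] note e = add_arr[OF i n]
  have "?e \<oplus>\<^bsub>Mor \<C> A A\<^esub> u \<cdot> b = ident \<C> A"
    using add_arr_assoc[OF i n ub] add_neg_arr(2)[OF ub] add_zero_arr(1)[OF i] by simp
  then consider "is_iso \<C> ?e A A" | "is_iso \<C> (u \<cdot> b) A A"
    using local_sum_iso[OF loc e ub] is_iso_ident[OF A] by metis
  then show ?thesis
  proof cases
    case 1
    then obtain g where g: "\<guillemotleft>g : A \<rightarrow> A\<guillemotright>" "g \<cdot> ?e = ident \<C> A" unfolding is_iso_def by blast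
    have "?e \<cdot> u = \<zero>\<^bsub>Mor \<C> A A\<^esub>"
      using comp_add_left[OF u i n] comp_ident_left[OF u] comp_neg_left[OF u ub] comp_assoc[OF u b u] bu
        comp_ident_right[OF u] add_neg_arr(1)[OF u] by simp
    then have "u = \<zero>\<^bsub>Mor \<C> A A\<^esub>" using comp_assoc[OF u e g(1)] g(2) comp_ident_left[OF u] comp_zero_right[OF g(1) A] by simp
    then have "ident \<C> A = \<zero>\<^bsub>Mor \<C> A A\<^esub>" using bu comp_zero_right[OF b A] by simp
    then show ?thesis using local_ident_nonzero[OF loc] by blast
  next
    case 2
    then obtain c where c: "\<guillemotleft>c : A \<rightarrow> A\<guillemotright>" "(u \<cdot> b) \<cdot> c = ident \<C> A" unfolding is_iso_def by blast
    have r: "u \<cdot> (b \<cdot> c) = ident \<C> A" using comp_assoc[OF c(1) b u] c(2) by simp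
    have "b \<cdot> c = b"
      using comp_assoc[OF comp_arr[OF c(1) b] u b] bu r comp_ident_left[OF comp_arr[OF c(1) b]] comp_ident_right[OF b]
      by simp
    then show ?thesis unfolding is_iso_def using u b bu r by metis
  qed
qed

lemma retract_if_comp_iso:
  assumes u: "\<guillemotleft>u : A \<rightarrow> B\<guillemotright>" and v: "\<guillemotleft>v : B \<rightarrow> A\<guillemotright>" and iso: "is_iso \<C> (v \<cdot> u) A A"
  shows "retract_of \<C> A B"
proof -
  obtain g where g: "\<guillemotleft>g : A \<rightarrow> A\<guillemotright>" "g \<cdot> (v \<cdot> u) = ident \<C> A" using iso unfolding is_iso_def by blast
  then have "(g \<cdot> v) \<cdot> u = ident \<C> A" using comp_assoc[OF u v g(1)] by simp
  then show ?thesis unfolding retract_of_def using u comp_arr[OF v g(1)] by blast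
qed

lemma local_indecomposable:
  assumes A: "A \<in> Ob \<C>" and loc: "local_ring (End_ring \<C> A)"
  shows "indecomposable \<C> A"
proof -
  have z: "zero_object \<C> D"
    if bi: "is_biproduct \<C> B D A i\<^sub>1 i\<^sub>2 p\<^sub>1 p\<^sub>2" and iso: "is_iso \<C> (i\<^sub>1 \<cdot> p\<^sub>1) A A" for B D i\<^sub>1 i\<^sub>2 p\<^sub>1 p\<^sub>2
  proof -
    note b = biproduct_arr[OF bi] and e = biproduct_eqs[OF bi] note ip = comp_arr[OF b(3,1)]
    obtain g where g: "\<guillemotleft>g : A \<rightarrow> A\<guillemotright>" "(i\<^sub>1 \<cdot> p\<^sub>1) \<cdot> g = ident \<C> A" using iso unfolding is_iso_def by blast
    have "p\<^sub>2 \<cdot> (i\<^sub>1 \<cdot> p\<^sub>1) = \<zero>\<^bsub>Mor \<C> A D\<^esub>"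
      using comp_assoc[OF b(3,1,4)] e(3) comp_zero_left[OF b(3,6)] by simp
    then have "p\<^sub>2 = \<zero>\<^bsub>Mor \<C> A D\<^esub>"
      using comp_assoc[OF g(1) ip b(4)] g(2) comp_ident_right[OF b(4)] comp_zero_left[OF g(1) b(6)] by simp
    then have "ident \<C> D = \<zero>\<^bsub>Mor \<C> D D\<^esub>" using e(2) comp_zero_left[OF b(2,6)] by simp
    then show ?thesis by (rule zero_object_if_ident_zero[OF b(6)])
  qed
  have "zero_object \<C> B \<or> zero_object \<C> D" if bi: "is_biproduct \<C> B D A i\<^sub>1 i\<^sub>2 p\<^sub>1 p\<^sub>2" for B D i\<^sub>1 i\<^sub>2 p\<^sub>1 p\<^sub>2
  proof -
    note b = biproduct_arr[OF bi]
    have "is_iso \<C> (i\<^sub>1 \<cdot> p\<^sub>1 \<oplus>\<^bsub>Mor \<C> A A\<^esub> i\<^sub>2 \<cdot> p\<^sub>2) A A" using biproduct_eqs(5)[OF bi] is_iso_ident[OF A] by simp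
    then show ?thesis
      using local_sum_iso[OF loc comp_arr[OF b(3,1)] comp_arr[OF b(4,2)]] z[OF bi] z[OF biproduct_swap[OF bi]]
      by blast
  qed
  moreover have "\<not> zero_object \<C> A"
    using arr_from_zero_object[OF _ ident_arr[OF A] zero_arr[OF A A]] local_ident_nonzero[OF loc] by blast
  ultimately show ?thesis unfolding indecomposable_def using A by blast
qed

end

section \<open>Extension groups and exactness\<close>

context extriangulated_category
begin

lemma Ext_zero: "D \<in> Ob \<C> \<Longrightarrow> A \<in> Ob \<C> \<Longrightarrow> \<zero>\<^bsub>Ext \<C> D A\<^esub> \<in> carrier (Ext \<C> D A)"
  by (simp add: abelian_groupE(2) Ext_abelian_group)

lemma Ext_map_closed:
  "\<guillemotleft>c : D' \<rightarrow> D\<guillemotright> \<Longrightarrow> \<guillemotleft>a : A \<rightarrow> A'\<guillemotright> \<Longrightarrow> \<delta> \<in> carrier (Ext \<C> D A) \<Longrightarrow>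
    Ext_map \<C> c a \<delta> \<in> carrier (Ext \<C> D' A')"
  using Ext_map_hom unfolding hom_def by fastforce

lemma Ext_map_add:
  "\<guillemotleft>c : D' \<rightarrow> D\<guillemotright> \<Longrightarrow> \<guillemotleft>a : A \<rightarrow> A'\<guillemotright> \<Longrightarrow> \<delta> \<in> carrier (Ext \<C> D A) \<Longrightarrow> \<epsilon> \<in> carrier (Ext \<C> D A) \<Longrightarrow>
    Ext_map \<C> c a (\<delta> \<oplus>\<^bsub>Ext \<C> D A\<^esub> \<epsilon>) = Ext_map \<C> c a \<delta> \<oplus>\<^bsub>Ext \<C> D' A'\<^esub> Ext_map \<C> c a \<epsilon>"
  using Ext_map_hom unfolding hom_def by fastforce

lemma Ext_add_eq_self:
  assumes "D \<in> Ob \<C>" "A \<in> Ob \<C>" "\<delta> \<in> carrier (Ext \<C> D A)" "\<epsilon> \<in> carrier (Ext \<C> D A)"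
    and "\<delta> = \<delta> \<oplus>\<^bsub>Ext \<C> D A\<^esub> \<epsilon>"
  shows "\<epsilon> = \<zero>\<^bsub>Ext \<C> D A\<^esub>"
proof -
  interpret abelian_group "Ext \<C> D A" using assms Ext_abelian_group by auto
  show ?thesis using assms add.l_cancel_one'[of \<delta> \<epsilon>] by simp
qed

lemma Ext_add_zero:
  assumes "D \<in> Ob \<C>" "A \<in> Ob \<C>" "\<delta> \<in> carrier (Ext \<C> D A)"
  shows "\<delta> \<oplus>\<^bsub>Ext \<C> D A\<^esub> \<zero>\<^bsub>Ext \<C> D A\<^esub> = \<delta>" "\<zero>\<^bsub>Ext \<C> D A\<^esub> \<oplus>\<^bsub>Ext \<C> D A\<^esub> \<delta> = \<delta>"
proof -
  interpret abelian_group "Ext \<C> D A" using assms Ext_abelian_group by auto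
  show "\<delta> \<oplus>\<^bsub>Ext \<C> D A\<^esub> \<zero>\<^bsub>Ext \<C> D A\<^esub> = \<delta>" "\<zero>\<^bsub>Ext \<C> D A\<^esub> \<oplus>\<^bsub>Ext \<C> D A\<^esub> \<delta> = \<delta>"
    using assms by simp_all
qed

lemma Ext_map_zero:
  assumes "\<guillemotleft>c : D' \<rightarrow> D\<guillemotright>" "\<guillemotleft>a : A \<rightarrow> A'\<guillemotright>"
  shows "Ext_map \<C> c a \<zero>\<^bsub>Ext \<C> D A\<^esub> = \<zero>\<^bsub>Ext \<C> D' A'\<^esub>"
proof -
  note ob = arr_Ob[OF assms(1)] arr_Ob[OF assms(2)]
  note z = Ext_zero[OF ob(2,3)]
  show ?thesis
    using Ext_add_eq_self[OF ob(1,4) Ext_map_closed[OF assms z] Ext_map_closed[OF assms z]]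
      Ext_map_add[OF assms z z] Ext_add_zero[OF ob(2,3) z] by simp
qed

lemma Ext_map_zero_left:
  assumes "D' \<in> Ob \<C>" "D \<in> Ob \<C>" "\<guillemotleft>a : A \<rightarrow> A'\<guillemotright>" "\<delta> \<in> carrier (Ext \<C> D A)"
  shows "Ext_map \<C> \<zero>\<^bsub>Mor \<C> D' D\<^esub> a \<delta> = \<zero>\<^bsub>Ext \<C> D' A'\<^esub>"
proof -
  note z = zero_arr[OF assms(1,2)]
  note cl = Ext_map_closed[OF z assms(3,4)]
  show ?thesis
    using Ext_add_eq_self[OF assms(1) arr_Ob(2)[OF assms(3)] cl cl]
      Ext_map_add_left[OF z z assms(3,4)] add_zero_arr[OF z] by simp
qed

lemma Ext_map_zero_right:
  assumes "A \<in> Ob \<C>" "A' \<in> Ob \<C>" "\<guillemotleft>c : D' \<rightarrow> D\<guillemotright>" "\<delta> \<in> carrier (Ext \<C> D A)"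
  shows "Ext_map \<C> c \<zero>\<^bsub>Mor \<C> A A'\<^esub> \<delta> = \<zero>\<^bsub>Ext \<C> D' A'\<^esub>"
proof -
  note z = zero_arr[OF assms(1,2)]
  note cl = Ext_map_closed[OF assms(3) z assms(4)]
  show ?thesis
    using Ext_add_eq_self[OF arr_Ob(1)[OF assms(3)] assms(2) cl cl]
      Ext_map_add_right[OF assms(3) z z assms(4)] add_zero_arr[OF z] by simp
qed

lemma push_closed:
  "D \<in> Ob \<C> \<Longrightarrow> \<guillemotleft>a : A \<rightarrow> A'\<guillemotright> \<Longrightarrow> \<delta> \<in> carrier (Ext \<C> D A) \<Longrightarrow> push \<C> D a \<delta> \<in> carrier (Ext \<C> D A')"
  unfolding push_def using Ext_map_closed ident_arr by blast

lemma pull_closed: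
  "A \<in> Ob \<C> \<Longrightarrow> \<guillemotleft>c : D' \<rightarrow> D\<guillemotright> \<Longrightarrow> \<delta> \<in> carrier (Ext \<C> D A) \<Longrightarrow> pull \<C> A c \<delta> \<in> carrier (Ext \<C> D' A)"
  unfolding pull_def using Ext_map_closed ident_arr by blast

lemma push_comp:
  assumes "D \<in> Ob \<C>" "\<guillemotleft>a : A \<rightarrow> A'\<guillemotright>" "\<guillemotleft>a' : A' \<rightarrow> A''\<guillemotright>" "\<delta> \<in> carrier (Ext \<C> D A)"
  shows "push \<C> D (a' \<cdot> a) \<delta> = push \<C> D a' (push \<C> D a \<delta>)"
  using Ext_map_comp[OF ident_arr[OF assms(1)] ident_arr[OF assms(1)] assms(2-4)]
    comp_ident_left[OF ident_arr[OF assms(1)]] unfolding push_def by simp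

lemma pull_comp:
  assumes "A \<in> Ob \<C>" "\<guillemotleft>c : D' \<rightarrow> D\<guillemotright>" "\<guillemotleft>c' : D'' \<rightarrow> D'\<guillemotright>" "\<delta> \<in> carrier (Ext \<C> D A)"
  shows "pull \<C> A (c \<cdot> c') \<delta> = pull \<C> A c' (pull \<C> A c \<delta>)"
  using Ext_map_comp[OF assms(2,3) ident_arr[OF assms(1)] ident_arr[OF assms(1)] assms(4)]
    comp_ident_left[OF ident_arr[OF assms(1)]] unfolding pull_def by simp

lemma push_ident: "D \<in> Ob \<C> \<Longrightarrow> A \<in> Ob \<C> \<Longrightarrow> \<delta> \<in> carrier (Ext \<C> D A) \<Longrightarrow> push \<C> D (ident \<C> A) \<delta> = \<delta>"
  unfolding push_def by (rule Ext_map_ident)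

lemma pull_ident: "D \<in> Ob \<C> \<Longrightarrow> A \<in> Ob \<C> \<Longrightarrow> \<delta> \<in> carrier (Ext \<C> D A) \<Longrightarrow> pull \<C> A (ident \<C> D) \<delta> = \<delta>"
  unfolding pull_def by (rule Ext_map_ident)

lemma push_pull:
  assumes "\<guillemotleft>a : A \<rightarrow> A'\<guillemotright>" "\<guillemotleft>c : D' \<rightarrow> D\<guillemotright>" "\<delta> \<in> carrier (Ext \<C> D A)"
  shows "push \<C> D' a (pull \<C> A c \<delta>) = pull \<C> A' c (push \<C> D a \<delta>)"
proof -
  note i = ident_arr[OF arr_Ob(1)[OF assms(1)]] ident_arr[OF arr_Ob(2)[OF assms(1)]]
    ident_arr[OF arr_Ob(1)[OF assms(2)]] ident_arr[OF arr_Ob(2)[OF assms(2)]]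
  show ?thesis
    using Ext_map_comp[OF assms(2) i(3,1) assms(1,3)] Ext_map_comp[OF i(4) assms(2,1) i(2) assms(3)]
      comp_ident_right[OF assms(2)] comp_ident_left[OF assms(2)]
      comp_ident_right[OF assms(1)] comp_ident_left[OF assms(1)]
    unfolding push_def pull_def by simp
qed

lemma push_zero: "D \<in> Ob \<C> \<Longrightarrow> \<guillemotleft>a : A \<rightarrow> A'\<guillemotright> \<Longrightarrow> push \<C> D a \<zero>\<^bsub>Ext \<C> D A\<^esub> = \<zero>\<^bsub>Ext \<C> D A'\<^esub>"
  unfolding push_def using Ext_map_zero ident_arr by blast

lemma pull_zero: "A \<in> Ob \<C> \<Longrightarrow> \<guillemotleft>c : D' \<rightarrow> D\<guillemotright> \<Longrightarrow> pull \<C> A c \<zero>\<^bsub>Ext \<C> D A\<^esub> = \<zero>\<^bsub>Ext \<C> D' A\<^esub>"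
  unfolding pull_def using Ext_map_zero ident_arr by blast

lemma push_zero_arr:
  "D \<in> Ob \<C> \<Longrightarrow> A \<in> Ob \<C> \<Longrightarrow> A' \<in> Ob \<C> \<Longrightarrow> \<delta> \<in> carrier (Ext \<C> D A) \<Longrightarrow>
    push \<C> D \<zero>\<^bsub>Mor \<C> A A'\<^esub> \<delta> = \<zero>\<^bsub>Ext \<C> D A'\<^esub>"
  unfolding push_def using Ext_map_zero_right ident_arr by blast

lemma pull_zero_arr:
  "A \<in> Ob \<C> \<Longrightarrow> D \<in> Ob \<C> \<Longrightarrow> D' \<in> Ob \<C> \<Longrightarrow> \<delta> \<in> carrier (Ext \<C> D A) \<Longrightarrow>
    pull \<C> A \<zero>\<^bsub>Mor \<C> D' D\<^esub> \<delta> = \<zero>\<^bsub>Ext \<C> D' A\<^esub>"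
  unfolding pull_def using Ext_map_zero_left ident_arr by blast

lemma push_add_arr:
  "D \<in> Ob \<C> \<Longrightarrow> \<guillemotleft>a : A \<rightarrow> A'\<guillemotright> \<Longrightarrow> \<guillemotleft>a' : A \<rightarrow> A'\<guillemotright> \<Longrightarrow> \<delta> \<in> carrier (Ext \<C> D A) \<Longrightarrow>
    push \<C> D (a \<oplus>\<^bsub>Mor \<C> A A'\<^esub> a') \<delta> = push \<C> D a \<delta> \<oplus>\<^bsub>Ext \<C> D A'\<^esub> push \<C> D a' \<delta>"
  unfolding push_def using Ext_map_add_right ident_arr by blast

lemma pull_add_arr:
  "A \<in> Ob \<C> \<Longrightarrow> \<guillemotleft>c : D' \<rightarrow> D\<guillemotright> \<Longrightarrow> \<guillemotleft>c' : D' \<rightarrow> D\<guillemotright> \<Longrightarrow> \<delta> \<in> carrier (Ext \<C> D A) \<Longrightarrow>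
    pull \<C> A (c \<oplus>\<^bsub>Mor \<C> D' D\<^esub> c') \<delta> = pull \<C> A c \<delta> \<oplus>\<^bsub>Ext \<C> D' A\<^esub> pull \<C> A c' \<delta>"
  unfolding pull_def using Ext_map_add_left ident_arr by blast

text \<open>Realizations are equivalence classes; a representative is used to obtain an E-triangle and to
  compare two of them.\<close>

lemma realization_sequence:
  assumes "D \<in> Ob \<C>" "A \<in> Ob \<C>" "\<delta> \<in> carrier (Ext \<C> D A)"
  obtains s where "s \<in> sequences \<C> A D" "realization \<C> D A \<delta> = seq_equiv \<C> A D `` {s}"
  using realization_class[OF assms] by (elim quotientE)

lemma E_triangle_arr:
  assumes "E_triangle \<C> A x B y D \<delta>"
  shows "\<guillemotleft>x : A \<rightarrow> B\<guillemotright>" "\<guillemotleft>y : B \<rightarrow> D\<guillemotright>" "\<delta> \<in> carrier (Ext \<C> D A)"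
    "A \<in> Ob \<C>" "B \<in> Ob \<C>" "D \<in> Ob \<C>"
proof -
  have t: "A \<in> Ob \<C>" "D \<in> Ob \<C>" "\<delta> \<in> carrier (Ext \<C> D A)" "(B, x, y) \<in> realization \<C> D A \<delta>"
    using assms unfolding E_triangle_def by auto
  obtain s where "realization \<C> D A \<delta> = seq_equiv \<C> A D `` {s}"
    using realization_sequence[OF t(2,1,3)] .
  then have "(B, x, y) \<in> sequences \<C> A D" using t(4) unfolding seq_equiv_def by auto
  then show "\<guillemotleft>x : A \<rightarrow> B\<guillemotright>" "\<guillemotleft>y : B \<rightarrow> D\<guillemotright>" "\<delta> \<in> carrier (Ext \<C> D A)"
    "A \<in> Ob \<C>" "B \<in> Ob \<C>" "D \<in> Ob \<C>"
    using t arr_Ob unfolding sequences_def by auto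
qed

lemma ex_E_triangle:
  assumes "D \<in> Ob \<C>" "A \<in> Ob \<C>" "\<delta> \<in> carrier (Ext \<C> D A)"
  obtains x B y where "E_triangle \<C> A x B y D \<delta>"
proof -
  obtain s where s: "s \<in> sequences \<C> A D" "realization \<C> D A \<delta> = seq_equiv \<C> A D `` {s}"
    using realization_sequence[OF assms] .
  obtain B x y where B: "s = (B, x, y)" "\<guillemotleft>x : A \<rightarrow> B\<guillemotright>" "\<guillemotleft>y : B \<rightarrow> D\<guillemotright>"
    using s(1) unfolding sequences_def by auto
  have "(s, s) \<in> seq_equiv \<C> A D"
    using s(1) B is_iso_ident[OF arr_Ob(2)[OF B(2)]] comp_ident_left[OF B(2)] comp_ident_right[OF B(3)]
    unfolding seq_equiv_def by auto
  then have "E_triangle \<C> A x B y D \<delta>" unfolding E_triangle_def using assms s B by auto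
  then show thesis by (rule that)
qed

lemma E_triangle_middle_isomorphic:
  assumes "E_triangle \<C> A x B y D \<delta>" and "E_triangle \<C> A x' B' y' D \<delta>"
  shows "isomorphic \<C> B B'"
proof -
  have t: "A \<in> Ob \<C>" "D \<in> Ob \<C>" "\<delta> \<in> carrier (Ext \<C> D A)" "(B, x, y) \<in> realization \<C> D A \<delta>"
    "(B', x', y') \<in> realization \<C> D A \<delta>"
    using assms unfolding E_triangle_def by auto
  obtain s where "realization \<C> D A \<delta> = seq_equiv \<C> A D `` {s}"
    using realization_sequence[OF t(2,1,3)] .
  then have "isomorphic \<C> (fst s) B" "isomorphic \<C> (fst s) B'"
    using t(4,5) unfolding seq_equiv_def isomorphic_def by auto
  then show ?thesis using isomorphic_sym isomorphic_trans by blast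
qed

lemma E_triangle_ident_zero:
  assumes "A \<in> Ob \<C>" and Z: "zero_object \<C> Z"
  shows "E_triangle \<C> A (ident \<C> A) A \<zero>\<^bsub>Mor \<C> A Z\<^esub> Z \<zero>\<^bsub>Ext \<C> Z A\<^esub>"
    and "E_triangle \<C> Z \<zero>\<^bsub>Mor \<C> Z A\<^esub> A (ident \<C> A) A \<zero>\<^bsub>Ext \<C> A Z\<^esub>"
  using realization_zero[OF biproduct_zero_object[OF assms]]
    realization_zero[OF biproduct_swap[OF biproduct_zero_object[OF assms]]] by auto

lemma Ext_morphismD:
  assumes "ext_morphism \<C> a c D A \<delta> D' A' \<delta>'"
  shows "push \<C> D a \<delta> = pull \<C> A' c \<delta>'"
  using assms unfolding ext_morphism_def by blast

lemma Ext_morphismI: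
  assumes "\<delta> \<in> carrier (Ext \<C> D A)" "\<delta>' \<in> carrier (Ext \<C> D' A')" "\<guillemotleft>a : A \<rightarrow> A'\<guillemotright>" "\<guillemotleft>c : D \<rightarrow> D'\<guillemotright>"
    "push \<C> D a \<delta> = pull \<C> A' c \<delta>'"
  shows "ext_morphism \<C> a c D A \<delta> D' A' \<delta>'"
  using assms unfolding ext_morphism_def by blast

text \<open>Here and below an object \<open>A\<close> is compared with the split triangles \<open>A \<rightarrow> A \<rightarrow> 0\<close> and \<open>0 \<rightarrow> A \<rightarrow> A\<close>;
  exactness follows from ET3, its dual, and the realization of morphisms.\<close>

lemma E_triangle_push_zero:
  assumes t: "E_triangle \<C> A x B y D \<delta>"
  shows "push \<C> D x \<delta> = \<zero>\<^bsub>Ext \<C> D B\<^esub>"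
proof -
  obtain Z where Z: "zero_object \<C> Z" using ex_zero_object by blast
  note a = E_triangle_arr[OF t] and i = ident_arr[OF E_triangle_arr(5)[OF t]]
  obtain c where c: "\<guillemotleft>c : D \<rightarrow> Z\<guillemotright>" "ext_morphism \<C> x c D A \<delta> Z B \<zero>\<^bsub>Ext \<C> Z B\<^esub>"
    using ET3[OF t E_triangle_ident_zero(1)[OF a(5) Z] a(1) i refl] by blast
  then show ?thesis using Ext_morphismD[OF c(2)] pull_zero[OF a(5) c(1)] by simp
qed

lemma E_triangle_pull_zero:
  assumes t: "E_triangle \<C> A x B y D \<delta>"
  shows "pull \<C> A y \<delta> = \<zero>\<^bsub>Ext \<C> B A\<^esub>"
proof -
  obtain Z where Z: "zero_object \<C> Z" using ex_zero_object by blast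
  note a = E_triangle_arr[OF t] and i = ident_arr[OF E_triangle_arr(5)[OF t]]
  obtain c where c: "\<guillemotleft>c : Z \<rightarrow> A\<guillemotright>" "ext_morphism \<C> c y B Z \<zero>\<^bsub>Ext \<C> B Z\<^esub> D A \<delta>"
    using ET3_op[OF E_triangle_ident_zero(2)[OF a(5) Z] t i a(2) refl] by blast
  then show ?thesis using Ext_morphismD[OF c(2)] push_zero[OF a(5) c(1)] by simp
qed

lemma E_triangle_comp_zero:
  assumes t: "E_triangle \<C> A x B y D \<delta>"
  shows "y \<cdot> x = \<zero>\<^bsub>Mor \<C> A D\<^esub>"
proof -
  obtain Z where Z: "zero_object \<C> Z" using ex_zero_object by blast
  note a = E_triangle_arr[OF t] and i = ident_arr[OF E_triangle_arr(4)[OF t]]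
  note z = zero_arr[OF a(4) zero_object_Ob[OF Z]]
  obtain c where c: "\<guillemotleft>c : Z \<rightarrow> D\<guillemotright>" "c \<cdot> \<zero>\<^bsub>Mor \<C> A Z\<^esub> = y \<cdot> x"
    using ET3[OF E_triangle_ident_zero(1)[OF a(4) Z] t i a(1) refl] by blast
  then show ?thesis using comp_zero_right[OF c(1) a(4)] by simp
qed

text \<open>Exactness of \<open>Hom(B, W) \<rightarrow> Hom(A, W) \<rightarrow> E(D, W)\<close>.\<close>

lemma factors_through_inflation:
  assumes t: "E_triangle \<C> A x B y D \<delta>" and g: "\<guillemotleft>g : A \<rightarrow> W\<guillemotright>"
    and "push \<C> D g \<delta> = \<zero>\<^bsub>Ext \<C> D W\<^esub>"
  shows "\<exists>h. \<guillemotleft>h : B \<rightarrow> W\<guillemotright> \<and> h \<cdot> x = g"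
proof -
  obtain Z where Z: "zero_object \<C> Z" using ex_zero_object by blast
  note a = E_triangle_arr[OF t] and W = arr_Ob(2)[OF g] and z = zero_object_Ob[OF Z]
  note m = Ext_morphismI[OF a(3) Ext_zero[OF z W] g zero_arr[OF a(6) z]]
  obtain b where "\<guillemotleft>b : B \<rightarrow> W\<guillemotright>" "b \<cdot> x = ident \<C> W \<cdot> g"
    using realization_morphism[OF t E_triangle_ident_zero(1)[OF W Z] m]
      assms(3) pull_zero[OF W zero_arr[OF a(6) z]] by auto
  then show ?thesis using comp_ident_left[OF g] by metis
qed

text \<open>Exactness of \<open>Hom(W, B) \<rightarrow> Hom(W, D) \<rightarrow> E(W, A)\<close>.\<close>

lemma lifts_along_deflation:
  assumes t: "E_triangle \<C> A x B y D \<delta>" and f: "\<guillemotleft>f : W \<rightarrow> D\<guillemotright>"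
    and "pull \<C> A f \<delta> = \<zero>\<^bsub>Ext \<C> W A\<^esub>"
  shows "\<exists>h. \<guillemotleft>h : W \<rightarrow> B\<guillemotright> \<and> y \<cdot> h = f"
proof -
  obtain Z where Z: "zero_object \<C> Z" using ex_zero_object by blast
  note a = E_triangle_arr[OF t] and W = arr_Ob(1)[OF f] and z = zero_object_Ob[OF Z]
  note m = Ext_morphismI[OF Ext_zero[OF W z] a(3) zero_arr[OF z a(4)] f]
  obtain b where "\<guillemotleft>b : W \<rightarrow> B\<guillemotright>" "y \<cdot> b = f \<cdot> ident \<C> W"
    using realization_morphism[OF E_triangle_ident_zero(2)[OF W Z] t m]
      assms(3) push_zero[OF W zero_arr[OF z a(4)]] by auto
  then show ?thesis using comp_ident_right[OF f] by metis
qed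

text \<open>Exactness of \<open>Hom(W, A) \<rightarrow> Hom(W, B) \<rightarrow> Hom(W, D)\<close>.\<close>

lemma factors_through_kernel:
  assumes t: "E_triangle \<C> A x B y D \<delta>" and w: "\<guillemotleft>w : W \<rightarrow> B\<guillemotright>" and "y \<cdot> w = \<zero>\<^bsub>Mor \<C> W D\<^esub>"
  shows "\<exists>h. \<guillemotleft>h : W \<rightarrow> A\<guillemotright> \<and> x \<cdot> h = w"
proof -
  obtain Z where Z: "zero_object \<C> Z" using ex_zero_object by blast
  note a = E_triangle_arr[OF t] and W = arr_Ob(1)[OF w] and z = zero_object_Ob[OF Z]
  have "\<zero>\<^bsub>Mor \<C> Z D\<^esub> \<cdot> \<zero>\<^bsub>Mor \<C> W Z\<^esub> = y \<cdot> w"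
    using assms(3) comp_zero_left[OF zero_arr[OF W z] a(6)] by simp
  then obtain h where "\<guillemotleft>h : W \<rightarrow> A\<guillemotright>" "w \<cdot> ident \<C> W = x \<cdot> h"
    using ET3_op[OF E_triangle_ident_zero(1)[OF W Z] t w zero_arr[OF z a(6)]] by blast
  then show ?thesis using comp_ident_right[OF w] by metis
qed

text \<open>Exactness of \<open>Hom(A, W) \<rightarrow> E(D, W) \<rightarrow> E(B, W)\<close>.\<close>

lemma Ext_from_connecting_left:
  assumes t: "E_triangle \<C> A x B y D \<delta>" and W: "W \<in> Ob \<C>" and e: "\<epsilon> \<in> carrier (Ext \<C> D W)"
    and "pull \<C> W y \<epsilon> = \<zero>\<^bsub>Ext \<C> B W\<^esub>"
  shows "\<exists>f. \<guillemotleft>f : A \<rightarrow> W\<guillemotright> \<and> push \<C> D f \<delta> = \<epsilon>"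
proof -
  note a = E_triangle_arr[OF t]
  obtain u V v where s: "E_triangle \<C> W u V v D \<epsilon>" using ex_E_triangle[OF a(6) W e] .
  obtain b where b: "\<guillemotleft>b : B \<rightarrow> V\<guillemotright>" "v \<cdot> b = y" using lifts_along_deflation[OF s a(2) assms(4)] by blast
  have "ident \<C> D \<cdot> y = v \<cdot> b" using b comp_ident_left[OF a(2)] by simp
  then obtain f where f: "\<guillemotleft>f : A \<rightarrow> W\<guillemotright>" "ext_morphism \<C> f (ident \<C> D) D A \<delta> D W \<epsilon>"
    using ET3_op[OF t s b(1) ident_arr[OF a(6)]] by blast
  then show ?thesis using Ext_morphismD[OF f(2)] pull_ident[OF a(6) W e] by auto
qed

text \<open>Exactness of \<open>Hom(W, D) \<rightarrow> E(W, A) \<rightarrow> E(W, B)\<close>.\<close>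

lemma Ext_from_connecting_right:
  assumes t: "E_triangle \<C> A x B y D \<delta>" and W: "W \<in> Ob \<C>" and e: "\<epsilon> \<in> carrier (Ext \<C> W A)"
    and "push \<C> W x \<epsilon> = \<zero>\<^bsub>Ext \<C> W B\<^esub>"
  shows "\<exists>f. \<guillemotleft>f : W \<rightarrow> D\<guillemotright> \<and> pull \<C> A f \<delta> = \<epsilon>"
proof -
  note a = E_triangle_arr[OF t]
  obtain u V v where s: "E_triangle \<C> A u V v W \<epsilon>" using ex_E_triangle[OF W a(4) e] .
  obtain b where b: "\<guillemotleft>b : V \<rightarrow> B\<guillemotright>" "b \<cdot> u = x" using factors_through_inflation[OF s a(1) assms(4)] by blast
  have "b \<cdot> u = x \<cdot> ident \<C> A" using b comp_ident_right[OF a(1)] by simp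
  then obtain f where f: "\<guillemotleft>f : W \<rightarrow> D\<guillemotright>" "ext_morphism \<C> (ident \<C> A) f W A \<epsilon> D A \<delta>"
    using ET3[OF s t ident_arr[OF a(4)] b(1)] by blast
  then show ?thesis using Ext_morphismD[OF f(2)] push_ident[OF W a(4) e] by auto
qed

text \<open>If \<open>x\<close> is an inflation, so is \<open>(f, x) : A \<rightarrow> B \<oplus> I\<close>: it is the composite of the split inflation
  \<open>(f, 1) : A \<rightarrow> B \<oplus> A\<close> and of \<open>1 \<oplus> x : B \<oplus> A \<rightarrow> B \<oplus> I\<close>, and ET4 composes inflations.\<close>

lemma inflation_pair:
  assumes t: "E_triangle \<C> A x I y D \<delta>" and f: "\<guillemotleft>f : A \<rightarrow> B\<guillemotright>"
    and S: "is_biproduct \<C> B I S i\<^sub>1 i\<^sub>2 p\<^sub>1 p\<^sub>2"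
  shows "\<exists>E h \<epsilon>. E_triangle \<C> A (i\<^sub>1 \<cdot> f \<oplus>\<^bsub>Mor \<C> A S\<^esub> i\<^sub>2 \<cdot> x) S h E \<epsilon>"
proof -
  note a = E_triangle_arr[OF t] and s = biproduct_arr[OF S]
  obtain Z where Z: "zero_object \<C> Z" using ex_zero_object by blast
  obtain T j\<^sub>1 j\<^sub>2 q\<^sub>1 q\<^sub>2 where T: "is_biproduct \<C> B A T j\<^sub>1 j\<^sub>2 q\<^sub>1 q\<^sub>2" using ex_biproduct[OF s(5) a(4)] by blast
  obtain U k\<^sub>1 k\<^sub>2 r\<^sub>1 r\<^sub>2 where U: "is_biproduct \<C> Z D U k\<^sub>1 k\<^sub>2 r\<^sub>1 r\<^sub>2"
    using ex_biproduct[OF zero_object_Ob[OF Z] a(6)] by blast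
  note tt = biproduct_arr[OF T]
  note t1 = realization_zero[OF biproduct_shear[OF biproduct_swap[OF T] f refl]]
  note t2 = realization_sum[OF E_triangle_ident_zero(1)[OF s(5) Z] t T S U]
  have "j\<^sub>2 \<cdot> ident \<C> A \<oplus>\<^bsub>Mor \<C> A T\<^esub> j\<^sub>1 \<cdot> f = j\<^sub>1 \<cdot> f \<oplus>\<^bsub>Mor \<C> A T\<^esub> j\<^sub>2 \<cdot> ident \<C> A"
    by (rule add_arr_comm[OF comp_arr[OF ident_arr[OF a(4)] tt(2)] comp_arr[OF f tt(1)]])
  moreover have "(i\<^sub>1 \<cdot> ident \<C> B \<cdot> q\<^sub>1 \<oplus>\<^bsub>Mor \<C> T S\<^esub> i\<^sub>2 \<cdot> x \<cdot> q\<^sub>2) \<cdot> (j\<^sub>1 \<cdot> f \<oplus>\<^bsub>Mor \<C> A T\<^esub> j\<^sub>2 \<cdot> ident \<C> A)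
      = i\<^sub>1 \<cdot> f \<oplus>\<^bsub>Mor \<C> A S\<^esub> i\<^sub>2 \<cdot> x"
    using biproduct_pair_comp[OF T s(1) comp_arr[OF a(1) s(2)] f ident_arr[OF a(4)]]
      comp_ident_right[OF s(1)] comp_ident_right[OF comp_arr[OF a(1) s(2)]] by simp
  ultimately show ?thesis using ET4[OF t1 t2] by (elim exE conjE) metis
qed

text \<open>Dually, \<open>(g, y) : B \<oplus> P \<rightarrow> D\<close> is the composite of \<open>1 \<oplus> y : B \<oplus> P \<rightarrow> B \<oplus> D\<close> and of the split
  deflation \<open>(g, 1) : B \<oplus> D \<rightarrow> D\<close>.\<close>

lemma deflation_pair:
  assumes t: "E_triangle \<C> A x P y D \<delta>" and g: "\<guillemotleft>g : B \<rightarrow> D\<guillemotright>"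
    and S: "is_biproduct \<C> B P S i\<^sub>1 i\<^sub>2 p\<^sub>1 p\<^sub>2"
  shows "\<exists>E h \<epsilon>. E_triangle \<C> E h S (g \<cdot> p\<^sub>1 \<oplus>\<^bsub>Mor \<C> S D\<^esub> y \<cdot> p\<^sub>2) D \<epsilon>"
proof -
  note a = E_triangle_arr[OF t] and s = biproduct_arr[OF S]
  obtain Z where Z: "zero_object \<C> Z" using ex_zero_object by blast
  obtain T j\<^sub>1 j\<^sub>2 q\<^sub>1 q\<^sub>2 where T: "is_biproduct \<C> B D T j\<^sub>1 j\<^sub>2 q\<^sub>1 q\<^sub>2" using ex_biproduct[OF s(5) a(6)] by blast
  obtain U k\<^sub>1 k\<^sub>2 r\<^sub>1 r\<^sub>2 where U: "is_biproduct \<C> Z A U k\<^sub>1 k\<^sub>2 r\<^sub>1 r\<^sub>2"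
    using ex_biproduct[OF zero_object_Ob[OF Z] a(4)] by blast
  note tt = biproduct_arr[OF T]
  have gg: "g = \<ominus>\<^bsub>Mor \<C> B D\<^esub> (\<ominus>\<^bsub>Mor \<C> B D\<^esub> g)"
    using neg_arr_unique[OF neg_arr[OF g] g add_neg_arr(2)[OF g]] by simp
  note t1 = realization_zero[OF biproduct_shear[OF T neg_arr[OF g] gg]]
  note t2 = realization_sum[OF E_triangle_ident_zero(2)[OF s(5) Z] t U S T]
  have j: "j\<^sub>1 \<cdot> ident \<C> B \<cdot> p\<^sub>1 \<oplus>\<^bsub>Mor \<C> S T\<^esub> j\<^sub>2 \<cdot> y \<cdot> p\<^sub>2 = j\<^sub>1 \<cdot> p\<^sub>1 \<oplus>\<^bsub>Mor \<C> S T\<^esub> j\<^sub>2 \<cdot> (y \<cdot> p\<^sub>2)"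
    using comp_ident_right[OF tt(1)] comp_assoc[OF s(4) a(2) tt(2)] by simp
  have "(g \<cdot> q\<^sub>1 \<oplus>\<^bsub>Mor \<C> T D\<^esub> ident \<C> D \<cdot> q\<^sub>2) \<cdot> (j\<^sub>1 \<cdot> ident \<C> B \<cdot> p\<^sub>1 \<oplus>\<^bsub>Mor \<C> S T\<^esub> j\<^sub>2 \<cdot> y \<cdot> p\<^sub>2)
      = g \<cdot> p\<^sub>1 \<oplus>\<^bsub>Mor \<C> S D\<^esub> y \<cdot> p\<^sub>2"
    unfolding j using biproduct_pair_comp[OF T g ident_arr[OF a(6)] s(3) comp_arr[OF s(4) a(2)]]
      comp_ident_left[OF comp_arr[OF s(4) a(2)]] by simp
  then show ?thesis using ET4_op[OF t2 t1] by (elim exE conjE) metis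
qed

lemma E_triangle_split:
  assumes t: "E_triangle \<C> A x B y D \<delta>" and r: "\<guillemotleft>r : B \<rightarrow> A\<guillemotright>" "r \<cdot> x = ident \<C> A"
  shows "\<delta> = \<zero>\<^bsub>Ext \<C> D A\<^esub>"
proof -
  note a = E_triangle_arr[OF t]
  show ?thesis
    using push_comp[OF a(6,1) r(1) a(3)] push_ident[OF a(6,4,3)] E_triangle_push_zero[OF t]
      push_zero[OF a(6) r(1)] r(2) by simp
qed

lemma E_triangle_zero_biproduct:
  assumes t: "E_triangle \<C> A x B y D \<zero>\<^bsub>Ext \<C> D A\<^esub>"
  shows "\<exists>S i\<^sub>1 i\<^sub>2 p\<^sub>1 p\<^sub>2. is_biproduct \<C> A D S i\<^sub>1 i\<^sub>2 p\<^sub>1 p\<^sub>2 \<and> isomorphic \<C> S B"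
  using ex_biproduct[OF E_triangle_arr(4,6)[OF t]] E_triangle_middle_isomorphic[OF realization_zero t]
  by blast

lemma subcategory_E_triangle_split:
  assumes \<X>: "subcategory \<C> \<X>" and t: "E_triangle \<C> A x B y D \<zero>\<^bsub>Ext \<C> D A\<^esub>" and B: "B \<in> \<X>"
  shows "A \<in> \<X>" and "D \<in> \<X>"
proof -
  obtain S i\<^sub>1 i\<^sub>2 p\<^sub>1 p\<^sub>2 where S: "is_biproduct \<C> A D S i\<^sub>1 i\<^sub>2 p\<^sub>1 p\<^sub>2" "isomorphic \<C> S B"
    using E_triangle_zero_biproduct[OF t] by blast
  have "S \<in> \<X>" using subcategory_isomorphic[OF \<X> B isomorphic_sym[OF S(2)]] .
  then show "A \<in> \<X>" "D \<in> \<X>" using subcategory_summand[OF \<X> S(1)] by auto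
qed

abbreviation Ext_trivial :: "'o \<Rightarrow> 'o \<Rightarrow> bool" where
  "Ext_trivial D A \<equiv> carrier (Ext \<C> D A) = {\<zero>\<^bsub>Ext \<C> D A\<^esub>}"

lemma Ext_trivialI:
  assumes "D \<in> Ob \<C>" "A \<in> Ob \<C>" "\<And>\<delta>. \<delta> \<in> carrier (Ext \<C> D A) \<Longrightarrow> \<delta> = \<zero>\<^bsub>Ext \<C> D A\<^esub>"
  shows "Ext_trivial D A"
  using assms Ext_zero by blast

lemma pull_morphism_sums:
  assumes "f \<in> morphism_sums \<C> D D' (through \<C> \<G> D D')" and "D \<in> Ob \<C>" "D' \<in> Ob \<C>" "A \<in> Ob \<C>"
    and "\<And>Y. Y \<in> \<G> \<Longrightarrow> Ext_trivial Y A" and d: "\<delta> \<in> carrier (Ext \<C> D' A)"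
  shows "pull \<C> A f \<delta> = \<zero>\<^bsub>Ext \<C> D A\<^esub>"
  using assms(1)
proof induction
  case zero
  then show ?case using pull_zero_arr assms by simp
next
  case (add f g)
  obtain Y u v where Y: "Y \<in> \<G>" "\<guillemotleft>u : D \<rightarrow> Y\<guillemotright>" "\<guillemotleft>v : Y \<rightarrow> D'\<guillemotright>" "f = v \<cdot> u"
    using add(1) unfolding through_def by blast
  have "pull \<C> A v \<delta> = \<zero>\<^bsub>Ext \<C> Y A\<^esub>" using pull_closed[OF assms(4) Y(3) d] assms(5)[OF Y(1)] by simp
  then have 1: "pull \<C> A f \<delta> = \<zero>\<^bsub>Ext \<C> D A\<^esub>"
    using pull_comp[OF assms(4) Y(3,2) d] pull_zero[OF assms(4) Y(2)] Y(4) by simp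
  have 2: "\<guillemotleft>f : D \<rightarrow> D'\<guillemotright>" "\<guillemotleft>g : D \<rightarrow> D'\<guillemotright>"
    using through_arr[OF add(1)] morphism_sums_arr[OF add(2) assms(2,3) through_arr] by auto
  show ?case
    using pull_add_arr[OF assms(4) 2 d] 1 add(3) Ext_add_zero[OF assms(2,4) Ext_zero[OF assms(2,4)]] by simp
qed

lemma Ext_trivial_retract_left:
  assumes "retract_of \<C> D' D" "A \<in> Ob \<C>" "Ext_trivial D A"
  shows "Ext_trivial D' A"
proof -
  obtain i p where ip: "\<guillemotleft>i : D' \<rightarrow> D\<guillemotright>" "\<guillemotleft>p : D \<rightarrow> D'\<guillemotright>" "p \<cdot> i = ident \<C> D'"
    using assms(1) unfolding retract_of_def by blast
  note D' = arr_Ob(1)[OF ip(1)]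
  show ?thesis
  proof (rule Ext_trivialI[OF D' assms(2)])
    fix \<delta> assume d: "\<delta> \<in> carrier (Ext \<C> D' A)"
    have "pull \<C> A p \<delta> = \<zero>\<^bsub>Ext \<C> D A\<^esub>" using pull_closed[OF assms(2) ip(2) d] assms(3) by simp
    then show "\<delta> = \<zero>\<^bsub>Ext \<C> D' A\<^esub>"
      using pull_comp[OF assms(2) ip(2,1) d] pull_zero[OF assms(2) ip(1)] pull_ident[OF D' assms(2) d] ip(3)
      by simp
  qed
qed

lemma projective_if_Ext_trivial:
  assumes "P \<in> Ob \<C>" and "\<And>A. A \<in> Ob \<C> \<Longrightarrow> Ext_trivial P A"
  shows "projective \<C> P"
  unfolding projective_def
proof (intro conjI allI impI)
  fix A x B y D \<delta> f
  assume "E_triangle \<C> A x B y D \<delta> \<and> \<guillemotleft>f : P \<rightarrow> D\<guillemotright>"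
  then have t: "E_triangle \<C> A x B y D \<delta>" and f: "\<guillemotleft>f : P \<rightarrow> D\<guillemotright>" by auto
  note a = E_triangle_arr[OF t]
  have "pull \<C> A f \<delta> = \<zero>\<^bsub>Ext \<C> P A\<^esub>" using pull_closed[OF a(4) f a(3)] assms(2)[OF a(4)] by simp
  then show "\<exists>g. \<guillemotleft>g : P \<rightarrow> B\<guillemotright> \<and> y \<cdot> g = f" by (rule lifts_along_deflation[OF t f])
qed (rule assms(1))

lemma Ext_trivial_injective:
  assumes I: "injective \<C> I" and D: "D \<in> Ob \<C>"
  shows "Ext_trivial D I"
proof -
  have Iob: "I \<in> Ob \<C>" using I unfolding injective_def by blast
  show ?thesis
  proof (rule Ext_trivialI[OF D Iob])
    fix \<delta> assume d: "\<delta> \<in> carrier (Ext \<C> D I)"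
    obtain x B y where t: "E_triangle \<C> I x B y D \<delta>" using ex_E_triangle[OF D Iob d] .
    obtain r where "\<guillemotleft>r : B \<rightarrow> I\<guillemotright>" "r \<cdot> x = ident \<C> I"
      using I t ident_arr[OF Iob] unfolding injective_def by blast
    then show "\<delta> = \<zero>\<^bsub>Ext \<C> D I\<^esub>" using E_triangle_split[OF t] by blast
  qed
qed

lemma subcategory_left_perp:
  assumes "\<And>A. A \<in> \<S> \<Longrightarrow> A \<in> Ob \<C>"
  shows "subcategory \<C> {M \<in> Ob \<C>. \<forall>A\<in>\<S>. Ext_trivial M A}"
proof -
  let ?P = "{M \<in> Ob \<C>. \<forall>A\<in>\<S>. Ext_trivial M A}"
  have r: "M \<in> ?P" if N: "N \<in> ?P" and r: "retract_of \<C> M N" for M N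
  proof -
    have "M \<in> Ob \<C>" using r unfolding retract_of_def arr_def by blast
    then show ?thesis using Ext_trivial_retract_left[OF r] N assms by blast
  qed
  have s: "S \<in> ?P" if B: "\<forall>j<n. B j \<in> ?P" and S: "is_direct_sum \<C> n B S" for n B S
  proof -
    have Sob: "S \<in> Ob \<C>" using S unfolding is_direct_sum_def by blast
    have i: "ident \<C> S \<in> morphism_sums \<C> S S (through \<C> ?P S S)"
    proof (rule ident_direct_sum[OF S])
      fix j assume "j < n"
      then have "B j \<in> ?P" using B by blast
      moreover from this have "isomorphic \<C> (B j) (B j)"
        unfolding isomorphic_def using is_iso_ident by blast
      ultimately show "\<exists>Y\<in>?P. isomorphic \<C> (B j) Y" by blast
    qed
    have "Ext_trivial S A" if A: "A \<in> \<S>" for A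
    proof (rule Ext_trivialI[OF Sob assms[OF A]])
      fix \<delta> assume d: "\<delta> \<in> carrier (Ext \<C> S A)"
      have "pull \<C> A (ident \<C> S) \<delta> = \<zero>\<^bsub>Ext \<C> S A\<^esub>"
        by (rule pull_morphism_sums[OF i Sob Sob assms[OF A] _ d]) (use A in blast)
      then show "\<delta> = \<zero>\<^bsub>Ext \<C> S A\<^esub>" using pull_ident[OF Sob assms[OF A] d] by simp
    qed
    then show ?thesis using Sob by blast
  qed
  show ?thesis
    unfolding subcategory_def
  proof (intro conjI allI impI)
    show "?P \<subseteq> Ob \<C>" by blast
    show "B \<in> ?P" if "A \<in> ?P \<and> isomorphic \<C> A B" for A B
      using that r isomorphic_retract isomorphic_sym by blast
    show "S \<in> ?P" if "(\<forall>j<n. A j \<in> ?P) \<and> is_direct_sum \<C> n A S" for n A S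
      by (rule s[OF conjunct1[OF that] conjunct2[OF that]])
    show "A \<in> ?P" if "S \<in> ?P \<and> is_biproduct \<C> A B S i\<^sub>1 i\<^sub>2 p\<^sub>1 p\<^sub>2" for A B S i\<^sub>1 i\<^sub>2 p\<^sub>1 p\<^sub>2
      by (rule r[OF conjunct1[OF that] biproduct_retract[OF conjunct2[OF that]]])
  qed
qed

end

section \<open>Consequences of the duality and of finite dimension\<close>

context two_calabi_yau_extriangulated_category
begin

text \<open>Only the existence of a bijection with the dual space is needed, not its naturality.\<close>

lemma Ext_trivial_sym:
  assumes ob: "A \<in> Ob \<C>" "B \<in> Ob \<C>" and t: "Ext_trivial A B"
  shows "Ext_trivial B A"
proof -
  obtain \<Phi> where "two_calabi_yau_duality K \<C> \<Phi>" using two_calabi_yau by blast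
  then have bij: "bij_betw (\<Phi> B A) (carrier (Ext \<C> B A)) (carrier (dual_space K (Ext \<C> A B)))"
    using ob unfolding two_calabi_yau_duality_def by blast
  interpret V: vectorspace K "Ext \<C> A B" using Ext_vectorspace ob by blast
  have z: "\<phi> \<zero>\<^bsub>Ext \<C> A B\<^esub> = \<zero>\<^bsub>K\<^esub>" if "\<phi> \<in> carrier (dual_space K (Ext \<C> A B))" for \<phi>
  proof -
    have h: "\<phi> \<in> module_hom K (Ext \<C> A B) (self_module K)" using that by (simp add: dual_space_def)
    have c: "\<phi> \<zero>\<^bsub>Ext \<C> A B\<^esub> \<in> carrier K"
      using h V.zero_closed unfolding module_hom_def by (auto simp: self_module_def)
    have "\<phi> (\<zero>\<^bsub>K\<^esub> \<odot>\<^bsub>Ext \<C> A B\<^esub> \<zero>\<^bsub>Ext \<C> A B\<^esub>) = \<zero>\<^bsub>K\<^esub> \<otimes>\<^bsub>K\<^esub> \<phi> \<zero>\<^bsub>Ext \<C> A B\<^esub>"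
      using h V.zero_closed unfolding module_hom_def self_module_def mem_Collect_eq module.simps by blast
    then show ?thesis using c by simp
  qed
  have eq: "\<phi> = \<psi>" if \<phi>: "\<phi> \<in> carrier (dual_space K (Ext \<C> A B))" and \<psi>: "\<psi> \<in> carrier (dual_space K (Ext \<C> A B))" for \<phi> \<psi>
  proof (rule extensionalityI[of _ "carrier (Ext \<C> A B)"])
    show "\<phi> \<in> extensional (carrier (Ext \<C> A B))" "\<psi> \<in> extensional (carrier (Ext \<C> A B))"
      using \<phi> \<psi> by (simp_all add: dual_space_def)
    show "\<phi> x = \<psi> x" if "x \<in> carrier (Ext \<C> A B)" for x
      using that t z[OF \<phi>] z[OF \<psi>] by simp
  qed
  show ?thesis
  proof (rule Ext_trivialI[OF ob(2,1)])
    fix \<delta> assume d: "\<delta> \<in> carrier (Ext \<C> B A)"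
    show "\<delta> = \<zero>\<^bsub>Ext \<C> B A\<^esub>"
      by (rule bij_betw_imp_inj_on[OF bij, THEN inj_onD, OF eq d Ext_zero[OF ob(2,1)]])
        (use bij d Ext_zero[OF ob(2,1)] in \<open>auto dest: bij_betwE\<close>)
  qed
qed

lemma injective_in_Proj: "injective \<C> I \<Longrightarrow> I \<in> Proj \<C>"
proof -
  assume I: "injective \<C> I"
  then have "I \<in> Ob \<C>" unfolding injective_def by blast
  then show ?thesis
    using projective_if_Ext_trivial Ext_trivial_sym Ext_trivial_injective[OF I] unfolding Proj_def by blast
qed

lemma cluster_tilting_iff:
  "cluster_tilting \<C> \<S> \<longleftrightarrow> subcategory \<C> \<S> \<and> functorially_finite \<C> \<S> \<and>
    (\<forall>M\<in>Ob \<C>. M \<in> \<S> \<longleftrightarrow> (\<forall>A\<in>\<S>. Ext_trivial M A))"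
proof -
  have "(\<forall>A\<in>\<S>. Ext_trivial A M) \<longleftrightarrow> (\<forall>A\<in>\<S>. Ext_trivial M A)"
    if "subcategory \<C> \<S>" "M \<in> Ob \<C>" for M
    using Ext_trivial_sym that subcategory_Ob by blast
  then show ?thesis unfolding cluster_tilting_def Ext_vanishes_def by auto
qed

lemma submodule_Mor:
  assumes ob: "A \<in> Ob \<C>" "B \<in> Ob \<C>" and "P \<zero>\<^bsub>Mor \<C> A B\<^esub>"
    and "\<And>f g. \<guillemotleft>f : A \<rightarrow> B\<guillemotright> \<Longrightarrow> \<guillemotleft>g : A \<rightarrow> B\<guillemotright> \<Longrightarrow> P f \<Longrightarrow> P g \<Longrightarrow> P (f \<oplus>\<^bsub>Mor \<C> A B\<^esub> g)"
    and "\<And>r f. r \<in> carrier K \<Longrightarrow> \<guillemotleft>f : A \<rightarrow> B\<guillemotright> \<Longrightarrow> P f \<Longrightarrow> P (r \<odot>\<^bsub>Mor \<C> A B\<^esub> f)"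
  shows "submodule K {f \<in> carrier (Mor \<C> A B). P f} (Mor \<C> A B)"
proof -
  interpret V: vectorspace K "Mor \<C> A B" using Mor_vectorspace ob by blast
  show ?thesis by (rule submodule.intro) (use assms in \<open>auto simp: arr_def V.module_axioms\<close>)
qed

text \<open>The spanning property is stated through submodules, so that linear combinations do not occur.\<close>

lemma finite_generators_Mor:
  assumes ob: "A \<in> Ob \<C>" "B \<in> Ob \<C>"
  obtains F where "finite F" "F \<subseteq> carrier (Mor \<C> A B)"
    "\<And>N. submodule K N (Mor \<C> A B) \<Longrightarrow> F \<subseteq> N \<Longrightarrow> carrier (Mor \<C> A B) \<subseteq> N"
proof -
  interpret V: vectorspace K "Mor \<C> A B" using Mor_vectorspace ob by blast
  obtain F where F: "finite F" "F \<subseteq> carrier (Mor \<C> A B)" "V.span F = carrier (Mor \<C> A B)"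
    using Mor_fin_dim[OF ob] unfolding V.fin_dim_def by blast
  then show thesis using that[of F] V.span_is_subset by metis
qed

end

section \<open>Exchange triangles over a rigid subcategory\<close>

text \<open>A functorially finite rigid subcategory \<open>\<X>\<close> containing the projectives; the injectives then belong to
  \<open>\<X>\<close> as well.\<close>

locale rigid_containing_projectives = two_calabi_yau_extriangulated_category K \<C>
  for K :: "('k, 'r) ring_scheme" and \<C> :: "('o, 'm, 'k, 'e, 'z) preextri_scheme" (structure) +
  fixes \<X> :: "'o set"
  assumes enough_proj: "enough_projectives \<C>" and enough_inj: "enough_injectives \<C>"
    and rigid_X: "rigid \<C> \<X>" and ff_X: "functorially_finite \<C> \<X>" and Proj_X: "Proj \<C> \<subseteq> \<X>"
begin

lemma subcategory_X: "subcategory \<C> \<X>"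
  using rigid_X unfolding rigid_def by blast

lemma X_Ob: "X \<in> \<X> \<Longrightarrow> X \<in> Ob \<C>"
  using subcategory_Ob[OF subcategory_X] .

lemma Ext_X: "X \<in> \<X> \<Longrightarrow> X' \<in> \<X> \<Longrightarrow> Ext_trivial X X'"
  using rigid_X unfolding rigid_def Ext_vanishes_def by blast

text \<open>The objects \<open>M\<close> with \<open>E(M, \<X>) = 0\<close>; by duality also \<open>E(\<X>, M) = 0\<close> (\<open>perpD\<close>).\<close>

definition perp :: "'o set" where
  "perp = {M \<in> Ob \<C>. \<forall>X\<in>\<X>. Ext_trivial M X}"

lemma perpD:
  assumes "M \<in> perp"
  shows "M \<in> Ob \<C>" "\<And>X. X \<in> \<X> \<Longrightarrow> Ext_trivial M X" "\<And>X. X \<in> \<X> \<Longrightarrow> Ext_trivial X M"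
  using assms Ext_trivial_sym X_Ob unfolding perp_def by blast+

lemma X_perp: "X \<in> \<X> \<Longrightarrow> X \<in> perp"
  unfolding perp_def using X_Ob Ext_X by blast

lemma ex_injective_triangle:
  assumes "A \<in> Ob \<C>"
  obtains x I y D \<delta> where "E_triangle \<C> A x I y D \<delta>" "I \<in> \<X>"
  using assms enough_inj injective_in_Proj Proj_X unfolding enough_injectives_def by blast

lemma ex_projective_triangle:
  assumes "D \<in> Ob \<C>"
  obtains A x P y \<delta> where "E_triangle \<C> A x P y D \<delta>" "P \<in> \<X>"
  using assms enough_proj Proj_X unfolding enough_projectives_def Proj_def by blast

text \<open>A retract \<open>A\<close> of \<open>X\<close> need not have a complement in \<open>X\<close>, but it has one in \<open>X \<oplus> I\<close> for an inflation
  of \<open>A\<close> into an injective \<open>I\<close>.\<close>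

lemma X_retract:
  assumes r: "retract_of \<C> A X" and X: "X \<in> \<X>"
  shows "A \<in> \<X>"
proof -
  obtain i p where ip: "\<guillemotleft>i : A \<rightarrow> X\<guillemotright>" "\<guillemotleft>p : X \<rightarrow> A\<guillemotright>" "p \<cdot> i = ident \<C> A"
    using r unfolding retract_of_def by blast
  obtain x I y D \<delta> where t: "E_triangle \<C> A x I y D \<delta>" "I \<in> \<X>" using ex_injective_triangle[OF arr_Ob(1)[OF ip(1)]] .
  obtain S i\<^sub>1 i\<^sub>2 p\<^sub>1 p\<^sub>2 where S: "is_biproduct \<C> X I S i\<^sub>1 i\<^sub>2 p\<^sub>1 p\<^sub>2" using ex_biproduct X_Ob X t(2) by blast
  have SX: "S \<in> \<X>" using subcategory_biproduct[OF subcategory_X S X t(2)] .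
  note b = biproduct_arr[OF S]
  let ?j = "i\<^sub>1 \<cdot> i \<oplus>\<^bsub>Mor \<C> A S\<^esub> i\<^sub>2 \<cdot> x"
  obtain E h \<epsilon> where t': "E_triangle \<C> A ?j S h E \<epsilon>" using inflation_pair[OF t(1) ip(1) S] by blast
  have "(p \<cdot> p\<^sub>1) \<cdot> ?j = ident \<C> A"
    using comp_assoc[OF E_triangle_arr(1)[OF t'] b(3) ip(2)]
      biproduct_proj_pair(1)[OF S ip(1) E_triangle_arr(1)[OF t(1)]] ip(3) by simp
  \<comment> \<open>the retraction of \<open>(i, x)\<close> induced by \<open>p\<close> splits the triangle\<close>
  from E_triangle_split[OF t' comp_arr[OF b(3) ip(2)] this]
  show ?thesis using subcategory_E_triangle_split(1)[OF subcategory_X _ SX] t' by simp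
qed

text \<open>E-triangles with middle term in \<open>\<X>\<close> and outer terms in \<open>perp\<close>. The approximation properties of the
  two morphisms are then automatic.\<close>

definition exchange_triangle :: "'o \<Rightarrow> 'm \<Rightarrow> 'o \<Rightarrow> 'm \<Rightarrow> 'o \<Rightarrow> 'e \<Rightarrow> bool" where
  "exchange_triangle A \<alpha> X \<beta> B \<delta> \<longleftrightarrow> E_triangle \<C> A \<alpha> X \<beta> B \<delta> \<and> X \<in> \<X> \<and> A \<in> perp \<and> B \<in> perp"

lemma exchange_triangleD:
  assumes "exchange_triangle A \<alpha> X \<beta> B \<delta>"
  shows "E_triangle \<C> A \<alpha> X \<beta> B \<delta>" "X \<in> \<X>" "A \<in> perp" "B \<in> perp"
  using assms unfolding exchange_triangle_def by auto

lemma exchange_triangle_left: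
  assumes ex: "exchange_triangle A \<alpha> X \<beta> B \<delta>"
  shows "left_approximation \<C> \<X> \<alpha> A X"
  unfolding left_approximation_def
proof (intro conjI ballI allI impI)
  note e = exchange_triangleD[OF ex] note a = E_triangle_arr[OF e(1)]
  show "X \<in> \<X>" "\<guillemotleft>\<alpha> : A \<rightarrow> X\<guillemotright>" using e a by auto
  fix X' g assume "X' \<in> \<X>" and g: "\<guillemotleft>g : A \<rightarrow> X'\<guillemotright>"
  then have "push \<C> B g \<delta> = \<zero>\<^bsub>Ext \<C> B X'\<^esub>" using push_closed[OF a(6) g a(3)] perpD(2)[OF e(4)] by blast
  then show "\<exists>h. \<guillemotleft>h : X \<rightarrow> X'\<guillemotright> \<and> h \<cdot> \<alpha> = g" using factors_through_inflation[OF e(1) g] by blast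
qed

lemma exchange_triangle_right:
  assumes ex: "exchange_triangle A \<alpha> X \<beta> B \<delta>"
  shows "right_approximation \<C> \<X> \<beta> X B"
  unfolding right_approximation_def
proof (intro conjI ballI allI impI)
  note e = exchange_triangleD[OF ex] note a = E_triangle_arr[OF e(1)]
  show "X \<in> \<X>" "\<guillemotleft>\<beta> : X \<rightarrow> B\<guillemotright>" using e a by auto
  fix X' g assume "X' \<in> \<X>" and g: "\<guillemotleft>g : X' \<rightarrow> B\<guillemotright>"
  then have "pull \<C> A g \<delta> = \<zero>\<^bsub>Ext \<C> X' A\<^esub>" using pull_closed[OF a(4) g a(3)] perpD(3)[OF e(3)] by blast
  then show "\<exists>h. \<guillemotleft>h : X' \<rightarrow> X\<guillemotright> \<and> \<beta> \<cdot> h = g" using lifts_along_deflation[OF e(1) g] by blast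
qed

lemma ex_exchange_triangle_from:
  assumes A: "A \<in> perp"
  obtains \<alpha> X \<beta> B \<delta> where "exchange_triangle A \<alpha> X \<beta> B \<delta>"
proof -
  note Aob = perpD(1)[OF A]
  obtain f X0 where f: "left_approximation \<C> \<X> f A X0" using ff_X Aob unfolding functorially_finite_def by blast
  note f = left_approximationD[OF f]
  obtain x I y D \<epsilon> where t: "E_triangle \<C> A x I y D \<epsilon>" "I \<in> \<X>" using ex_injective_triangle[OF Aob] .
  obtain S i\<^sub>1 i\<^sub>2 p\<^sub>1 p\<^sub>2 where S: "is_biproduct \<C> X0 I S i\<^sub>1 i\<^sub>2 p\<^sub>1 p\<^sub>2" using ex_biproduct X_Ob f(1) t(2) by blast
  have SX: "S \<in> \<X>" using subcategory_biproduct[OF subcategory_X S f(1) t(2)] .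
  note b = biproduct_arr[OF S]
  let ?j = "i\<^sub>1 \<cdot> f \<oplus>\<^bsub>Mor \<C> A S\<^esub> i\<^sub>2 \<cdot> x"
  obtain E h \<delta> where t': "E_triangle \<C> A ?j S h E \<delta>" using inflation_pair[OF t(1) f(2) S] by blast
  note a = E_triangle_arr[OF t']
  have "Ext_trivial E X'" if X': "X' \<in> \<X>" for X'
  proof (rule Ext_trivialI[OF a(6) X_Ob[OF X']])
    fix \<epsilon> assume e: "\<epsilon> \<in> carrier (Ext \<C> E X')"
    have "pull \<C> X' h \<epsilon> = \<zero>\<^bsub>Ext \<C> S X'\<^esub>" using pull_closed[OF X_Ob[OF X'] a(2) e] Ext_X[OF SX X'] by blast
    then obtain g where g: "\<guillemotleft>g : A \<rightarrow> X'\<guillemotright>" "push \<C> E g \<delta> = \<epsilon>"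
      using Ext_from_connecting_left[OF t' X_Ob[OF X'] e] by blast
    obtain k where k: "\<guillemotleft>k : X0 \<rightarrow> X'\<guillemotright>" "k \<cdot> f = g" using f(3)[OF X' g(1)] by blast
    \<comment> \<open>\<open>g\<close> factors through the inflation, hence annihilates \<open>\<delta>\<close>\<close>
    have "(k \<cdot> p\<^sub>1) \<cdot> ?j = g"
      using comp_assoc[OF a(1) b(3) k(1)] biproduct_proj_pair(1)[OF S f(2) E_triangle_arr(1)[OF t(1)]] k(2)
      by simp
    then show "\<epsilon> = \<zero>\<^bsub>Ext \<C> E X'\<^esub>"
      using push_comp[OF a(6,1) comp_arr[OF b(3) k(1)] a(3)] E_triangle_push_zero[OF t']
        push_zero[OF a(6) comp_arr[OF b(3) k(1)]] g(2) by simp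
  qed
  then have "E \<in> perp" unfolding perp_def using a(6) by blast
  then have "exchange_triangle A ?j S h E \<delta>" unfolding exchange_triangle_def using t' SX A by blast
  then show thesis by (rule that)
qed

lemma ex_exchange_triangle_to:
  assumes B: "B \<in> perp"
  obtains A \<alpha> X \<beta> \<delta> where "exchange_triangle A \<alpha> X \<beta> B \<delta>"
proof -
  note Bob = perpD(1)[OF B]
  obtain f X0 where f: "right_approximation \<C> \<X> f X0 B" using ff_X Bob unfolding functorially_finite_def by blast
  note f = right_approximationD[OF f]
  obtain D x P y \<epsilon> where t: "E_triangle \<C> D x P y B \<epsilon>" "P \<in> \<X>" using ex_projective_triangle[OF Bob] .
  obtain S i\<^sub>1 i\<^sub>2 p\<^sub>1 p\<^sub>2 where S: "is_biproduct \<C> X0 P S i\<^sub>1 i\<^sub>2 p\<^sub>1 p\<^sub>2" using ex_biproduct X_Ob f(1) t(2) by blast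
  have SX: "S \<in> \<X>" using subcategory_biproduct[OF subcategory_X S f(1) t(2)] .
  note b = biproduct_arr[OF S]
  let ?q = "f \<cdot> p\<^sub>1 \<oplus>\<^bsub>Mor \<C> S B\<^esub> y \<cdot> p\<^sub>2"
  obtain E h \<delta> where t': "E_triangle \<C> E h S ?q B \<delta>" using deflation_pair[OF t(1) f(2) S] by blast
  note a = E_triangle_arr[OF t']
  have "Ext_trivial X' E" if X': "X' \<in> \<X>" for X'
  proof (rule Ext_trivialI[OF X_Ob[OF X'] a(4)])
    fix \<epsilon> assume e: "\<epsilon> \<in> carrier (Ext \<C> X' E)"
    have "push \<C> X' h \<epsilon> = \<zero>\<^bsub>Ext \<C> X' S\<^esub>" using push_closed[OF X_Ob[OF X'] a(1) e] Ext_X[OF X' SX] by blast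
    then obtain g where g: "\<guillemotleft>g : X' \<rightarrow> B\<guillemotright>" "pull \<C> E g \<delta> = \<epsilon>"
      using Ext_from_connecting_right[OF t' X_Ob[OF X'] e] by blast
    obtain k where k: "\<guillemotleft>k : X' \<rightarrow> X0\<guillemotright>" "f \<cdot> k = g" using f(3)[OF X' g(1)] by blast
    have "?q \<cdot> (i\<^sub>1 \<cdot> k) = g"
      using comp_assoc[OF k(1) b(1) a(2)] biproduct_pair_inj(1)[OF S f(2) E_triangle_arr(2)[OF t(1)]] k(2)
      by simp
    then show "\<epsilon> = \<zero>\<^bsub>Ext \<C> X' E\<^esub>"
      using pull_comp[OF a(4,2) comp_arr[OF k(1) b(1)] a(3)] E_triangle_pull_zero[OF t']
        pull_zero[OF a(4) comp_arr[OF k(1) b(1)]] g(2) by simp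
  qed
  then have "E \<in> perp" unfolding perp_def using a(4) Ext_trivial_sym X_Ob by blast
  then have "exchange_triangle E h S ?q B \<delta>" unfolding exchange_triangle_def using t' SX B by blast
  then show thesis by (rule that)
qed

text \<open>In the triangulated category \<open>\<Z>/[\<X>]\<close>, with \<open>\<Z>\<close> the subcategory \<open>perp\<close>, one has \<open>B = A[1]\<close> and
  \<open>B' = A'[1]\<close>, and the claim is that \<open>Hom(A, A'[1]) = 0\<close> if and only if \<open>Hom(A[1], A'[2]) = 0\<close>.\<close>

lemma exchange_Ext_trivial:
  assumes ex: "exchange_triangle A \<alpha> X \<beta> B \<delta>" and ex': "exchange_triangle A' \<alpha>' X' \<beta>' B' \<delta>'"
  shows "Ext_trivial A A' \<longleftrightarrow> Ext_trivial B B'"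
proof -
  note e = exchange_triangleD[OF ex] and e' = exchange_triangleD[OF ex']
  note a = E_triangle_arr[OF e(1)] and a' = E_triangle_arr[OF e'(1)]
  show ?thesis
  proof
    assume t: "Ext_trivial A A'"
    show "Ext_trivial B B'"
    proof (rule Ext_trivialI[OF a(6) a'(6)])
      fix \<epsilon> assume eps: "\<epsilon> \<in> carrier (Ext \<C> B B')"
      have "pull \<C> B' \<beta> \<epsilon> = \<zero>\<^bsub>Ext \<C> X B'\<^esub>"
        using pull_closed[OF a'(6) a(2) eps] perpD(3)[OF e'(4) e(2)] by blast
      then obtain f where f: "\<guillemotleft>f : A \<rightarrow> B'\<guillemotright>" "push \<C> B f \<delta> = \<epsilon>"
        using Ext_from_connecting_left[OF e(1) a'(6) eps] by blast
      have "pull \<C> A' f \<delta>' = \<zero>\<^bsub>Ext \<C> A A'\<^esub>" using pull_closed[OF a'(4) f(1) a'(3)] t by blast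
      then obtain g where g: "\<guillemotleft>g : A \<rightarrow> X'\<guillemotright>" "\<beta>' \<cdot> g = f" using lifts_along_deflation[OF e'(1) f(1)] by blast
      obtain h where h: "\<guillemotleft>h : X \<rightarrow> X'\<guillemotright>" "h \<cdot> \<alpha> = g"
        using left_approximationD(3)[OF exchange_triangle_left[OF ex] e'(2) g(1)] by blast
      have "f = (\<beta>' \<cdot> h) \<cdot> \<alpha>" using comp_assoc[OF a(1) h(1) a'(2)] g h by simp
      then show "\<epsilon> = \<zero>\<^bsub>Ext \<C> B B'\<^esub>"
        using push_comp[OF a(6,1) comp_arr[OF h(1) a'(2)] a(3)] E_triangle_push_zero[OF e(1)]
          push_zero[OF a(6) comp_arr[OF h(1) a'(2)]] f(2) by simp
    qed
  next
    assume t: "Ext_trivial B B'"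
    show "Ext_trivial A A'"
    proof (rule Ext_trivialI[OF a(4) a'(4)])
      fix \<epsilon> assume eps: "\<epsilon> \<in> carrier (Ext \<C> A A')"
      have "push \<C> A \<alpha>' \<epsilon> = \<zero>\<^bsub>Ext \<C> A X'\<^esub>"
        using push_closed[OF a(4) a'(1) eps] perpD(2)[OF e(3) e'(2)] by blast
      then obtain f where f: "\<guillemotleft>f : A \<rightarrow> B'\<guillemotright>" "pull \<C> A' f \<delta>' = \<epsilon>"
        using Ext_from_connecting_right[OF e'(1) a(4) eps] by blast
      have "push \<C> B f \<delta> = \<zero>\<^bsub>Ext \<C> B B'\<^esub>" using push_closed[OF a(6) f(1) a(3)] t by blast
      then obtain g where g: "\<guillemotleft>g : X \<rightarrow> B'\<guillemotright>" "g \<cdot> \<alpha> = f" using factors_through_inflation[OF e(1) f(1)] by blast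
      obtain h where h: "\<guillemotleft>h : X \<rightarrow> X'\<guillemotright>" "\<beta>' \<cdot> h = g"
        using right_approximationD(3)[OF exchange_triangle_right[OF ex'] e(2) g(1)] by blast
      have "f = \<beta>' \<cdot> (h \<cdot> \<alpha>)" using comp_assoc[OF a(1) h(1) a'(2)] g h by simp
      then show "\<epsilon> = \<zero>\<^bsub>Ext \<C> A A'\<^esub>"
        using pull_comp[OF a'(4,2) comp_arr[OF a(1) h(1)] a'(3)] E_triangle_pull_zero[OF e'(1)]
          pull_zero[OF a'(4) comp_arr[OF a(1) h(1)]] f(2) by simp
    qed
  qed
qed

text \<open>Functoriality of the shift in \<open>\<Z>/[\<X>]\<close>.\<close>

lemma exchange_map:
  assumes ex: "exchange_triangle A \<alpha> X \<beta> B \<delta>" and ex': "exchange_triangle A' \<alpha>' X' \<beta>' B' \<delta>'"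
    and u: "\<guillemotleft>u : A \<rightarrow> A'\<guillemotright>"
  obtains v where "\<guillemotleft>v : B \<rightarrow> B'\<guillemotright>" "push \<C> B u \<delta> = pull \<C> A' v \<delta>'"
proof -
  note e = exchange_triangleD[OF ex] and e' = exchange_triangleD[OF ex']
  note a = E_triangle_arr[OF e(1)] and a' = E_triangle_arr[OF e'(1)]
  obtain b where b: "\<guillemotleft>b : X \<rightarrow> X'\<guillemotright>" "b \<cdot> \<alpha> = \<alpha>' \<cdot> u"
    using left_approximationD(3)[OF exchange_triangle_left[OF ex] e'(2) comp_arr[OF u a'(1)]] by blast
  then show thesis using ET3[OF e(1) e'(1) u b(1,2)] that Ext_morphismD by blast
qed

section \<open>Mutation of cluster tilting subcategories\<close>

text \<open>The image of \<open>\<S>\<close> under the shift of \<open>\<Z>/[\<X>]\<close>, with all possible cones taken.\<close>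

definition mutate :: "'o set \<Rightarrow> 'o set" where
  "mutate \<S> = {B. \<exists>A\<in>\<S>. \<exists>\<alpha> X \<beta> \<delta>. exchange_triangle A \<alpha> X \<beta> B \<delta>}"

lemma mutateI: "exchange_triangle A \<alpha> X \<beta> B \<delta> \<Longrightarrow> A \<in> \<S> \<Longrightarrow> B \<in> mutate \<S>"
  unfolding mutate_def by blast

lemma mutateE:
  assumes "B \<in> mutate \<S>"
  obtains A \<alpha> X \<beta> \<delta> where "A \<in> \<S>" "exchange_triangle A \<alpha> X \<beta> B \<delta>"
  using assms unfolding mutate_def by blast

lemma mutate_perp: "mutate \<S> \<subseteq> perp"
  using exchange_triangleD(4) by (auto elim: mutateE)

lemma cluster_tilting_mem:
  assumes "cluster_tilting \<C> \<S>" and "M \<in> Ob \<C>"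
  shows "M \<in> \<S> \<longleftrightarrow> (\<forall>A\<in>\<S>. Ext_trivial M A)"
  using assms unfolding cluster_tilting_iff by blast

lemma cluster_tilting_subcategory: "cluster_tilting \<C> \<S> \<Longrightarrow> subcategory \<C> \<S>"
  unfolding cluster_tilting_iff by blast

lemma cluster_tilting_Ob: "cluster_tilting \<C> \<S> \<Longrightarrow> M \<in> \<S> \<Longrightarrow> M \<in> Ob \<C>"
  using cluster_tilting_subcategory subcategory_Ob by blast

lemma cluster_tilting_Ext: "cluster_tilting \<C> \<S> \<Longrightarrow> M \<in> \<S> \<Longrightarrow> N \<in> \<S> \<Longrightarrow> Ext_trivial M N"
  using cluster_tilting_mem cluster_tilting_Ob by blast

lemma cluster_tilting_perp: "cluster_tilting \<C> \<S> \<Longrightarrow> \<X> \<subseteq> \<S> \<Longrightarrow> \<S> \<subseteq> perp"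
  unfolding perp_def using cluster_tilting_Ob cluster_tilting_Ext by blast

lemma cluster_tilting_retract:
  assumes "cluster_tilting \<C> \<S>" and "N \<in> \<S>" and "retract_of \<C> M N"
  shows "M \<in> \<S>"
proof -
  have "M \<in> Ob \<C>" using assms(3) unfolding retract_of_def arr_def by blast
  then show ?thesis
    using cluster_tilting_mem[OF assms(1)] Ext_trivial_retract_left[OF assms(3)]
      cluster_tilting_Ob[OF assms(1)] assms(2) by blast
qed

lemma cluster_tilting_maximal:
  assumes "cluster_tilting \<C> \<S>" "cluster_tilting \<C> \<T>" and "\<T> \<subseteq> \<S>"
  shows "\<T> = \<S>"
  using assms cluster_tilting_mem[OF assms(2)] cluster_tilting_Ob[OF assms(1)] cluster_tilting_Ext[OF assms(1)]
  by blast

lemma mutate_mem: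
  assumes S: "cluster_tilting \<C> \<S>" "\<X> \<subseteq> \<S>" and M: "M \<in> perp"
  shows "M \<in> mutate \<S> \<longleftrightarrow> (\<forall>B\<in>mutate \<S>. Ext_trivial M B)"
proof
  assume "M \<in> mutate \<S>"
  then show "\<forall>B\<in>mutate \<S>. Ext_trivial M B"
    using exchange_Ext_trivial cluster_tilting_Ext[OF S(1)] by (blast elim: mutateE)
next
  assume *: "\<forall>B\<in>mutate \<S>. Ext_trivial M B"
  obtain A \<alpha> X \<beta> \<delta> where ex: "exchange_triangle A \<alpha> X \<beta> M \<delta>" using ex_exchange_triangle_to[OF M] .
  have "Ext_trivial A A'" if A': "A' \<in> \<S>" for A'
  proof -
    obtain \<alpha>' X' \<beta>' B' \<delta>' where ex': "exchange_triangle A' \<alpha>' X' \<beta>' B' \<delta>'"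
      using ex_exchange_triangle_from[of A'] cluster_tilting_perp[OF S] A' by blast
    then show ?thesis using exchange_Ext_trivial[OF ex ex'] * mutateI[OF ex' A'] by blast
  qed
  then have "A \<in> \<S>"
    using cluster_tilting_mem[OF S(1)] perpD(1)[OF exchange_triangleD(3)[OF ex]] by blast
  then show "M \<in> mutate \<S>" by (rule mutateI[OF ex])
qed

lemma X_subset_mutate:
  assumes S: "cluster_tilting \<C> \<S>" "\<X> \<subseteq> \<S>"
  shows "\<X> \<subseteq> mutate \<S>"
  using mutate_mem[OF S X_perp] perpD(3) mutate_perp by blast

lemma mutate_mem_Ob:
  assumes S: "cluster_tilting \<C> \<S>" "\<X> \<subseteq> \<S>" and M: "M \<in> Ob \<C>"
  shows "M \<in> mutate \<S> \<longleftrightarrow> (\<forall>B\<in>mutate \<S>. Ext_trivial M B)"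
proof (cases "M \<in> perp")
  case True
  then show ?thesis by (rule mutate_mem[OF S])
next
  case False
  then show ?thesis using M mutate_perp X_subset_mutate[OF S] unfolding perp_def by blast
qed

lemma mutate_Ob: "B \<in> mutate \<S> \<Longrightarrow> B \<in> Ob \<C>"
  using mutate_perp perpD(1) by blast

lemma subcategory_mutate:
  assumes S: "cluster_tilting \<C> \<S>" "\<X> \<subseteq> \<S>"
  shows "subcategory \<C> (mutate \<S>)"
proof -
  have "mutate \<S> = {M \<in> Ob \<C>. \<forall>B\<in>mutate \<S>. Ext_trivial M B}"
    using mutate_mem_Ob[OF S] mutate_Ob by blast
  then show ?thesis using subcategory_left_perp[of "mutate \<S>"] mutate_Ob by simp
qed

text \<open>Up to retracts, every object of \<open>\<S>\<close> is a sum of an object of \<open>\<X>\<close> and of copies of \<open>S\<^sub>0\<close>. The condition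
  is expressed by the identity morphisms.\<close>

definition generated_by :: "'o \<Rightarrow> 'o set \<Rightarrow> bool" where
  "generated_by S\<^sub>0 \<S> \<longleftrightarrow> S\<^sub>0 \<in> \<S> \<and>
     (\<forall>M\<in>\<S>. ident \<C> M \<in> morphism_sums \<C> M M (through \<C> (insert S\<^sub>0 \<X>) M M))"

text \<open>The shift takes a decomposition of the identity of \<open>A\<close> to one of the identity of the cone \<open>M\<close>, up to a
  morphism that factors through \<open>X\<close>.\<close>

lemma mutate_generated_by:
  assumes gen: "generated_by S\<^sub>0 \<S>" and perp: "\<S> \<subseteq> perp"
  obtains T\<^sub>0 where "generated_by T\<^sub>0 (mutate \<S>)"
proof -
  have S0: "S\<^sub>0 \<in> \<S>" using gen unfolding generated_by_def by blast
  then obtain \<alpha>0 X0 \<beta>0 T\<^sub>0 \<delta>0 where ex0: "exchange_triangle S\<^sub>0 \<alpha>0 X0 \<beta>0 T\<^sub>0 \<delta>0"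
    using ex_exchange_triangle_from perp by blast
  note e0 = exchange_triangleD[OF ex0] note a0 = E_triangle_arr[OF e0(1)]
  have "ident \<C> M \<in> morphism_sums \<C> M M (through \<C> (insert T\<^sub>0 \<X>) M M)" if M: "M \<in> mutate \<S>" for M
  proof -
    obtain A \<alpha> X \<beta> \<delta> where A: "A \<in> \<S>" and ex: "exchange_triangle A \<alpha> X \<beta> M \<delta>" using M by (rule mutateE)
    note e = exchange_triangleD[OF ex] note a = E_triangle_arr[OF e(1)]
    let ?P = "through \<C> (insert T\<^sub>0 \<X>) M M"
    have *: "\<exists>c\<in>morphism_sums \<C> M M ?P. push \<C> M f \<delta> = pull \<C> A c \<delta>"
      if "f \<in> morphism_sums \<C> A A (through \<C> (insert S\<^sub>0 \<X>) A A)" for f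
      using that
    proof induction
      case zero
      have "push \<C> M \<zero>\<^bsub>Mor \<C> A A\<^esub> \<delta> = pull \<C> A \<zero>\<^bsub>Mor \<C> M M\<^esub> \<delta>"
        using push_zero_arr[OF a(6,4,4,3)] pull_zero_arr[OF a(4,6,6,3)] by simp
      then show ?case using morphism_sums.zero by metis
    next
      case (add f g)
      obtain c where c: "c \<in> morphism_sums \<C> M M ?P" "push \<C> M g \<delta> = pull \<C> A c \<delta>" using add.IH by blast
      have ca: "\<guillemotleft>c : M \<rightarrow> M\<guillemotright>" using morphism_sums_arr[OF c(1) a(6,6) through_arr] .
      have fa: "\<guillemotleft>f : A \<rightarrow> A\<guillemotright>" using through_arr[OF add(1)] .
      have ga: "\<guillemotleft>g : A \<rightarrow> A\<guillemotright>" using morphism_sums_arr[OF add(2) a(4,4) through_arr] .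
      obtain Y u v where Y: "Y \<in> insert S\<^sub>0 \<X>" "\<guillemotleft>u : A \<rightarrow> Y\<guillemotright>" "\<guillemotleft>v : Y \<rightarrow> A\<guillemotright>" "f = v \<cdot> u"
        using add(1) unfolding through_def by blast
      show ?case
      proof (cases "Y \<in> \<X>")
        case True
        have "push \<C> M u \<delta> = \<zero>\<^bsub>Ext \<C> M Y\<^esub>" using push_closed[OF a(6) Y(2) a(3)] perpD(2)[OF e(4) True] by blast
        then have "push \<C> M f \<delta> = \<zero>\<^bsub>Ext \<C> M A\<^esub>"
          using push_comp[OF a(6) Y(2,3) a(3)] push_zero[OF a(6) Y(3)] Y(4) by simp
        then have "push \<C> M (f \<oplus>\<^bsub>Mor \<C> A A\<^esub> g) \<delta> = pull \<C> A c \<delta>"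
          using push_add_arr[OF a(6) fa ga a(3)] Ext_add_zero(2)[OF a(6,4) push_closed[OF a(6) ga a(3)]] c(2) by simp
        then show ?thesis using c(1) by blast
      next
        case False
        then have u: "\<guillemotleft>u : A \<rightarrow> S\<^sub>0\<guillemotright>" and v: "\<guillemotleft>v : S\<^sub>0 \<rightarrow> A\<guillemotright>" using Y by auto
        obtain u' where u': "\<guillemotleft>u' : M \<rightarrow> T\<^sub>0\<guillemotright>" "push \<C> M u \<delta> = pull \<C> S\<^sub>0 u' \<delta>0"
          using exchange_map[OF ex ex0 u] .
        obtain v' where v': "\<guillemotleft>v' : T\<^sub>0 \<rightarrow> M\<guillemotright>" "push \<C> T\<^sub>0 v \<delta>0 = pull \<C> A v' \<delta>"
          using exchange_map[OF ex0 ex v] .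
        have "push \<C> M f \<delta> = pull \<C> A (v' \<cdot> u') \<delta>"
          using push_comp[OF a(6) u v a(3)] u'(2) push_pull[OF v u'(1) a0(3)] v'(2)
            pull_comp[OF a(4) v'(1) u'(1) a(3)] Y(4) by simp
        then have "push \<C> M (f \<oplus>\<^bsub>Mor \<C> A A\<^esub> g) \<delta> = pull \<C> A (v' \<cdot> u' \<oplus>\<^bsub>Mor \<C> M M\<^esub> c) \<delta>"
          using push_add_arr[OF a(6) fa ga a(3)] pull_add_arr[OF a(4) comp_arr[OF u'(1) v'(1)] ca a(3)] c(2)
          by simp
        moreover have "v' \<cdot> u' \<in> ?P" unfolding through_def using u'(1) v'(1) by blast
        ultimately show ?thesis using morphism_sums.add[OF _ c(1)] by blast
      qed
    qed
    obtain c where c: "c \<in> morphism_sums \<C> M M ?P" "push \<C> M (ident \<C> A) \<delta> = pull \<C> A c \<delta>"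
      using * gen A unfolding generated_by_def by blast
    have ca: "\<guillemotleft>c : M \<rightarrow> M\<guillemotright>" using morphism_sums_arr[OF c(1) a(6,6) through_arr] .
    note i = ident_arr[OF a(6)] note n = neg_arr[OF ca]
    \<comment> \<open>\<open>\<delta> = c\<^sup>* \<delta>\<close>, so \<open>1 - c\<close> annihilates \<open>\<delta>\<close> and lifts to \<open>X\<close>\<close>
    let ?d = "ident \<C> M \<oplus>\<^bsub>Mor \<C> M M\<^esub> (\<ominus>\<^bsub>Mor \<C> M M\<^esub> c)"
    have "pull \<C> A ?d \<delta> = pull \<C> A (c \<oplus>\<^bsub>Mor \<C> M M\<^esub> (\<ominus>\<^bsub>Mor \<C> M M\<^esub> c)) \<delta>"
      using pull_add_arr[OF a(4) i n a(3)] pull_add_arr[OF a(4) ca n a(3)] c(2)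
        push_ident[OF a(6,4,3)] pull_ident[OF a(6,4,3)] by simp
    also have "\<dots> = \<zero>\<^bsub>Ext \<C> M A\<^esub>" using add_neg_arr(1)[OF ca] pull_zero_arr[OF a(4,6,6,3)] by simp
    finally obtain s where s: "\<guillemotleft>s : M \<rightarrow> X\<guillemotright>" "\<beta> \<cdot> s = ?d" using lifts_along_deflation[OF e(1) add_arr[OF i n]] by blast
    then have "?d \<in> ?P" unfolding through_def using e(2) a(2) by force
    moreover have "ident \<C> M = ?d \<oplus>\<^bsub>Mor \<C> M M\<^esub> c"
      using add_arr_assoc[OF i n ca] add_neg_arr(2)[OF ca] add_zero_arr(1)[OF i] by simp
    ultimately show ?thesis using morphism_sums.add[OF _ c(1)] by metis
  qed
  then show thesis using that[of T\<^sub>0] mutateI[OF ex0 S0] unfolding generated_by_def by blast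
qed

text \<open>A left \<open>\<X>\<close>-approximation of \<open>A\<close> is enlarged by one copy of \<open>S\<^sub>0\<close> for each member of a finite generating
  set of \<open>Hom(A, S\<^sub>0)\<close>.\<close>

lemma generated_left_approximation:
  assumes gen: "generated_by S\<^sub>0 \<S>" and S: "subcategory \<C> \<S>" "\<X> \<subseteq> \<S>" and A: "A \<in> Ob \<C>"
  shows "\<exists>f Y. left_approximation \<C> \<S> f A Y"
proof -
  have S0: "S\<^sub>0 \<in> \<S>" using gen unfolding generated_by_def by blast
  note Sob = subcategory_Ob[OF S(1)]
  obtain f0 X0 where "left_approximation \<C> \<X> f0 A X0" using ff_X A unfolding functorially_finite_def by blast
  note f0 = left_approximationD[OF this]
  obtain F where F: "finite F" "F \<subseteq> carrier (Mor \<C> A S\<^sub>0)" and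
    F_gen: "\<And>N. submodule K N (Mor \<C> A S\<^sub>0) \<Longrightarrow> F \<subseteq> N \<Longrightarrow> carrier (Mor \<C> A S\<^sub>0) \<subseteq> N"
    using finite_generators_Mor[OF A Sob[OF S0]] by metis
  have "\<exists>f Y. Y \<in> \<S> \<and> \<guillemotleft>f : A \<rightarrow> Y\<guillemotright> \<and> (\<exists>h. \<guillemotleft>h : Y \<rightarrow> X0\<guillemotright> \<and> h \<cdot> f = f0) \<and>
      (\<forall>g\<in>F. \<exists>h. \<guillemotleft>h : Y \<rightarrow> S\<^sub>0\<guillemotright> \<and> h \<cdot> f = g)"
    using F
  proof (induction F rule: finite_induct)
    case empty
    then show ?case using f0(1,2) S(2) ident_arr[OF X_Ob[OF f0(1)]] comp_ident_left[OF f0(2)] by blast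
  next
    case (insert g F)
    obtain f Y where Y: "Y \<in> \<S>" "\<guillemotleft>f : A \<rightarrow> Y\<guillemotright>" "\<exists>h. \<guillemotleft>h : Y \<rightarrow> X0\<guillemotright> \<and> h \<cdot> f = f0"
      "\<forall>g\<in>F. \<exists>h. \<guillemotleft>h : Y \<rightarrow> S\<^sub>0\<guillemotright> \<and> h \<cdot> f = g" using insert by blast
    have g: "\<guillemotleft>g : A \<rightarrow> S\<^sub>0\<guillemotright>" using insert.prems A Sob[OF S0] unfolding arr_def by blast
    obtain T i\<^sub>1 i\<^sub>2 p\<^sub>1 p\<^sub>2 where T: "is_biproduct \<C> Y S\<^sub>0 T i\<^sub>1 i\<^sub>2 p\<^sub>1 p\<^sub>2" using ex_biproduct Sob Y(1) S0 by blast
    note b = biproduct_arr[OF T]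
    let ?f = "i\<^sub>1 \<cdot> f \<oplus>\<^bsub>Mor \<C> A T\<^esub> i\<^sub>2 \<cdot> g"
    have fa: "\<guillemotleft>?f : A \<rightarrow> T\<guillemotright>" by (intro add_arr comp_arr[OF Y(2) b(1)] comp_arr[OF g b(2)])
    have 1: "\<exists>h'. \<guillemotleft>h' : T \<rightarrow> W\<guillemotright> \<and> h' \<cdot> ?f = k" if ex: "\<exists>h. \<guillemotleft>h : Y \<rightarrow> W\<guillemotright> \<and> h \<cdot> f = k" for W k
    proof -
      obtain h where h: "\<guillemotleft>h : Y \<rightarrow> W\<guillemotright>" "h \<cdot> f = k" using ex by blast
      have "(h \<cdot> p\<^sub>1) \<cdot> ?f = k" using comp_assoc[OF fa b(3) h(1)] biproduct_proj_pair(1)[OF T Y(2) g] h(2) by simp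
      then show ?thesis using comp_arr[OF b(3) h(1)] by blast
    qed
    have 2: "\<exists>h. \<guillemotleft>h : T \<rightarrow> S\<^sub>0\<guillemotright> \<and> h \<cdot> ?f = g" using b(4) biproduct_proj_pair(2)[OF T Y(2) g] by blast
    show ?case
      using subcategory_biproduct[OF S(1) T Y(1) S0] fa 1[OF Y(3)] 1 2 Y(4)
      by (intro exI[of _ ?f] exI[of _ T]) blast
  qed
  then obtain f Y h0 where Y: "Y \<in> \<S>" "\<guillemotleft>f : A \<rightarrow> Y\<guillemotright>" and h0: "\<guillemotleft>h0 : Y \<rightarrow> X0\<guillemotright>" "h0 \<cdot> f = f0" and
    fF: "\<And>g. g \<in> F \<Longrightarrow> \<exists>h. \<guillemotleft>h : Y \<rightarrow> S\<^sub>0\<guillemotright> \<and> h \<cdot> f = g" by blast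
  note Yob = arr_Ob(2)[OF Y(2)]
  have to_S0: "\<exists>h. \<guillemotleft>h : Y \<rightarrow> S\<^sub>0\<guillemotright> \<and> h \<cdot> f = g" if "\<guillemotleft>g : A \<rightarrow> S\<^sub>0\<guillemotright>" for g
  proof -
    have "submodule K {g \<in> carrier (Mor \<C> A S\<^sub>0). \<exists>h. \<guillemotleft>h : Y \<rightarrow> S\<^sub>0\<guillemotright> \<and> h \<cdot> f = g} (Mor \<C> A S\<^sub>0)"
    proof (rule submodule_Mor[OF A Sob[OF S0]])
      show "\<exists>h. \<guillemotleft>h : Y \<rightarrow> S\<^sub>0\<guillemotright> \<and> h \<cdot> f = \<zero>\<^bsub>Mor \<C> A S\<^sub>0\<^esub>"
        using zero_arr[OF Yob Sob[OF S0]] comp_zero_left[OF Y(2) Sob[OF S0]] by blast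
      show "\<exists>h. \<guillemotleft>h : Y \<rightarrow> S\<^sub>0\<guillemotright> \<and> h \<cdot> f = g \<oplus>\<^bsub>Mor \<C> A S\<^sub>0\<^esub> g'"
        if "\<exists>h. \<guillemotleft>h : Y \<rightarrow> S\<^sub>0\<guillemotright> \<and> h \<cdot> f = g" "\<exists>h. \<guillemotleft>h : Y \<rightarrow> S\<^sub>0\<guillemotright> \<and> h \<cdot> f = g'" for g g'
        using that comp_add_left[OF Y(2)] add_arr by blast
      show "\<exists>h. \<guillemotleft>h : Y \<rightarrow> S\<^sub>0\<guillemotright> \<and> h \<cdot> f = r \<odot>\<^bsub>Mor \<C> A S\<^sub>0\<^esub> g"
        if r: "r \<in> carrier K" and ex: "\<exists>h. \<guillemotleft>h : Y \<rightarrow> S\<^sub>0\<guillemotright> \<and> h \<cdot> f = g" for r g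
      proof -
        interpret V: vectorspace K "Mor \<C> Y S\<^sub>0" using Mor_vectorspace Yob Sob[OF S0] by blast
        obtain h where h: "\<guillemotleft>h : Y \<rightarrow> S\<^sub>0\<guillemotright>" "h \<cdot> f = g" using ex by blast
        then have "\<guillemotleft>r \<odot>\<^bsub>Mor \<C> Y S\<^sub>0\<^esub> h : Y \<rightarrow> S\<^sub>0\<guillemotright>" using r V.smult_closed unfolding arr_def by blast
        then show ?thesis using comp_smult_left[OF Y(2) h(1) r] h(2) by metis
    qed
    qed
    from F_gen[OF this] F(2) fF that show ?thesis unfolding arr_def by blast
  qed
  have "left_approximation \<C> \<S> f A Y"
    unfolding left_approximation_def
  proof (intro conjI ballI allI impI Y)
    fix M g assume M: "M \<in> \<S>" and g: "\<guillemotleft>g : A \<rightarrow> M\<guillemotright>"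
    have "ident \<C> M \<in> morphism_sums \<C> M M (through \<C> (insert S\<^sub>0 \<X>) M M)"
      using gen M unfolding generated_by_def by blast
    from through_sums_to[OF this g] show "\<exists>h. \<guillemotleft>h : Y \<rightarrow> M\<guillemotright> \<and> h \<cdot> f = g"
    proof (rule extend_morphism_sums[OF _ Y(2) arr_Ob(2)[OF g]])
      fix k assume "k \<in> through \<C> (insert S\<^sub>0 \<X>) A M"
      then obtain W u v where W: "W \<in> insert S\<^sub>0 \<X>" "\<guillemotleft>u : A \<rightarrow> W\<guillemotright>" "\<guillemotleft>v : W \<rightarrow> M\<guillemotright>" "k = v \<cdot> u"
        unfolding through_def by blast
      have "\<exists>l. \<guillemotleft>l : Y \<rightarrow> W\<guillemotright> \<and> l \<cdot> f = u"
      proof (cases "W = S\<^sub>0")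
        case True
        then show ?thesis using to_S0 W(2) by blast
      next
        case False
        then obtain l where l: "\<guillemotleft>l : X0 \<rightarrow> W\<guillemotright>" "l \<cdot> f0 = u" using W(1) f0(3)[OF _ W(2)] by blast
        then have "(l \<cdot> h0) \<cdot> f = u" using comp_assoc[OF Y(2) h0(1) l(1)] h0(2) by simp
        then show ?thesis using comp_arr[OF h0(1) l(1)] by blast
      qed
      then obtain l where l: "\<guillemotleft>l : Y \<rightarrow> W\<guillemotright>" "l \<cdot> f = u" by blast
      then have "(v \<cdot> l) \<cdot> f = k" using comp_assoc[OF Y(2) l(1) W(3)] W(4) by simp
      then show "\<exists>h. \<guillemotleft>h : Y \<rightarrow> M\<guillemotright> \<and> h \<cdot> f = k" using comp_arr[OF l(1) W(3)] by blast
    qed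
  qed
  then show ?thesis by blast
qed

lemma generated_right_approximation:
  assumes gen: "generated_by S\<^sub>0 \<S>" and S: "subcategory \<C> \<S>" "\<X> \<subseteq> \<S>" and A: "A \<in> Ob \<C>"
  shows "\<exists>f Y. right_approximation \<C> \<S> f Y A"
proof -
  have S0: "S\<^sub>0 \<in> \<S>" using gen unfolding generated_by_def by blast
  note Sob = subcategory_Ob[OF S(1)]
  obtain f0 X0 where "right_approximation \<C> \<X> f0 X0 A" using ff_X A unfolding functorially_finite_def by blast
  note f0 = right_approximationD[OF this]
  obtain F where F: "finite F" "F \<subseteq> carrier (Mor \<C> S\<^sub>0 A)" and
    F_gen: "\<And>N. submodule K N (Mor \<C> S\<^sub>0 A) \<Longrightarrow> F \<subseteq> N \<Longrightarrow> carrier (Mor \<C> S\<^sub>0 A) \<subseteq> N"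
    using finite_generators_Mor[OF Sob[OF S0] A] by metis
  have "\<exists>f Y. Y \<in> \<S> \<and> \<guillemotleft>f : Y \<rightarrow> A\<guillemotright> \<and> (\<exists>h. \<guillemotleft>h : X0 \<rightarrow> Y\<guillemotright> \<and> f \<cdot> h = f0) \<and>
      (\<forall>g\<in>F. \<exists>h. \<guillemotleft>h : S\<^sub>0 \<rightarrow> Y\<guillemotright> \<and> f \<cdot> h = g)"
    using F
  proof (induction F rule: finite_induct)
    case empty
    then show ?case using f0(1,2) S(2) ident_arr[OF X_Ob[OF f0(1)]] comp_ident_right[OF f0(2)] by blast
  next
    case (insert g F)
    obtain f Y where Y: "Y \<in> \<S>" "\<guillemotleft>f : Y \<rightarrow> A\<guillemotright>" "\<exists>h. \<guillemotleft>h : X0 \<rightarrow> Y\<guillemotright> \<and> f \<cdot> h = f0"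
      "\<forall>g\<in>F. \<exists>h. \<guillemotleft>h : S\<^sub>0 \<rightarrow> Y\<guillemotright> \<and> f \<cdot> h = g" using insert by blast
    have g: "\<guillemotleft>g : S\<^sub>0 \<rightarrow> A\<guillemotright>" using insert.prems A Sob[OF S0] unfolding arr_def by blast
    obtain T i\<^sub>1 i\<^sub>2 p\<^sub>1 p\<^sub>2 where T: "is_biproduct \<C> Y S\<^sub>0 T i\<^sub>1 i\<^sub>2 p\<^sub>1 p\<^sub>2" using ex_biproduct Sob Y(1) S0 by blast
    note b = biproduct_arr[OF T]
    let ?f = "f \<cdot> p\<^sub>1 \<oplus>\<^bsub>Mor \<C> T A\<^esub> g \<cdot> p\<^sub>2"
    have fa: "\<guillemotleft>?f : T \<rightarrow> A\<guillemotright>" by (intro add_arr comp_arr[OF b(3) Y(2)] comp_arr[OF b(4) g])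
    have 1: "\<exists>h'. \<guillemotleft>h' : W \<rightarrow> T\<guillemotright> \<and> ?f \<cdot> h' = k" if ex: "\<exists>h. \<guillemotleft>h : W \<rightarrow> Y\<guillemotright> \<and> f \<cdot> h = k" for W k
    proof -
      obtain h where h: "\<guillemotleft>h : W \<rightarrow> Y\<guillemotright>" "f \<cdot> h = k" using ex by blast
      have "?f \<cdot> (i\<^sub>1 \<cdot> h) = k" using comp_assoc[OF h(1) b(1) fa] biproduct_pair_inj(1)[OF T Y(2) g] h(2) by simp
      then show ?thesis using comp_arr[OF h(1) b(1)] by blast
    qed
    have 2: "\<exists>h. \<guillemotleft>h : S\<^sub>0 \<rightarrow> T\<guillemotright> \<and> ?f \<cdot> h = g" using b(2) biproduct_pair_inj(2)[OF T Y(2) g] by blast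
    show ?case
      using subcategory_biproduct[OF S(1) T Y(1) S0] fa 1[OF Y(3)] 1 2 Y(4)
      by (intro exI[of _ ?f] exI[of _ T]) blast
  qed
  then obtain f Y h0 where Y: "Y \<in> \<S>" "\<guillemotleft>f : Y \<rightarrow> A\<guillemotright>" and h0: "\<guillemotleft>h0 : X0 \<rightarrow> Y\<guillemotright>" "f \<cdot> h0 = f0" and
    fF: "\<And>g. g \<in> F \<Longrightarrow> \<exists>h. \<guillemotleft>h : S\<^sub>0 \<rightarrow> Y\<guillemotright> \<and> f \<cdot> h = g" by blast
  note Yob = arr_Ob(1)[OF Y(2)]
  have from_S0: "\<exists>h. \<guillemotleft>h : S\<^sub>0 \<rightarrow> Y\<guillemotright> \<and> f \<cdot> h = g" if "\<guillemotleft>g : S\<^sub>0 \<rightarrow> A\<guillemotright>" for g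
  proof -
    have "submodule K {g \<in> carrier (Mor \<C> S\<^sub>0 A). \<exists>h. \<guillemotleft>h : S\<^sub>0 \<rightarrow> Y\<guillemotright> \<and> f \<cdot> h = g} (Mor \<C> S\<^sub>0 A)"
    proof (rule submodule_Mor[OF Sob[OF S0] A])
      show "\<exists>h. \<guillemotleft>h : S\<^sub>0 \<rightarrow> Y\<guillemotright> \<and> f \<cdot> h = \<zero>\<^bsub>Mor \<C> S\<^sub>0 A\<^esub>"
        using zero_arr[OF Sob[OF S0] Yob] comp_zero_right[OF Y(2) Sob[OF S0]] by blast
      show "\<exists>h. \<guillemotleft>h : S\<^sub>0 \<rightarrow> Y\<guillemotright> \<and> f \<cdot> h = g \<oplus>\<^bsub>Mor \<C> S\<^sub>0 A\<^esub> g'"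
        if "\<exists>h. \<guillemotleft>h : S\<^sub>0 \<rightarrow> Y\<guillemotright> \<and> f \<cdot> h = g" "\<exists>h. \<guillemotleft>h : S\<^sub>0 \<rightarrow> Y\<guillemotright> \<and> f \<cdot> h = g'" for g g'
        using that comp_add_right[OF _ _ Y(2)] add_arr by blast
      show "\<exists>h. \<guillemotleft>h : S\<^sub>0 \<rightarrow> Y\<guillemotright> \<and> f \<cdot> h = r \<odot>\<^bsub>Mor \<C> S\<^sub>0 A\<^esub> g"
        if r: "r \<in> carrier K" and ex: "\<exists>h. \<guillemotleft>h : S\<^sub>0 \<rightarrow> Y\<guillemotright> \<and> f \<cdot> h = g" for r g
      proof -
        interpret V: vectorspace K "Mor \<C> S\<^sub>0 Y" using Mor_vectorspace Yob Sob[OF S0] by blast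
        obtain h where h: "\<guillemotleft>h : S\<^sub>0 \<rightarrow> Y\<guillemotright>" "f \<cdot> h = g" using ex by blast
        then have "\<guillemotleft>r \<odot>\<^bsub>Mor \<C> S\<^sub>0 Y\<^esub> h : S\<^sub>0 \<rightarrow> Y\<guillemotright>" using r V.smult_closed unfolding arr_def by blast
        then show ?thesis using comp_smult_right[OF h(1) Y(2) r] h(2) by metis
    qed
    qed
    from F_gen[OF this] F(2) fF that show ?thesis unfolding arr_def by blast
  qed
  have "right_approximation \<C> \<S> f Y A"
    unfolding right_approximation_def
  proof (intro conjI ballI allI impI Y)
    fix M g assume M: "M \<in> \<S>" and g: "\<guillemotleft>g : M \<rightarrow> A\<guillemotright>"
    have "ident \<C> M \<in> morphism_sums \<C> M M (through \<C> (insert S\<^sub>0 \<X>) M M)"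
      using gen M unfolding generated_by_def by blast
    from through_sums_from[OF this g] show "\<exists>h. \<guillemotleft>h : M \<rightarrow> Y\<guillemotright> \<and> f \<cdot> h = g"
    proof (rule lift_morphism_sums[OF _ Y(2) arr_Ob(1)[OF g]])
      fix k assume "k \<in> through \<C> (insert S\<^sub>0 \<X>) M A"
      then obtain W u v where W: "W \<in> insert S\<^sub>0 \<X>" "\<guillemotleft>u : M \<rightarrow> W\<guillemotright>" "\<guillemotleft>v : W \<rightarrow> A\<guillemotright>" "k = v \<cdot> u"
        unfolding through_def by blast
      have "\<exists>l. \<guillemotleft>l : W \<rightarrow> Y\<guillemotright> \<and> f \<cdot> l = v"
      proof (cases "W = S\<^sub>0")
        case True
        then show ?thesis using from_S0 W(3) by blast
      next
        case False
        then obtain l where l: "\<guillemotleft>l : W \<rightarrow> X0\<guillemotright>" "f0 \<cdot> l = v" using W(1) f0(3)[OF _ W(3)] by blast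
        then have "f \<cdot> (h0 \<cdot> l) = v" using comp_assoc[OF l(1) h0(1) Y(2)] h0(2) by simp
        then show ?thesis using comp_arr[OF l(1) h0(1)] by blast
      qed
      then obtain l where l: "\<guillemotleft>l : W \<rightarrow> Y\<guillemotright>" "f \<cdot> l = v" by blast
      then have "f \<cdot> (l \<cdot> u) = k" using comp_assoc[OF W(2) l(1) Y(2)] W(4) by simp
      then show "\<exists>h. \<guillemotleft>h : M \<rightarrow> Y\<guillemotright> \<and> f \<cdot> h = k" using comp_arr[OF W(2) l(1)] by blast
    qed
  qed
  then show ?thesis by blast
qed

lemma cluster_tilting_mutate:
  assumes S: "cluster_tilting \<C> \<S>" "\<X> \<subseteq> \<S>" and gen: "generated_by S\<^sub>0 \<S>"
  obtains T\<^sub>0 where "cluster_tilting \<C> (mutate \<S>)" "generated_by T\<^sub>0 (mutate \<S>)"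
proof -
  obtain T\<^sub>0 where T: "generated_by T\<^sub>0 (mutate \<S>)" using mutate_generated_by[OF gen cluster_tilting_perp[OF S]] .
  note sub = subcategory_mutate[OF S] note X = X_subset_mutate[OF S]
  have "functorially_finite \<C> (mutate \<S>)"
    unfolding functorially_finite_def
    using generated_left_approximation[OF T sub X] generated_right_approximation[OF T sub X] by blast
  then have "cluster_tilting \<C> (mutate \<S>)"
    unfolding cluster_tilting_iff using sub mutate_mem_Ob[OF S] by blast
  then show thesis using that T by blast
qed

text \<open>If \<open>\<S>\<close> is closed under cones, then all exchange triangles starting in \<open>\<S>\<close> split, and \<open>\<S> = \<X>\<close>.\<close>

lemma mutate_neq:
  assumes S: "cluster_tilting \<C> \<S>" "\<X> \<subseteq> \<S>" "\<S> \<noteq> \<X>"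
  shows "mutate \<S> \<noteq> \<S>"
proof
  assume eq: "mutate \<S> = \<S>"
  have "A \<in> \<X>" if A: "A \<in> \<S>" for A
  proof -
    obtain \<alpha> X \<beta> B \<delta> where ex: "exchange_triangle A \<alpha> X \<beta> B \<delta>"
      using ex_exchange_triangle_from cluster_tilting_perp[OF S(1,2)] A by blast
    note e = exchange_triangleD[OF ex] note a = E_triangle_arr[OF e(1)]
    have "B \<in> \<S>" using mutateI[OF ex A] eq by simp
    then have "\<delta> = \<zero>\<^bsub>Ext \<C> B A\<^esub>" using cluster_tilting_Ext[OF S(1) _ A] a(3) by blast
    then show "A \<in> \<X>" using subcategory_E_triangle_split(1)[OF subcategory_X _ e(2)] e(1) by simp
  qed
  then show False using S(2,3) by blast
qed

lemma mutation_pair_mutate: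
  assumes S: "cluster_tilting \<C> \<S>" "\<X> \<subseteq> \<S>"
  shows "mutation_pair \<C> \<X> \<S> (mutate \<S>)"
  unfolding mutation_pair_def
proof (intro conjI ballI subcategory_X cluster_tilting_subcategory[OF S(1)] subcategory_mutate[OF S]
    X_subset_mutate[OF S] S(2))
  fix A assume A: "A \<in> \<S>"
  obtain \<alpha> X \<beta> B \<delta> where ex: "exchange_triangle A \<alpha> X \<beta> B \<delta>"
    using ex_exchange_triangle_from cluster_tilting_perp[OF S(1,2)] A by blast
  then show "\<exists>B\<in>mutate \<S>. \<exists>\<alpha> X \<beta> \<delta>. E_triangle \<C> A \<alpha> X \<beta> B \<delta> \<and>
      left_approximation \<C> \<X> \<alpha> A X \<and> right_approximation \<C> \<X> \<beta> X B"
    using mutateI[OF ex A] exchange_triangleD(1)[OF ex] exchange_triangle_left[OF ex]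
      exchange_triangle_right[OF ex] by blast
next
  fix B assume "B \<in> mutate \<S>"
  then obtain A \<alpha> X \<beta> \<delta> where A: "A \<in> \<S>" and ex: "exchange_triangle A \<alpha> X \<beta> B \<delta>" by (rule mutateE)
  then show "\<exists>A\<in>\<S>. \<exists>\<alpha> X \<beta> \<delta>. E_triangle \<C> A \<alpha> X \<beta> B \<delta> \<and>
      left_approximation \<C> \<X> \<alpha> A X \<and> right_approximation \<C> \<X> \<beta> X B"
    using exchange_triangleD(1)[OF ex] exchange_triangle_left[OF ex] exchange_triangle_right[OF ex] by blast
qed

section \<open>Rigid objects and the uniqueness of the second completion\<close>

text \<open>The right \<open>End(R)\<close>-submodule of \<open>Hom(R, T)\<close> generated by \<open>F\<close> and by the morphisms that factor through
  \<open>\<X>\<close>.\<close>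

definition span_mod :: "'o \<Rightarrow> 'o \<Rightarrow> 'm set \<Rightarrow> 'm set" where
  "span_mod R T F = morphism_sums \<C> R T (through \<C> \<X> R T \<union> {f \<cdot> r | f r. f \<in> F \<and> \<guillemotleft>r : R \<rightarrow> R\<guillemotright>})"

context
  fixes R T :: 'o
  assumes R: "R \<in> Ob \<C>" and T: "T \<in> Ob \<C>"
begin

abbreviation (input) "gens F \<equiv> through \<C> \<X> R T \<union> {f \<cdot> r | f r. f \<in> F \<and> \<guillemotleft>r : R \<rightarrow> R\<guillemotright>}"

lemma gens_arr:
  assumes "\<And>f. f \<in> F \<Longrightarrow> \<guillemotleft>f : R \<rightarrow> T\<guillemotright>" and "g \<in> gens F"
  shows "\<guillemotleft>g : R \<rightarrow> T\<guillemotright>"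
  using assms(2) through_arr comp_arr assms(1) by blast

lemma span_mod_arr:
  assumes "\<And>f. f \<in> F \<Longrightarrow> \<guillemotleft>f : R \<rightarrow> T\<guillemotright>" and "g \<in> span_mod R T F"
  shows "\<guillemotleft>g : R \<rightarrow> T\<guillemotright>"
  using assms(2) unfolding span_mod_def by (rule morphism_sums_arr[OF _ R T gens_arr[OF assms(1)]])

lemma span_mod_gens:
  assumes "\<And>f. f \<in> F \<Longrightarrow> \<guillemotleft>f : R \<rightarrow> T\<guillemotright>" and "g \<in> gens F"
  shows "g \<in> span_mod R T F"
  unfolding span_mod_def using assms(2) gens_arr[OF assms] by (rule morphism_sums_base)

lemma span_mod_add:
  assumes "\<And>f. f \<in> F \<Longrightarrow> \<guillemotleft>f : R \<rightarrow> T\<guillemotright>" and "g \<in> span_mod R T F" "h \<in> span_mod R T F"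
  shows "g \<oplus>\<^bsub>Mor \<C> R T\<^esub> h \<in> span_mod R T F"
  using assms(2,3) unfolding span_mod_def by (rule morphism_sums_add[OF _ _ R T gens_arr[OF assms(1)]])

lemma span_mod_comp:
  assumes F: "\<And>f. f \<in> F \<Longrightarrow> \<guillemotleft>f : R \<rightarrow> T\<guillemotright>" and g: "g \<in> span_mod R T F" and r: "\<guillemotleft>r : R \<rightarrow> R\<guillemotright>"
  shows "g \<cdot> r \<in> span_mod R T F"
proof -
  have "ident \<C> T \<cdot> g \<cdot> r \<in> span_mod R T F"
    unfolding span_mod_def
  proof (rule morphism_sums_comp[OF g[unfolded span_mod_def] R T gens_arr[OF F] gens_arr[OF F] r ident_arr[OF T]])
    fix h assume h: "h \<in> gens F"
    have ha: "\<guillemotleft>h : R \<rightarrow> T\<guillemotright>" using gens_arr[OF F h] .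
    have "h \<cdot> r \<in> gens F"
    proof (cases "h \<in> through \<C> \<X> R T")
      case True
      then show ?thesis using through_comp[OF True r ident_arr[OF T]] comp_ident_left[OF ha] by simp
    next
      case False
      then obtain f s where f: "f \<in> F" "\<guillemotleft>s : R \<rightarrow> R\<guillemotright>" "h = f \<cdot> s" using h by blast
      then have "h \<cdot> r = f \<cdot> (s \<cdot> r)" using comp_assoc[OF r f(2) F[OF f(1)]] by simp
      then show ?thesis using f(1) comp_arr[OF r f(2)] by blast
    qed
    then show "ident \<C> T \<cdot> h \<cdot> r \<in> morphism_sums \<C> R T (gens F)"
      using span_mod_gens[OF F] comp_ident_left[OF ha] unfolding span_mod_def by simp
  qed
  then show ?thesis using comp_ident_left[OF span_mod_arr[OF F g]] by simp
qed

lemma span_mod_neg: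
  assumes F: "\<And>f. f \<in> F \<Longrightarrow> \<guillemotleft>f : R \<rightarrow> T\<guillemotright>" and g: "g \<in> span_mod R T F"
  shows "\<ominus>\<^bsub>Mor \<C> R T\<^esub> g \<in> span_mod R T F"
proof -
  have "g \<cdot> (\<ominus>\<^bsub>Mor \<C> R R\<^esub> (ident \<C> R)) = \<ominus>\<^bsub>Mor \<C> R T\<^esub> g"
    using comp_neg_right[OF ident_arr[OF R] span_mod_arr[OF F g]] comp_ident_right[OF span_mod_arr[OF F g]] by simp
  then show ?thesis using span_mod_comp[OF F g neg_arr[OF ident_arr[OF R]]] by simp
qed

lemma span_mod_mono: "F \<subseteq> G \<Longrightarrow> g \<in> span_mod R T F \<Longrightarrow> g \<in> span_mod R T G"
  unfolding span_mod_def by (erule morphism_sums_mono) blast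

lemma span_mod_trans:
  assumes G: "\<And>f. f \<in> G \<Longrightarrow> \<guillemotleft>f : R \<rightarrow> T\<guillemotright>" and FG: "F \<subseteq> span_mod R T G" and g: "g \<in> span_mod R T F"
  shows "g \<in> span_mod R T G"
  using g unfolding span_mod_def[of R T F]
proof induction
  case zero
  then show ?case unfolding span_mod_def by (rule morphism_sums.zero)
next
  case (add f g)
  have "f \<in> span_mod R T G"
    using add(1) span_mod_gens[OF G] span_mod_comp[OF G] FG by blast
  then show ?case using span_mod_add[OF G] add.IH by blast
qed

lemma finite_span_mod:
  obtains F where "finite F" "\<And>f. f \<in> F \<Longrightarrow> \<guillemotleft>f : R \<rightarrow> T\<guillemotright>" "\<And>g. \<guillemotleft>g : R \<rightarrow> T\<guillemotright> \<Longrightarrow> g \<in> span_mod R T F"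
proof -
  obtain F where F: "finite F" "F \<subseteq> carrier (Mor \<C> R T)" and
    F_gen: "\<And>N. submodule K N (Mor \<C> R T) \<Longrightarrow> F \<subseteq> N \<Longrightarrow> carrier (Mor \<C> R T) \<subseteq> N"
    using finite_generators_Mor[OF R T] by metis
  have Fa: "\<guillemotleft>f : R \<rightarrow> T\<guillemotright>" if "f \<in> F" for f using that F(2) R T unfolding arr_def by blast
  have sub: "submodule K {g \<in> carrier (Mor \<C> R T). g \<in> span_mod R T F} (Mor \<C> R T)"
  proof (rule submodule_Mor[OF R T])
    show "\<zero>\<^bsub>Mor \<C> R T\<^esub> \<in> span_mod R T F" unfolding span_mod_def by (rule morphism_sums.zero)
    show "f \<oplus>\<^bsub>Mor \<C> R T\<^esub> g \<in> span_mod R T F" if "f \<in> span_mod R T F" "g \<in> span_mod R T F" for f g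
      using span_mod_add[OF Fa] that by blast
    show "r \<odot>\<^bsub>Mor \<C> R T\<^esub> f \<in> span_mod R T F"
      if r: "r \<in> carrier K" and fa: "\<guillemotleft>f : R \<rightarrow> T\<guillemotright>" and f: "f \<in> span_mod R T F" for r f
    proof -
      interpret V: vectorspace K "Mor \<C> R R" using Mor_vectorspace R by blast
      note i = ident_arr[OF R]
      have ri: "\<guillemotleft>r \<odot>\<^bsub>Mor \<C> R R\<^esub> ident \<C> R : R \<rightarrow> R\<guillemotright>" using i r V.smult_closed unfolding arr_def by blast
      have "f \<cdot> (r \<odot>\<^bsub>Mor \<C> R R\<^esub> ident \<C> R) = r \<odot>\<^bsub>Mor \<C> R T\<^esub> f"
        using comp_smult_right[OF i fa r] comp_ident_right[OF fa] by simp
      then show ?thesis using span_mod_comp[OF Fa f ri] by simp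
    qed
  qed
  have "F \<subseteq> span_mod R T F"
  proof
    fix f assume f: "f \<in> F"
    then have "f \<cdot> ident \<C> R \<in> span_mod R T F" using span_mod_gens[OF Fa] ident_arr[OF R] by blast
    then show "f \<in> span_mod R T F" using comp_ident_right[OF Fa[OF f]] by simp
  qed
  then have "F \<subseteq> {g \<in> carrier (Mor \<C> R T). g \<in> span_mod R T F}" using F(2) by blast
  from F_gen[OF sub this] have "\<And>g. \<guillemotleft>g : R \<rightarrow> T\<guillemotright> \<Longrightarrow> g \<in> span_mod R T F" unfolding arr_def by blast
  then show thesis using that[of F] F(1) Fa by blast
qed

end

text \<open>The deflation \<open>x\<^sub>0 : X\<^sub>0 \<rightarrow> T\<close> is enlarged to \<open>y : X\<^sub>0 \<oplus> R\<^sup>F \<rightarrow> T\<close> with one copy of \<open>R\<close> for each member of \<open>F\<close>.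
  The last clause is the part that uses the local endomorphism ring: if \<open>\<phi> : R \<rightarrow> Y\<close> is a split
  monomorphism, then one of its components in \<open>R\<^sup>F\<close>, say \<open>u\<close> at \<open>f\<close>, is invertible, since \<open>R\<close> is not a retract of
  \<open>X\<^sub>0\<close>. So \<open>y \<phi>\<close> is \<open>f u\<close> up to the span of the other members of \<open>F\<close>.\<close>

lemma ex_deflation_extension:
  assumes S: "subcategory \<C> \<S>" "\<X> \<subseteq> \<S>" and R: "R \<in> \<S>" "R \<notin> \<X>" and loc: "local_ring (End_ring \<C> R)"
    and ex: "exchange_triangle K\<^sub>0 \<kappa>\<^sub>0 X\<^sub>0 x\<^sub>0 T \<delta>\<^sub>0"
    and F: "finite F" "F \<subseteq> {f. \<guillemotleft>f : R \<rightarrow> T\<guillemotright>}"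
  shows "\<exists>L \<kappa> Y y \<delta>. E_triangle \<C> L \<kappa> Y y T \<delta> \<and> Y \<in> \<S> \<and>
      (\<exists>h. \<guillemotleft>h : X\<^sub>0 \<rightarrow> Y\<guillemotright> \<and> y \<cdot> h = x\<^sub>0) \<and> (\<forall>f\<in>F. \<exists>h. \<guillemotleft>h : R \<rightarrow> Y\<guillemotright> \<and> y \<cdot> h = f) \<and>
      (if F = {} then Y \<in> \<X> else retract_of \<C> R Y) \<and>
      (\<forall>\<phi>. \<guillemotleft>\<phi> : R \<rightarrow> Y\<guillemotright> \<longrightarrow> y \<cdot> \<phi> \<in> span_mod R T F) \<and>
      (\<forall>\<phi> p. \<guillemotleft>\<phi> : R \<rightarrow> Y\<guillemotright> \<longrightarrow> \<guillemotleft>p : Y \<rightarrow> R\<guillemotright> \<longrightarrow> is_iso \<C> (p \<cdot> \<phi>) R R \<longrightarrow>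
        (\<exists>f\<in>F. \<exists>u. \<exists>s\<in>span_mod R T (F - {f}). is_iso \<C> u R R \<and> y \<cdot> \<phi> = f \<cdot> u \<oplus>\<^bsub>Mor \<C> R T\<^esub> s))"
  using F
proof (induction F rule: finite_induct)
  case empty
  note e = exchange_triangleD[OF ex] note a = E_triangle_arr[OF e(1)]
  have Rob: "R \<in> Ob \<C>" using subcategory_Ob[OF S(1) R(1)] .
  have "x\<^sub>0 \<cdot> \<phi> \<in> span_mod R T {}" if "\<guillemotleft>\<phi> : R \<rightarrow> X\<^sub>0\<guillemotright>" for \<phi>
  proof (rule span_mod_gens[OF Rob a(6)])
    show "x\<^sub>0 \<cdot> \<phi> \<in> through \<C> \<X> R T \<union> {f \<cdot> r | f r. f \<in> {} \<and> \<guillemotleft>r : R \<rightarrow> R\<guillemotright>}"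
      unfolding through_def using that a(2) e(2) by blast
  qed auto
  moreover have "\<not> is_iso \<C> (p \<cdot> \<phi>) R R" if "\<guillemotleft>\<phi> : R \<rightarrow> X\<^sub>0\<guillemotright>" "\<guillemotleft>p : X\<^sub>0 \<rightarrow> R\<guillemotright>" for \<phi> p
    using retract_if_comp_iso[OF that] X_retract e(2) R(2) by blast
  moreover have "\<exists>h. \<guillemotleft>h : X\<^sub>0 \<rightarrow> X\<^sub>0\<guillemotright> \<and> x\<^sub>0 \<cdot> h = x\<^sub>0"
    using ident_arr[OF a(5)] comp_ident_right[OF a(2)] by blast
  ultimately show ?case
    using e(1,2) S(2)
    by (intro exI[of _ K\<^sub>0] exI[of _ \<kappa>\<^sub>0] exI[of _ X\<^sub>0] exI[of _ x\<^sub>0] exI[of _ \<delta>\<^sub>0]) auto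
next
  case (insert g F)
  have Rob: "R \<in> Ob \<C>" using subcategory_Ob[OF S(1) R(1)] .
  have ga: "\<guillemotleft>g : R \<rightarrow> T\<guillemotright>" and Fa: "\<And>f. f \<in> F \<Longrightarrow> \<guillemotleft>f : R \<rightarrow> T\<guillemotright>"
    and insF: "\<And>f. f \<in> insert g F \<Longrightarrow> \<guillemotleft>f : R \<rightarrow> T\<guillemotright>" and F: "F \<subseteq> {f. \<guillemotleft>f : R \<rightarrow> T\<guillemotright>}"
    using insert.prems by auto
  obtain L \<kappa> Y y \<delta> where t: "E_triangle \<C> L \<kappa> Y y T \<delta>" and Y: "Y \<in> \<S>"
    and h0: "\<exists>h. \<guillemotleft>h : X\<^sub>0 \<rightarrow> Y\<guillemotright> \<and> y \<cdot> h = x\<^sub>0" and hF: "\<forall>f\<in>F. \<exists>h. \<guillemotleft>h : R \<rightarrow> Y\<guillemotright> \<and> y \<cdot> h = f"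
    and sp: "\<And>\<phi>. \<guillemotleft>\<phi> : R \<rightarrow> Y\<guillemotright> \<Longrightarrow> y \<cdot> \<phi> \<in> span_mod R T F"
    and un: "\<And>\<phi> p. \<guillemotleft>\<phi> : R \<rightarrow> Y\<guillemotright> \<Longrightarrow> \<guillemotleft>p : Y \<rightarrow> R\<guillemotright> \<Longrightarrow> is_iso \<C> (p \<cdot> \<phi>) R R \<Longrightarrow>
        \<exists>f\<in>F. \<exists>u. \<exists>s\<in>span_mod R T (F - {f}). is_iso \<C> u R R \<and> y \<cdot> \<phi> = f \<cdot> u \<oplus>\<^bsub>Mor \<C> R T\<^esub> s"
    using insert.IH[OF F] by blast
  note a = E_triangle_arr[OF t] note Tob = a(6)
  obtain W i\<^sub>1 i\<^sub>2 p\<^sub>1 p\<^sub>2 where bi: "is_biproduct \<C> R Y W i\<^sub>1 i\<^sub>2 p\<^sub>1 p\<^sub>2" using ex_biproduct[OF Rob a(5)] by blast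
  note b = biproduct_arr[OF bi]
  let ?y = "g \<cdot> p\<^sub>1 \<oplus>\<^bsub>Mor \<C> W T\<^esub> y \<cdot> p\<^sub>2"
  let ?F = "insert g F"
  obtain E h \<epsilon> where t': "E_triangle \<C> E h W ?y T \<epsilon>" using deflation_pair[OF t ga bi] by blast
  note a' = E_triangle_arr[OF t']
  have comp: "?y \<cdot> \<phi> = g \<cdot> (p\<^sub>1 \<cdot> \<phi>) \<oplus>\<^bsub>Mor \<C> R T\<^esub> y \<cdot> (p\<^sub>2 \<cdot> \<phi>)" if "\<guillemotleft>\<phi> : R \<rightarrow> W\<guillemotright>" for \<phi>
    using comp_add_left[OF that comp_arr[OF b(3) ga] comp_arr[OF b(4) a(2)]]
      comp_assoc[OF that b(3) ga] comp_assoc[OF that b(4) a(2)] by simp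
  have lift: "\<exists>k'. \<guillemotleft>k' : V \<rightarrow> W\<guillemotright> \<and> ?y \<cdot> k' = m" if ex: "\<exists>k. \<guillemotleft>k : V \<rightarrow> Y\<guillemotright> \<and> y \<cdot> k = m" for V m
  proof -
    obtain k where k: "\<guillemotleft>k : V \<rightarrow> Y\<guillemotright>" "y \<cdot> k = m" using ex by blast
    have "?y \<cdot> (i\<^sub>2 \<cdot> k) = m" using comp_assoc[OF k(1) b(2) a'(2)] biproduct_pair_inj(2)[OF bi ga a(2)] k(2) by simp
    then show ?thesis using comp_arr[OF k(1) b(2)] by blast
  qed
  have "\<exists>k. \<guillemotleft>k : R \<rightarrow> W\<guillemotright> \<and> ?y \<cdot> k = g" using b(1) biproduct_pair_inj(1)[OF bi ga a(2)] by blast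
  then have 1: "\<forall>f\<in>?F. \<exists>k. \<guillemotleft>k : R \<rightarrow> W\<guillemotright> \<and> ?y \<cdot> k = f" using hF lift by blast
  have gr: "g \<cdot> r \<in> span_mod R T G" if "\<guillemotleft>r : R \<rightarrow> R\<guillemotright>" "g \<in> G" "G \<subseteq> ?F" for r G
    by (rule span_mod_gens[OF Rob Tob]) (use that insert.prems in blast)+
  have 2: "?y \<cdot> \<phi> \<in> span_mod R T ?F" if ph: "\<guillemotleft>\<phi> : R \<rightarrow> W\<guillemotright>" for \<phi>
    unfolding comp[OF ph]
  proof (rule span_mod_add[OF Rob Tob insF])
    show "g \<cdot> (p\<^sub>1 \<cdot> \<phi>) \<in> span_mod R T ?F" using gr[OF comp_arr[OF ph b(3)], of ?F] by blast
    show "y \<cdot> (p\<^sub>2 \<cdot> \<phi>) \<in> span_mod R T ?F"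
      using span_mod_mono[OF Rob Tob _ sp[OF comp_arr[OF ph b(4)]], of ?F] by blast
  qed
  have 3: "\<exists>f\<in>?F. \<exists>u. \<exists>s\<in>span_mod R T (?F - {f}). is_iso \<C> u R R \<and> ?y \<cdot> \<phi> = f \<cdot> u \<oplus>\<^bsub>Mor \<C> R T\<^esub> s"
    if ph: "\<guillemotleft>\<phi> : R \<rightarrow> W\<guillemotright>" and p: "\<guillemotleft>p : W \<rightarrow> R\<guillemotright>" and iso: "is_iso \<C> (p \<cdot> \<phi>) R R" for \<phi> p
  proof -
    note \<phi>1 = comp_arr[OF ph b(3)] and \<phi>2 = comp_arr[OF ph b(4)] and q1 = comp_arr[OF b(1) p] and q2 = comp_arr[OF b(2) p]
    have "p \<cdot> \<phi> = (p \<cdot> i\<^sub>1) \<cdot> (p\<^sub>1 \<cdot> \<phi>) \<oplus>\<^bsub>Mor \<C> R R\<^esub> (p \<cdot> i\<^sub>2) \<cdot> (p\<^sub>2 \<cdot> \<phi>)"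
      using biproduct_decomp[OF bi p] comp_add_left[OF ph comp_arr[OF b(3) q1] comp_arr[OF b(4) q2]]
        comp_assoc[OF ph b(3) q1] comp_assoc[OF ph b(4) q2] by simp
    then consider "is_iso \<C> ((p \<cdot> i\<^sub>1) \<cdot> (p\<^sub>1 \<cdot> \<phi>)) R R" | "is_iso \<C> ((p \<cdot> i\<^sub>2) \<cdot> (p\<^sub>2 \<cdot> \<phi>)) R R"
      using local_sum_iso[OF loc comp_arr[OF \<phi>1 q1] comp_arr[OF \<phi>2 q2]] iso by auto
    then show ?thesis
    proof cases
      case 1
      then obtain w where w: "\<guillemotleft>w : R \<rightarrow> R\<guillemotright>" "w \<cdot> ((p \<cdot> i\<^sub>1) \<cdot> (p\<^sub>1 \<cdot> \<phi>)) = ident \<C> R" unfolding is_iso_def by blast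
      have "(w \<cdot> (p \<cdot> i\<^sub>1)) \<cdot> (p\<^sub>1 \<cdot> \<phi>) = ident \<C> R" using comp_assoc[OF \<phi>1 q1 w(1)] w(2) by simp
      then have iso1: "is_iso \<C> (p\<^sub>1 \<cdot> \<phi>) R R" by (rule local_left_invertible[OF loc \<phi>1 comp_arr[OF q1 w(1)]])
      have "?F - {g} = F" using insert.hyps by blast
      then have "y \<cdot> (p\<^sub>2 \<cdot> \<phi>) \<in> span_mod R T (?F - {g})" using sp[OF \<phi>2] by simp
      then show ?thesis using comp[OF ph] iso1 by blast
    next
      case 2
      obtain f u s where f: "f \<in> F" and s: "s \<in> span_mod R T (F - {f})" and u: "is_iso \<C> u R R"
        and eq: "y \<cdot> (p\<^sub>2 \<cdot> \<phi>) = f \<cdot> u \<oplus>\<^bsub>Mor \<C> R T\<^esub> s" using un[OF \<phi>2 q2 2] by blast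
      have arrs: "\<guillemotleft>g \<cdot> (p\<^sub>1 \<cdot> \<phi>) : R \<rightarrow> T\<guillemotright>" "\<guillemotleft>f \<cdot> u : R \<rightarrow> T\<guillemotright>" "\<guillemotleft>s : R \<rightarrow> T\<guillemotright>"
        using comp_arr[OF \<phi>1 ga] comp_arr[OF _ Fa[OF f]] u span_mod_arr[OF Rob Tob _ s] Fa
        unfolding is_iso_def by blast+
      have fg: "f \<noteq> g" using f insert.hyps by blast
      have "g \<cdot> (p\<^sub>1 \<cdot> \<phi>) \<oplus>\<^bsub>Mor \<C> R T\<^esub> s \<in> span_mod R T (?F - {f})"
      proof (rule span_mod_add[OF Rob Tob])
        show "\<guillemotleft>k : R \<rightarrow> T\<guillemotright>" if "k \<in> ?F - {f}" for k using that insert.prems by blast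
        show "g \<cdot> (p\<^sub>1 \<cdot> \<phi>) \<in> span_mod R T (?F - {f})" using gr[OF \<phi>1, of "?F - {f}"] fg by blast
        show "s \<in> span_mod R T (?F - {f})" using span_mod_mono[OF Rob Tob _ s, of "?F - {f}"] by blast
      qed
      moreover have "?y \<cdot> \<phi> = f \<cdot> u \<oplus>\<^bsub>Mor \<C> R T\<^esub> (g \<cdot> (p\<^sub>1 \<cdot> \<phi>) \<oplus>\<^bsub>Mor \<C> R T\<^esub> s)"
        using comp[OF ph] eq add_arr_assoc[OF arrs] add_arr_assoc[OF arrs(2,1,3)] add_arr_comm[OF arrs(1,2)] by simp
      ultimately show ?thesis using f u by blast
    qed
  qed
  have "W \<in> \<S>" using subcategory_biproduct[OF S(1) bi R(1) Y] .
  moreover have "if ?F = {} then W \<in> \<X> else retract_of \<C> R W" using biproduct_retract[OF bi] by simp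
  ultimately show ?case
    using t' lift[OF h0] 1 2 3
    by (intro exI[of _ E] exI[of _ h] exI[of _ W] exI[of _ ?y] exI[of _ \<epsilon>]) (intro conjI allI impI; assumption?; blast)
qed

text \<open>The key step for uniqueness. The number of copies of \<open>R\<close> in \<open>Y\<close> is minimized by choosing the generating
  set \<open>F\<close> of \<open>Hom(R, T)\<close> modulo \<open>\<X>\<close> of least cardinality.\<close>

lemma rigid_in_cluster_tilting_or_mutate:
  assumes S: "cluster_tilting \<C> \<S>" "\<X> \<subseteq> \<S>" and gen: "generated_by R \<S>"
    and R: "R \<notin> \<X>" "local_ring (End_ring \<C> R)" and ret: "\<And>M. M \<in> \<S> \<Longrightarrow> M \<notin> \<X> \<Longrightarrow> retract_of \<C> R M"
    and T: "T \<in> perp" "Ext_trivial T T"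
  shows "T \<in> \<S> \<or> T \<in> mutate \<S>"
proof -
  have RS: "R \<in> \<S>" using gen unfolding generated_by_def by blast
  note Rob = cluster_tilting_Ob[OF S(1) RS] note Tob = perpD(1)[OF T(1)]
  let ?gen = "\<lambda>F. finite F \<and> (\<forall>f\<in>F. \<guillemotleft>f : R \<rightarrow> T\<guillemotright>) \<and> (\<forall>g. \<guillemotleft>g : R \<rightarrow> T\<guillemotright> \<longrightarrow> g \<in> span_mod R T F)"
  obtain F0 where "?gen F0" using finite_span_mod[OF Rob Tob] by metis
  then obtain F where F: "?gen F" and F_min: "\<And>G. ?gen G \<Longrightarrow> card F \<le> card G"
    using ex_has_least_nat[of ?gen F0 card] by blast
  have Fa: "\<And>f. f \<in> F \<Longrightarrow> \<guillemotleft>f : R \<rightarrow> T\<guillemotright>" using F by blast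
  then have FT: "F \<subseteq> {f. \<guillemotleft>f : R \<rightarrow> T\<guillemotright>}" by blast
  obtain K\<^sub>0 \<kappa>\<^sub>0 X\<^sub>0 x\<^sub>0 \<delta>\<^sub>0 where ex: "exchange_triangle K\<^sub>0 \<kappa>\<^sub>0 X\<^sub>0 x\<^sub>0 T \<delta>\<^sub>0" using ex_exchange_triangle_to[OF T(1)] .
  obtain L \<kappa> Y y \<delta> where t: "E_triangle \<C> L \<kappa> Y y T \<delta>" and Y: "Y \<in> \<S>"
    and h0: "\<exists>h. \<guillemotleft>h : X\<^sub>0 \<rightarrow> Y\<guillemotright> \<and> y \<cdot> h = x\<^sub>0" and hF: "\<forall>f\<in>F. \<exists>h. \<guillemotleft>h : R \<rightarrow> Y\<guillemotright> \<and> y \<cdot> h = f"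
    and Y_case: "if F = {} then Y \<in> \<X> else retract_of \<C> R Y"
    and un: "\<forall>\<phi> p. \<guillemotleft>\<phi> : R \<rightarrow> Y\<guillemotright> \<longrightarrow> \<guillemotleft>p : Y \<rightarrow> R\<guillemotright> \<longrightarrow> is_iso \<C> (p \<cdot> \<phi>) R R \<longrightarrow>
        (\<exists>f\<in>F. \<exists>u. \<exists>s\<in>span_mod R T (F - {f}). is_iso \<C> u R R \<and> y \<cdot> \<phi> = f \<cdot> u \<oplus>\<^bsub>Mor \<C> R T\<^esub> s)"
    using ex_deflation_extension[OF cluster_tilting_subcategory[OF S(1)] S(2) RS R ex F[THEN conjunct1] FT]
    by (elim exE conjE) (rule that; (assumption | (rule exI, rule conjI; assumption)))
  note a = E_triangle_arr[OF t]
  have X_lift: "\<exists>k. \<guillemotleft>k : V \<rightarrow> Y\<guillemotright> \<and> y \<cdot> k = v" if V: "V \<in> \<X>" and v: "\<guillemotleft>v : V \<rightarrow> T\<guillemotright>" for V v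
  proof -
    obtain h where h: "\<guillemotleft>h : X\<^sub>0 \<rightarrow> Y\<guillemotright>" "y \<cdot> h = x\<^sub>0" using h0 by blast
    obtain k where k: "\<guillemotleft>k : V \<rightarrow> X\<^sub>0\<guillemotright>" "x\<^sub>0 \<cdot> k = v"
      using right_approximationD(3)[OF exchange_triangle_right[OF ex] V v] by blast
    have "y \<cdot> (h \<cdot> k) = v" using comp_assoc[OF k(1) h(1) a(2)] h(2) k(2) by simp
    then show ?thesis using comp_arr[OF k(1) h(1)] by blast
  qed
  have pre: "\<exists>k. \<guillemotleft>k : V \<rightarrow> Y\<guillemotright> \<and> y \<cdot> k = v \<cdot> u"
    if w: "\<exists>k. \<guillemotleft>k : W \<rightarrow> Y\<guillemotright> \<and> y \<cdot> k = v" and u: "\<guillemotleft>u : V \<rightarrow> W\<guillemotright>" for V W u v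
  proof -
    obtain k where k: "\<guillemotleft>k : W \<rightarrow> Y\<guillemotright>" "y \<cdot> k = v" using w by blast
    then show ?thesis using comp_assoc[OF u k(1) a(2)] comp_arr[OF u k(1)] by metis
  qed
  have R_lift: "\<exists>k. \<guillemotleft>k : R \<rightarrow> Y\<guillemotright> \<and> y \<cdot> k = v" if v: "\<guillemotleft>v : R \<rightarrow> T\<guillemotright>" for v
  proof -
    have "v \<in> span_mod R T F" using F v by blast
    then show ?thesis
      unfolding span_mod_def
    proof (rule lift_morphism_sums[OF _ a(2) Rob])
      fix g assume "g \<in> through \<C> \<X> R T \<union> {f \<cdot> r | f r. f \<in> F \<and> \<guillemotleft>r : R \<rightarrow> R\<guillemotright>}"
      then consider V u v where "V \<in> \<X>" "\<guillemotleft>u : R \<rightarrow> V\<guillemotright>" "\<guillemotleft>v : V \<rightarrow> T\<guillemotright>" "g = v \<cdot> u"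
        | f r where "f \<in> F" "\<guillemotleft>r : R \<rightarrow> R\<guillemotright>" "g = f \<cdot> r" unfolding through_def by blast
      then show "\<exists>k. \<guillemotleft>k : R \<rightarrow> Y\<guillemotright> \<and> y \<cdot> k = g"
        by cases (use pre X_lift hF in blast)+
    qed
  qed
  \<comment> \<open>\<open>y\<close> is a right \<open>\<S>\<close>-approximation\<close>
  have S_lift: "\<exists>k. \<guillemotleft>k : M \<rightarrow> Y\<guillemotright> \<and> y \<cdot> k = v" if M: "M \<in> \<S>" and v: "\<guillemotleft>v : M \<rightarrow> T\<guillemotright>" for M v
  proof -
    have "ident \<C> M \<in> morphism_sums \<C> M M (through \<C> (insert R \<X>) M M)"
      using gen M unfolding generated_by_def by blast
    from through_sums_from[OF this v] show ?thesis
    proof (rule lift_morphism_sums[OF _ a(2) arr_Ob(1)[OF v]])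
      fix g assume "g \<in> through \<C> (insert R \<X>) M T"
      then obtain V u v where "V \<in> insert R \<X>" "\<guillemotleft>u : M \<rightarrow> V\<guillemotright>" "\<guillemotleft>v : V \<rightarrow> T\<guillemotright>" "g = v \<cdot> u"
        unfolding through_def by blast
      then show "\<exists>k. \<guillemotleft>k : M \<rightarrow> Y\<guillemotright> \<and> y \<cdot> k = g" using pre X_lift R_lift by blast
    qed
  qed
  have "Ext_trivial M L" if M: "M \<in> \<S>" for M
  proof (rule Ext_trivialI[OF cluster_tilting_Ob[OF S(1) M] a(4)])
    note Mob = cluster_tilting_Ob[OF S(1) M]
    fix \<epsilon> assume e: "\<epsilon> \<in> carrier (Ext \<C> M L)"
    have "push \<C> M \<kappa> \<epsilon> = \<zero>\<^bsub>Ext \<C> M Y\<^esub>" using push_closed[OF Mob a(1) e] cluster_tilting_Ext[OF S(1) M Y] by blast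
    then obtain v where v: "\<guillemotleft>v : M \<rightarrow> T\<guillemotright>" "pull \<C> L v \<delta> = \<epsilon>"
      using Ext_from_connecting_right[OF t Mob e] by blast
    obtain k where k: "\<guillemotleft>k : M \<rightarrow> Y\<guillemotright>" "y \<cdot> k = v" using S_lift[OF M v(1)] by blast
    then show "\<epsilon> = \<zero>\<^bsub>Ext \<C> M L\<^esub>"
      using pull_comp[OF a(4,2) k(1) a(3)] E_triangle_pull_zero[OF t] pull_zero[OF a(4) k(1)] v(2) by simp
  qed
  then have L: "L \<in> \<S>"
    using cluster_tilting_mem[OF S(1) a(4)] Ext_trivial_sym cluster_tilting_Ob[OF S(1)] a(4) by blast
  consider "F = {}" | "L \<in> \<X>" | "F \<noteq> {}" "L \<notin> \<X>" by blast
  then show ?thesis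
  proof cases
    case 1
    then have "exchange_triangle L \<kappa> Y y T \<delta>"
      unfolding exchange_triangle_def using t Y_case L T(1) cluster_tilting_perp[OF S] by auto
    then show ?thesis using mutateI[OF _ L] by blast
  next
    case 2
    then have "\<delta> = \<zero>\<^bsub>Ext \<C> T L\<^esub>" using perpD(2)[OF T(1) 2] a(3) by blast
    then show ?thesis
      using subcategory_E_triangle_split(2)[OF cluster_tilting_subcategory[OF S(1)] _ Y] t by simp
  next
    case 3
    obtain i p\<^sub>1 where i: "\<guillemotleft>i : R \<rightarrow> L\<guillemotright>" "\<guillemotleft>p\<^sub>1 : L \<rightarrow> R\<guillemotright>" "p\<^sub>1 \<cdot> i = ident \<C> R"
      using ret[OF L 3(2)] unfolding retract_of_def by blast
    obtain j p where j: "\<guillemotleft>j : R \<rightarrow> Y\<guillemotright>" "\<guillemotleft>p : Y \<rightarrow> R\<guillemotright>" "p \<cdot> j = ident \<C> R"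
      using Y_case 3(1) unfolding retract_of_def by auto
    \<comment> \<open>contradiction: \<open>R\<close> is a retract of both \<open>L\<close> and \<open>Y\<close>\<close>
    let ?g = "j \<cdot> p\<^sub>1"
    note g = comp_arr[OF i(2) j(1)]
    have "push \<C> T (y \<cdot> ?g) \<delta> = \<zero>\<^bsub>Ext \<C> T T\<^esub>" using push_closed[OF a(6) comp_arr[OF g a(2)] a(3)] T(2) by blast
    then obtain h where h: "\<guillemotleft>h : Y \<rightarrow> T\<guillemotright>" "h \<cdot> \<kappa> = y \<cdot> ?g"
      using factors_through_inflation[OF t comp_arr[OF g a(2)]] by blast
    obtain h' where h': "\<guillemotleft>h' : Y \<rightarrow> Y\<guillemotright>" "y \<cdot> h' = h" using S_lift[OF Y h(1)] by blast
    note k = comp_arr[OF a(1) h'(1)] note n = neg_arr[OF k]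
    let ?d = "?g \<oplus>\<^bsub>Mor \<C> L Y\<^esub> (\<ominus>\<^bsub>Mor \<C> L Y\<^esub> (h' \<cdot> \<kappa>))"
    have "y \<cdot> ?d = \<zero>\<^bsub>Mor \<C> L T\<^esub>"
      using comp_add_right[OF g n a(2)] comp_neg_right[OF k a(2)] comp_assoc[OF a(1) h'(1) a(2)] h(2) h'(2)
        add_neg_arr(1)[OF comp_arr[OF g a(2)]] by simp
    then obtain b where b: "\<guillemotleft>b : L \<rightarrow> L\<guillemotright>" "\<kappa> \<cdot> b = ?d" using factors_through_kernel[OF t add_arr[OF g n]] by blast
    \<comment> \<open>rigidity of \<open>T\<close> gives the decomposition of \<open>j p\<^sub>1\<close>\<close>
    have g_eq: "?g = \<kappa> \<cdot> b \<oplus>\<^bsub>Mor \<C> L Y\<^esub> h' \<cdot> \<kappa>"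
      using b(2) add_arr_assoc[OF g n k] add_neg_arr(2)[OF k] add_zero_arr(1)[OF g] by simp
    note bi = comp_arr[OF i(1) b(1)] note \<phi>1 = comp_arr[OF bi a(1)] and \<phi>2 = comp_arr[OF i(1) a(1)]
    have "ident \<C> R = p \<cdot> (?g \<cdot> i)"
      using comp_assoc[OF i(1,2) j(1)] i(3) comp_ident_right[OF j(1)] j(3) by simp
    also have "?g \<cdot> i = \<kappa> \<cdot> (b \<cdot> i) \<oplus>\<^bsub>Mor \<C> R Y\<^esub> h' \<cdot> (\<kappa> \<cdot> i)"
      unfolding g_eq using comp_add_left[OF i(1) comp_arr[OF b(1) a(1)] k] comp_assoc[OF i(1) b(1) a(1)]
        comp_assoc[OF i(1) a(1) h'(1)] by simp
    also have "p \<cdot> \<dots> = p \<cdot> (\<kappa> \<cdot> (b \<cdot> i)) \<oplus>\<^bsub>Mor \<C> R R\<^esub> (p \<cdot> h') \<cdot> (\<kappa> \<cdot> i)"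
      using comp_add_right[OF \<phi>1 comp_arr[OF \<phi>2 h'(1)] j(2)] comp_assoc[OF \<phi>2 h'(1) j(2)] by simp
    finally have "is_iso \<C> (p \<cdot> (\<kappa> \<cdot> (b \<cdot> i)) \<oplus>\<^bsub>Mor \<C> R R\<^esub> (p \<cdot> h') \<cdot> (\<kappa> \<cdot> i)) R R"
      using is_iso_ident[OF Rob] by simp
    then have "is_iso \<C> (p \<cdot> (\<kappa> \<cdot> (b \<cdot> i))) R R \<or> is_iso \<C> ((p \<cdot> h') \<cdot> (\<kappa> \<cdot> i)) R R"
      by (rule local_sum_iso[OF R(2) comp_arr[OF \<phi>1 j(2)] comp_arr[OF \<phi>2 comp_arr[OF h'(1) j(2)]]])
    then obtain w q where w: "\<guillemotleft>w : R \<rightarrow> L\<guillemotright>" and q: "\<guillemotleft>q : Y \<rightarrow> R\<guillemotright>" and iso: "is_iso \<C> (q \<cdot> (\<kappa> \<cdot> w)) R R"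
      using bi i(1) j(2) comp_arr[OF h'(1) j(2)] by blast
    have yw: "y \<cdot> (\<kappa> \<cdot> w) = \<zero>\<^bsub>Mor \<C> R T\<^esub>"
      using comp_assoc[OF w a(1,2)] E_triangle_comp_zero[OF t] comp_zero_left[OF w a(6)] by simp
    \<comment> \<open>\<open>f u = - s\<close> with \<open>u\<close> invertible makes \<open>f\<close> superfluous as a generator\<close>
    obtain f u s where f: "f \<in> F" and s: "s \<in> span_mod R T (F - {f})" and u: "is_iso \<C> u R R"
      and eq: "\<zero>\<^bsub>Mor \<C> R T\<^esub> = f \<cdot> u \<oplus>\<^bsub>Mor \<C> R T\<^esub> s"
      using un[rule_format, OF comp_arr[OF w a(1)] q iso] yw by auto
    have Fa': "\<guillemotleft>k : R \<rightarrow> T\<guillemotright>" if "k \<in> F - {f}" for k using Fa that by blast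
    obtain u' where u': "\<guillemotleft>u : R \<rightarrow> R\<guillemotright>" "\<guillemotleft>u' : R \<rightarrow> R\<guillemotright>" "u \<cdot> u' = ident \<C> R" using u unfolding is_iso_def by blast
    note fa = Fa[OF f] note fu = comp_arr[OF u'(1) fa] note sa = span_mod_arr[OF Rob Tob Fa' s]
    have "f \<cdot> u = \<ominus>\<^bsub>Mor \<C> R T\<^esub> s"
      using neg_arr_unique[OF sa fu] eq add_arr_comm[OF sa fu] by simp
    then have "f \<cdot> u \<in> span_mod R T (F - {f})" using span_mod_neg[OF Rob Tob Fa' s] by simp
    from span_mod_comp[OF Rob Tob Fa' this u'(2)] have f_in: "f \<in> span_mod R T (F - {f})"
      using comp_assoc[OF u'(2,1) fa] u'(3) comp_ident_right[OF fa] by simp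
    have "F \<subseteq> span_mod R T (F - {f})"
    proof
      fix k assume "k \<in> F"
      show "k \<in> span_mod R T (F - {f})"
      proof (cases "k = f")
        case True then show ?thesis using f_in by simp
      next
        case False
        then have "k \<in> F - {f}" using \<open>k \<in> F\<close> by blast
        then have "k \<cdot> ident \<C> R \<in> span_mod R T (F - {f})"
          using ident_arr[OF Rob] by (intro span_mod_gens[OF Rob Tob Fa']) blast+
        then show ?thesis using comp_ident_right[OF Fa[OF \<open>k \<in> F\<close>]] by simp
      qed
    qed
    then have "?gen (F - {f})" using F Fa' span_mod_trans[OF Rob Tob Fa'] by blast
    then have "card F \<le> card (F - {f})" by (rule F_min)
    then show ?thesis using card_Diff1_less[OF _ f] F by fastforce
  qed
qed

end

section \<open>The two completions\<close>

theorem theorem3p8: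
  fixes K :: "('k, 'r) ring_scheme"
    and \<C> :: "('o, 'm, 'k, 'e, 'z) preextri_scheme"
    and \<X> :: "'o set"
  assumes "two_calabi_yau_extriangulated_category K \<C>"
    and "krull_schmidt_category \<C>"
    and "enough_projectives \<C>"
    and "enough_injectives \<C>"
    and "almost_complete_cluster_tilting \<C> \<X>"
  shows "\<exists>\<R> \<Q>. \<R> \<noteq> \<Q> \<and>
           {\<T>. cluster_tilting \<C> \<T> \<and> \<X> \<subseteq> \<T>} = {\<R>, \<Q>} \<and>
           mutation_pair \<C> \<X> \<R> \<Q> \<and> mutation_pair \<C> \<X> \<Q> \<R>"
proof -
  interpret two_calabi_yau_extriangulated_category K \<C> by (rule assms(1))
  interpret KS: krull_schmidt_category \<C> by (rule assms(2))
  obtain \<R> R\<^sub>0 where X: "rigid \<C> \<X>" "functorially_finite \<C> \<X>" "Proj \<C> \<subseteq> \<X>"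
    and \<R>: "cluster_tilting \<C> \<R>" "\<X> \<subseteq> \<R>" and R0: "indecomposable \<C> R\<^sub>0"
    and R0_X: "\<And>X. X \<in> \<X> \<Longrightarrow> \<not> isomorphic \<C> R\<^sub>0 X"
    and ind: "\<And>M. indecomposable \<C> M \<Longrightarrow> M \<in> \<R> \<longleftrightarrow> M \<in> \<X> \<or> isomorphic \<C> M R\<^sub>0"
    using assms(5) unfolding almost_complete_cluster_tilting_def by blast
  interpret rigid_containing_projectives K \<C> \<X> by unfold_locales (use assms X in auto)
  have R0ob: "R\<^sub>0 \<in> Ob \<C>" using R0 unfolding indecomposable_def by blast
  have R0_refl: "isomorphic \<C> R\<^sub>0 R\<^sub>0" unfolding isomorphic_def using is_iso_ident[OF R0ob] by blast
  have R0_R: "R\<^sub>0 \<in> \<R>" using ind[OF R0] R0_refl by blast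
  have R0_nX: "R\<^sub>0 \<notin> \<X>" using R0_X R0_refl by blast
  have decomp: "\<exists>n B. is_direct_sum \<C> n B M \<and> (\<forall>j<n. local_ring (End_ring \<C> (B j)) \<and> B j \<in> \<R> \<and>
      (B j \<in> \<X> \<or> isomorphic \<C> (B j) R\<^sub>0))" if M: "M \<in> \<R>" for M
  proof -
    obtain n B where B: "\<forall>j<n. B j \<in> Ob \<C> \<and> local_ring (End_ring \<C> (B j))" "is_direct_sum \<C> n B M"
      using KS.krull_schmidt[OF cluster_tilting_Ob[OF \<R>(1) M]] by metis
    have "B j \<in> \<R>" if "j < n" for j using cluster_tilting_retract[OF \<R>(1) M direct_sum_retract[OF B(2) that]] .
    then show ?thesis using B local_indecomposable ind by blast
  qed
  obtain n B where B: "is_direct_sum \<C> n B R\<^sub>0" "\<forall>j<n. local_ring (End_ring \<C> (B j)) \<and> B j \<in> \<R> \<and>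
      (B j \<in> \<X> \<or> isomorphic \<C> (B j) R\<^sub>0)" using decomp[OF R0_R] by blast
  obtain j where j: "j < n" "B j \<notin> \<X>" using subcategory_direct_sum[OF subcategory_X B(1)] R0_nX by metis
  \<comment> \<open>\<open>L\<close> is a copy of \<open>R\<^sub>0\<close> whose endomorphism ring is known to be local\<close>
  define L where "L = B j"
  have L: "local_ring (End_ring \<C> L)" "L \<in> \<R>" "L \<notin> \<X>" "isomorphic \<C> R\<^sub>0 L"
    using B(2) j isomorphic_sym unfolding L_def by blast+
  have ret: "retract_of \<C> L M" if M: "M \<in> \<R>" "M \<notin> \<X>" for M
  proof -
    obtain n B where B: "is_direct_sum \<C> n B M" "\<forall>j<n. local_ring (End_ring \<C> (B j)) \<and> B j \<in> \<R> \<and>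
      (B j \<in> \<X> \<or> isomorphic \<C> (B j) R\<^sub>0)" using decomp[OF M(1)] by blast
    obtain j where j: "j < n" "B j \<notin> \<X>" using subcategory_direct_sum[OF subcategory_X B(1)] M(2) by metis
    have "isomorphic \<C> (B j) L" using B(2) j isomorphic_trans[OF _ L(4)] by blast
    then show ?thesis using retract_of_trans[OF isomorphic_retract direct_sum_retract[OF B(1) j(1)]] isomorphic_sym by blast
  qed
  have gen: "generated_by L \<R>"
    unfolding generated_by_def
  proof (intro conjI ballI L(2))
    fix M assume M: "M \<in> \<R>"
    obtain n B where B: "is_direct_sum \<C> n B M" "\<forall>j<n. local_ring (End_ring \<C> (B j)) \<and> B j \<in> \<R> \<and>
      (B j \<in> \<X> \<or> isomorphic \<C> (B j) R\<^sub>0)" using decomp[OF M] by blast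
    show "ident \<C> M \<in> morphism_sums \<C> M M (through \<C> (insert L \<X>) M M)"
    proof (rule ident_direct_sum[OF B(1)])
      fix j assume j: "j < n"
      have "isomorphic \<C> (B j) (B j)"
        unfolding isomorphic_def using is_iso_ident cluster_tilting_Ob[OF \<R>(1)] B(2) j by blast
      then show "\<exists>Y\<in>insert L \<X>. isomorphic \<C> (B j) Y"
        using B(2) j isomorphic_trans[OF _ L(4)] by blast
    qed
  qed
  let ?Q = "mutate \<R>"
  obtain L' where Q: "cluster_tilting \<C> ?Q" and genQ: "generated_by L' ?Q" using cluster_tilting_mutate[OF \<R> gen] .
  have XQ: "\<X> \<subseteq> ?Q" using X_subset_mutate[OF \<R>] .
  have nX: "\<R> \<noteq> \<X>" using R0_R R0_nX by blast
  have neq: "?Q \<noteq> \<R>" by (rule mutate_neq[OF \<R> nX])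
  have two: "\<T> = \<R> \<or> \<T> = ?Q" if \<T>: "cluster_tilting \<C> \<T>" "\<X> \<subseteq> \<T>" for \<T>
  proof -
    have each: "T \<in> \<R> \<or> T \<in> ?Q" if T: "T \<in> \<T>" for T
      using rigid_in_cluster_tilting_or_mutate[OF \<R> gen L(3,1) ret] cluster_tilting_perp[OF \<T>]
        cluster_tilting_Ext[OF \<T>(1)] T by blast
    \<comment> \<open>otherwise the sum of an object outside \<open>\<R>\<close> and one outside \<open>?Q\<close> lies in neither\<close>
    have "\<T> \<subseteq> \<R> \<or> \<T> \<subseteq> ?Q"
    proof (rule ccontr)
      assume "\<not> (\<T> \<subseteq> \<R> \<or> \<T> \<subseteq> ?Q)"
      then obtain A B where AB: "A \<in> \<T>" "A \<notin> \<R>" "B \<in> \<T>" "B \<notin> ?Q" by blast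
      obtain S i\<^sub>1 i\<^sub>2 p\<^sub>1 p\<^sub>2 where bi: "is_biproduct \<C> A B S i\<^sub>1 i\<^sub>2 p\<^sub>1 p\<^sub>2"
        using ex_biproduct cluster_tilting_Ob[OF \<T>(1)] AB by blast
      have "S \<in> \<T>" using subcategory_biproduct[OF cluster_tilting_subcategory[OF \<T>(1)] bi AB(1,3)] .
      then show False
        using each subcategory_summand(1)[OF cluster_tilting_subcategory[OF \<R>(1)] bi]
          subcategory_summand(2)[OF cluster_tilting_subcategory[OF Q] bi] AB by blast
    qed
    then show ?thesis using cluster_tilting_maximal[OF _ \<T>(1)] \<R>(1) Q by blast
  qed
  have "cluster_tilting \<C> (mutate ?Q)" "\<X> \<subseteq> mutate ?Q"
    using cluster_tilting_mutate[OF Q XQ genQ] X_subset_mutate[OF Q XQ] by auto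
  moreover have "?Q \<noteq> \<X>" using cluster_tilting_maximal[OF \<R>(1) Q] \<R>(2) neq by metis
  then have "mutate ?Q \<noteq> ?Q" by (rule mutate_neq[OF Q XQ])
  ultimately have QQ: "mutate ?Q = \<R>" using two by blast
  have "{\<T>. cluster_tilting \<C> \<T> \<and> \<X> \<subseteq> \<T>} = {\<R>, ?Q}" using two \<R> Q XQ by blast
  then show ?thesis
    using neq mutation_pair_mutate[OF \<R>] mutation_pair_mutate[OF Q XQ] unfolding QQ by blast
qed

end
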